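(* Fix $2<p<\infty$ and $\alpha>0$, and let $X=\{(\lambda,m_\lambda)\}_{\lambda\in\Lambda}$ denote a divisor. (a) If $X$ is a sampling divisor for $\mathcal F^p_\alpha$, then $X$ satisfies the finite overlap condition and there exists $C>0$ such that $$\bigcup_{\lambda\in\Lambda} D(\lambda,\sqrt{m_\lambda/\alpha}+C)=\mathbb C.$$ (b) Conversely, let the divisor $X$ satisfy the finite overlap condition. There exists $C=C(S_X)>0$ (depending only on $S_X$, for the fixed $p$ and $\alpha$) such that if for some compact subset $K$ of $\mathbb C$ we have $$\bigcup_{\lambda\in\Lambda,\ m_\lambda>\alpha C^2} D(\lambda,\sqrt{m_\lambda/\alpha}-C)=\mathbb C\setminus K,$$ then $X$ is a sampling divisor for $\mathcal F^p_\alpha$.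
   Context: $D(z,r)$ is the open disc of radius $r$ centered at $z\in\mathbb C$; $dm$ is Lebesgue area measure. $\mathcal F^p_\alpha$ is the Banach space of entire functions $f$ such that $f(z)e^{-\alpha|z|^2/2}\in L^p(\mathbb C)$, with $\|f\|_p^p=\int_{\mathbb C}|f(z)|^pe^{-p\alpha|z|^2/2}dm(z)$. A divisor is $X=\{(\lambda,m_\lambda)\}_{\lambda\in\Lambda}$, where $\Lambda$ is a sequence of (distinct) points in $\mathbb C$ and $m_\lambda\in\{1,2,3,\dots\}$ is the multiplicity associated with $\lambda$. Put $N^p_\lambda=\{f\in\mathcal F^p_\alpha: f(\lambda)=f'(\lambda)=\dots=f^{(m_\lambda-1)}(\lambda)=0\}$, and let $\|f\|_{\mathcal F^p_\alpha/N^p_\lambda}=\inf_{g\in N^p_\lambda}\|f-g\|_p$ be the quotient norm. $X$ is called sampling for $\mathcal F^p_\alpha$ if there are constants $0<c\le C'<\infty$ such that $c\|f\|_p^p\le\sum_{\lambda\in\Lambda}\|f\|^p_{\mathcal F^p_\alpha/N^p_\lambda}\le C'\|f\|_p^p$ for all $f\in\mathcal F^p_\alpha$. $X$ satisfies the finite overlap condition if $S_X=\sup_{z\in\mathbb C}\sum_{\lambda\in\Lambda}\chi_{D(\lambda,\sqrt{m_\lambda/\alpha})}(z)<\infty$. *)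

theory Defs
  imports "HOL-Complex_Analysis.Complex_Analysis"
begin

text \<open>
  The \<open>p\<close>-th power of the modulus of \<open>f z * exp (- \<alpha> * (cmod z)\<^sup>2 / 2)\<close>; membership of the latter
  in \<open>L\<^sup>p\<close> is integrability of this integrand, measurability being automatic for entire \<open>f\<close>.
\<close>

definition fock_integrand :: "real \<Rightarrow> real \<Rightarrow> (complex \<Rightarrow> complex) \<Rightarrow> complex \<Rightarrow> real" where
  "fock_integrand p \<alpha> f z = cmod (f z) powr p * exp (- (p * \<alpha> * (cmod z)\<^sup>2 / 2))"

definition fock_space :: "real \<Rightarrow> real \<Rightarrow> (complex \<Rightarrow> complex) set" where
  "fock_space p \<alpha> = {f. f holomorphic_on UNIV \<and> integrable lborel (fock_integrand p \<alpha> f)}"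

definition fock_norm :: "real \<Rightarrow> real \<Rightarrow> (complex \<Rightarrow> complex) \<Rightarrow> real" where
  "fock_norm p \<alpha> f = (LINT z|lborel. fock_integrand p \<alpha> f z) powr (1 / p)"

definition vanishing_space :: "real \<Rightarrow> real \<Rightarrow> complex \<Rightarrow> nat \<Rightarrow> (complex \<Rightarrow> complex) set" where
  "vanishing_space p \<alpha> l k = {f \<in> fock_space p \<alpha>. \<forall>j<k. (deriv ^^ j) f l = 0}"

definition quotient_norm :: "real \<Rightarrow> real \<Rightarrow> complex \<Rightarrow> nat \<Rightarrow> (complex \<Rightarrow> complex) \<Rightarrow> real" where
  "quotient_norm p \<alpha> l k f =
     (INF g\<in>vanishing_space p \<alpha> l k. fock_norm p \<alpha> (\<lambda>z. f z - g z))"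

text \<open>
  A divisor is given by the set \<open>\<Lambda>\<close> of its points together with a multiplicity function \<open>m\<close>,
  whose values outside \<open>\<Lambda>\<close> are irrelevant. A sequence of distinct points is rendered as a countable
  (possibly finite) set.
\<close>

definition divisor :: "complex set \<Rightarrow> (complex \<Rightarrow> nat) \<Rightarrow> bool" where
  "divisor \<Lambda> m \<longleftrightarrow> countable \<Lambda> \<and> (\<forall>l\<in>\<Lambda>. 1 \<le> m l)"

text \<open>
  The sums over \<open>\<Lambda>\<close> are taken in \<open>[0, \<infinity>]\<close>, where they always exist; so the upper sampling bound
  and the finiteness of the overlap constant carry the assertion of convergence.
\<close>

definition sampling :: "real \<Rightarrow> real \<Rightarrow> complex set \<Rightarrow> (complex \<Rightarrow> nat) \<Rightarrow> bool" where
  "sampling p \<alpha> \<Lambda> m \<longleftrightarrow>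
     (\<exists>c C'. 0 < c \<and> c \<le> C' \<and>
       (\<forall>f\<in>fock_space p \<alpha>.
          ennreal (c * fock_norm p \<alpha> f powr p)
            \<le> (\<Sum>\<^sub>\<infinity>l\<in>\<Lambda>. ennreal (quotient_norm p \<alpha> l (m l) f powr p)) \<and>
          (\<Sum>\<^sub>\<infinity>l\<in>\<Lambda>. ennreal (quotient_norm p \<alpha> l (m l) f powr p))
            \<le> ennreal (C' * fock_norm p \<alpha> f powr p)))"

definition overlap_const :: "real \<Rightarrow> complex set \<Rightarrow> (complex \<Rightarrow> nat) \<Rightarrow> ennreal" where
  "overlap_const \<alpha> \<Lambda> m =
     (SUP z. \<Sum>\<^sub>\<infinity>l\<in>\<Lambda>. indicator (ball l (sqrt (real (m l) / \<alpha>))) z)"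

definition finite_overlap :: "real \<Rightarrow> complex set \<Rightarrow> (complex \<Rightarrow> nat) \<Rightarrow> bool" where
  "finite_overlap \<alpha> \<Lambda> m \<longleftrightarrow> overlap_const \<alpha> \<Lambda> m < \<infinity>"

end

theory Submission
  imports Defs
begin

text \<open>
  Everything rests on two estimates for a single disc \<open>D = ball l (sqrt (m / \<alpha>))\<close>. First, the quotient norm
  at \<open>l\<close> is controlled by the \<open>p\<close>-mass of \<open>f\<close> on \<open>D\<close>: an average of Taylor polynomials of degrees between
  \<open>m\<close> and \<open>m + O(sqrt m)\<close> is congruent to \<open>f\<close> modulo functions vanishing to order \<open>m\<close>, and it is given by
  an integral over a thin annulus near the boundary of \<open>D\<close> whose weighted kernel is dominated by an integrable
  convolution kernel. Secondly, a function vanishing to order \<open>m\<close> at \<open>l\<close> has only the fraction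
  \<open>exp (- p * \<alpha> * C\<^sup>2 / 2)\<close> of its mass on \<open>D\<close> inside the disc shrunk by \<open>C\<close>; so on the shrunk disc \<open>f\<close> is
  controlled by the quotient norm, up to a small multiple of its mass on \<open>D\<close>.

  With finite overlap the first estimate sums to the upper sampling bound, and the second one to the lower
  bound when the shrunk discs cover the plane. A compact exceptional set is handled by a normal families
  argument, which requires that a function in the Fock space vanishing on the divisor is zero; this follows from
  a maximum principle with arbitrarily strong polynomial weights. Conversely, testing a sampling divisor on the
  reproducing kernels gives the finite overlap condition and the covering by enlarged discs.
\<close>

subsection \<open>Area integrals over the complex plane\<close>

text \<open>A plain Taylor polynomial has the kernel \<open>w ^ m / (1 - w)\<close>, whose weighted
  modulus decays only like the inverse distance along the boundary circle; an absolute bound would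
  lose a factor growing with \<open>m\<close>. Averaging over about \<open>sqrt m\<close> degrees is
  affordable because the Gaussian drop away from the circle, on the scale
  \<open>1 / sqrt \<alpha>\<close>, beats the change of degree.

  The constant in (b) comes from absorption: the second estimate, summed, bounds the mass outside
  \<open>K\<close> by a multiple of the quotient sum plus
  \<open>4 powr p * S * exp (- (p * \<alpha> * C\<^sup>2 / 2))\<close> times the total mass, and
  \<open>C\<close> makes this factor at most 1/2.

  For uniqueness, the contraction on a single disc says nothing while the maximum of the weighted
  modulus lies in \<open>K\<close>. Strong weights cure this, but a maximum is only guaranteed for
  bounded ones, and these are moduli of holomorphic functions only approximately and only on discs
  missing the origin. Finite overlap leaves finitely many other discs, which are added to the
  exceptional set.\<close>

lemma measurable_Complex [measurable]:
  "(\<lambda>(x, y). Complex x y) \<in> borel_measurable (borel \<Otimes>\<^sub>M borel)"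
  unfolding Complex_eq case_prod_beta by measurable

text \<open>Both measures give a box the product of its side lengths, which determines Lebesgue
  measure. This is the entry point for Fubini in real and imaginary parts.\<close>

lemma lborel_complex_eq_distr:
  "(lborel :: complex measure) = distr (lborel \<Otimes>\<^sub>M lborel) borel (\<lambda>(x, y). Complex x y)"
proof (rule lborel_eqI)
  fix l u :: complex
  assume le: "\<And>b. b \<in> Basis \<Longrightarrow> l \<bullet> b \<le> u \<bullet> b"
  have "(\<lambda>(x, y). Complex x y) -` box l u \<inter> space (lborel \<Otimes>\<^sub>M lborel)
      = box (Re l) (Re u) \<times> box (Im l) (Im u)"
    by (auto simp: space_pair_measure in_box_complex_iff box_real)
  then have "emeasure (distr (lborel \<Otimes>\<^sub>M lborel) borel (\<lambda>(x, y). Complex x y)) (box l u)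
      = emeasure (lborel \<Otimes>\<^sub>M lborel) (box (Re l) (Re u) \<times> box (Im l) (Im u))"
    by (subst emeasure_distr) auto
  also have "\<dots> = ennreal (Re u - Re l) * ennreal (Im u - Im l)"
    using le[of 1] le[of \<i>] by (subst lborel.emeasure_pair_measure_Times) (auto simp: Basis_complex_def)
  also have "\<dots> = ennreal (\<Prod>b\<in>Basis. (u - l) \<bullet> b)"
    using le[of 1] le[of \<i>] by (simp add: Basis_complex_def ennreal_mult)
  finally show "emeasure (distr (lborel \<Otimes>\<^sub>M lborel) borel (\<lambda>(x, y). Complex x y)) (box l u)
      = ennreal (\<Prod>b\<in>Basis. (u - l) \<bullet> b)" .
qed simp

lemma nn_integral_complex:
  assumes [measurable]: "g \<in> borel_measurable borel"
  shows "(\<integral>\<^sup>+z. g z \<partial>lborel) = (\<integral>\<^sup>+x. \<integral>\<^sup>+y. g (Complex x y) \<partial>lborel \<partial>lborel)"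
proof -
  have "(\<integral>\<^sup>+z. g z \<partial>lborel) = (\<integral>\<^sup>+v. g (case v of (x, y) \<Rightarrow> Complex x y) \<partial>(lborel \<Otimes>\<^sub>M lborel))"
    by (subst lborel_complex_eq_distr, subst nn_integral_distr) auto
  also have "\<dots> = (\<integral>\<^sup>+x. \<integral>\<^sup>+y. g (Complex x y) \<partial>lborel \<partial>lborel)"
    by (subst lborel.nn_integral_fst[symmetric]) auto
  finally show ?thesis .
qed

lemma nn_integral_complex_swap:
  assumes [measurable]: "g \<in> borel_measurable borel"
  shows "(\<integral>\<^sup>+z. g z \<partial>lborel) = (\<integral>\<^sup>+y. \<integral>\<^sup>+x. g (Complex x y) \<partial>lborel \<partial>lborel)"
  unfolding nn_integral_complex[OF assms]
  by (rule lborel_pair.Fubini') (use measurable_compose[OF measurable_Complex assms] in \<open>simp add: case_prod_beta\<close>)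

lemma nn_integral_shear_Re:
  assumes [measurable]: "g \<in> borel_measurable (borel :: complex measure)"
  shows "(\<integral>\<^sup>+z. g (z + of_real (t * Im z)) \<partial>lborel) = (\<integral>\<^sup>+z. g z \<partial>lborel)"
proof -
  have "(\<integral>\<^sup>+z. g (z + of_real (t * Im z)) \<partial>lborel)
      = (\<integral>\<^sup>+y. \<integral>\<^sup>+x. g (Complex (t * y + 1 * x) y) \<partial>lborel \<partial>lborel)"
    by (subst nn_integral_complex_swap) (auto simp: Complex_eq algebra_simps)
  also have "\<dots> = (\<integral>\<^sup>+y. \<integral>\<^sup>+x. g (Complex x y) \<partial>lborel \<partial>lborel)"
    proof (rule nn_integral_cong)
    fix y
    show "(\<integral>\<^sup>+x. g (Complex (t * y + 1 * x) y) \<partial>lborel) = (\<integral>\<^sup>+x. g (Complex x y) \<partial>lborel)"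
      using nn_integral_real_affine[of "\<lambda>x. g (Complex x y)" 1 "t * y"]
      by (simp add: Complex_eq)
  qed
  also have "\<dots> = (\<integral>\<^sup>+z. g z \<partial>lborel)"
    by (rule nn_integral_complex_swap[symmetric]) auto
  finally show ?thesis .
qed

lemma nn_integral_shear_Im:
  assumes [measurable]: "g \<in> borel_measurable (borel :: complex measure)"
  shows "(\<integral>\<^sup>+z. g (z + \<i> * of_real (t * Re z)) \<partial>lborel) = (\<integral>\<^sup>+z. g z \<partial>lborel)"
proof -
  have "(\<integral>\<^sup>+z. g (z + \<i> * of_real (t * Re z)) \<partial>lborel)
      = (\<integral>\<^sup>+x. \<integral>\<^sup>+y. g (Complex x (t * x + 1 * y)) \<partial>lborel \<partial>lborel)"
    by (subst nn_integral_complex) (auto simp: Complex_eq algebra_simps)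
  also have "\<dots> = (\<integral>\<^sup>+x. \<integral>\<^sup>+y. g (Complex x y) \<partial>lborel \<partial>lborel)"
    proof (rule nn_integral_cong)
    fix x
    show "(\<integral>\<^sup>+y. g (Complex x (t * x + 1 * y)) \<partial>lborel) = (\<integral>\<^sup>+y. g (Complex x y) \<partial>lborel)"
      using nn_integral_real_affine[of "\<lambda>y. g (Complex x y)" 1 "t * x"]
      by (simp add: Complex_eq)
  qed
  also have "\<dots> = (\<integral>\<^sup>+z. g z \<partial>lborel)"
    by (rule nn_integral_complex[symmetric]) auto
  finally show ?thesis .
qed

lemma nn_integral_affine_complex:
  fixes g :: "complex \<Rightarrow> ennreal"
  assumes [measurable]: "g \<in> borel_measurable borel" and c: "c \<noteq> 0"
  shows "(\<integral>\<^sup>+z. g z \<partial>lborel) = ennreal (c\<^sup>2) * (\<integral>\<^sup>+z. g (w + of_real c * z) \<partial>lborel)"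
  by (subst lborel_affine[OF c, of w])
     (simp add: nn_integral_density nn_integral_distr nn_integral_cmult scaleR_conv_of_real)

text \<open>A rotation by an angle other than \<open>\<pi>\<close> is a product of three shears.\<close>

lemma nn_integral_rotate:
  fixes g :: "complex \<Rightarrow> ennreal"
  assumes [measurable]: "g \<in> borel_measurable borel" and c: "cmod c = 1"
  shows "(\<integral>\<^sup>+z. g (z * c) \<partial>lborel) = (\<integral>\<^sup>+z. g z \<partial>lborel)"
proof (cases "c = -1")
  case True
  then show ?thesis
    using nn_integral_affine_complex[of g "-1" 0] by simp
next
  case False
  define a b where "a = Re c" and "b = Im c"
  have ab: "a\<^sup>2 + b\<^sup>2 = 1"
    using c by (simp add: a_def b_def cmod_def)
  have "1 + a \<noteq> 0"
  proof
    assume "1 + a = 0"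
    then have "a = -1" by simp
    with ab have "b = 0" by simp
    with \<open>a = -1\<close> False show False by (simp add: a_def b_def complex_eq_iff)
  qed
  \<comment> \<open>For a rotation by the angle \<theta> this is
    \<open>- tan (\<theta> / 2)\<close>, finite because \<open>c\<close> is not -1; the middle shear
    has slope \<open>sin \<theta>\<close>.\<close>
  define t where "t = - b / (1 + a)"
  have t: "t * (1 + a) = - b" "1 + t * b = a"
    using \<open>1 + a \<noteq> 0\<close> ab by (auto simp: t_def field_simps power2_eq_square)
  define s1 s2 :: "complex \<Rightarrow> complex" where "s1 z = z + of_real (t * Im z)"
    and "s2 z = z + \<i> * of_real (b * Re z)" for z
  have [measurable]: "s1 \<in> borel_measurable borel" "s2 \<in> borel_measurable borel"
    unfolding s1_def s2_def by measurable
  have "s1 (s2 (s1 z)) = z * c" for z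
  proof (rule complex_eqI)
    have "Re (s1 (s2 (s1 z))) = (1 + t * b) * Re z + (t + (1 + t * b) * t) * Im z"
      by (simp add: s1_def s2_def algebra_simps)
    also have "\<dots> = a * Re z - b * Im z"
      using t by (simp add: algebra_simps)
    finally show "Re (s1 (s2 (s1 z))) = Re (z * c)"
      by (simp add: a_def b_def)
    have "Im (s1 (s2 (s1 z))) = b * Re z + (1 + t * b) * Im z"
      by (simp add: s1_def s2_def algebra_simps)
    also have "\<dots> = b * Re z + a * Im z"
      by (simp only: t(2))
    finally show "Im (s1 (s2 (s1 z))) = Im (z * c)"
      by (simp add: a_def b_def algebra_simps)
  qed
  then have "(\<integral>\<^sup>+z. g (z * c) \<partial>lborel) = (\<integral>\<^sup>+z. g (s1 (s2 (s1 z))) \<partial>lborel)"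
    by simp
  also have "\<dots> = (\<integral>\<^sup>+z. g z \<partial>lborel)"
    using nn_integral_shear_Re[of "\<lambda>z. g (s1 (s2 z))" t]
      nn_integral_shear_Im[of "\<lambda>z. g (s1 z)" b] nn_integral_shear_Re[of g t]
    by (simp add: s1_def s2_def)
  finally show ?thesis .
qed

text \<open>Fubini and rotation invariance. This is how a mean value inequality on each circle about
  the origin becomes an inequality between area integrals.\<close>

lemma nn_integral_rotation_average:
  fixes g :: "complex \<Rightarrow> ennreal" and W :: "real \<Rightarrow> ennreal"
  assumes [measurable]: "g \<in> borel_measurable borel" "W \<in> borel_measurable borel"
  shows "(\<integral>\<^sup>+z. \<integral>\<^sup>+x. W x * g (z * cis (2 * pi * x)) \<partial>lborel \<partial>lborel)
       = (\<integral>\<^sup>+x. W x \<partial>lborel) * (\<integral>\<^sup>+z. g z \<partial>lborel)"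
proof -
  have [measurable]: "cis \<in> borel_measurable borel"
    unfolding cis_conv_exp by measurable
  have "(\<integral>\<^sup>+z. \<integral>\<^sup>+x. W x * g (z * cis (2 * pi * x)) \<partial>lborel \<partial>lborel)
      = (\<integral>\<^sup>+x. \<integral>\<^sup>+z. W x * g (z * cis (2 * pi * x)) \<partial>lborel \<partial>lborel)"
    by (rule lborel_pair.Fubini') measurable
  also have "\<dots> = (\<integral>\<^sup>+x. W x * (\<integral>\<^sup>+z. g z \<partial>lborel) \<partial>lborel)"
    by (intro nn_integral_cong) (simp add: nn_integral_cmult nn_integral_rotate)
  finally show ?thesis
    by (simp add: nn_integral_multc)
qed

subsection \<open>Zeros of entire functions and circle means\<close>

text \<open>In the Leibniz sum only the term with all \<open>k\<close> derivatives on the power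
  survives at \<open>l\<close>.\<close>

lemma higher_deriv_power_mult_at:
  assumes g: "g holomorphic_on UNIV" and j: "j \<le> k"
  shows "(deriv ^^ j) (\<lambda>z. (z - l) ^ k * g z) l = (if j = k then fact k * g l else 0)"
proof -
  have "(deriv ^^ j) (\<lambda>z. (z - l) ^ k * g z) l
      = (\<Sum>i = 0..j. of_nat (j choose i) * (deriv ^^ i) (\<lambda>z. (z - l) ^ k) l * (deriv ^^ (j - i)) g l)"
    by (rule higher_deriv_mult[of _ UNIV]) (auto intro!: holomorphic_intros g)
  also have "\<dots> = (\<Sum>i = 0..j. if i = k then fact k * g l else 0)"
    using j by (intro sum.cong) (auto simp: higher_deriv_power pochhammer_fact)
  also have "\<dots> = (if j = k then fact k * g l else 0)"
    using j by auto
  finally show ?thesis .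
qed

text \<open>Induction on \<open>k\<close>: the cofactor \<open>g\<close> after \<open>k\<close>
  steps has the value \<open>(deriv ^^ k) f l / fact k\<close> at \<open>l\<close>, so one more
  vanishing derivative lets one more factor split off through a removable singularity.\<close>

lemma entire_vanishing_factor:
  assumes f: "f holomorphic_on UNIV" and v: "\<And>j. j < k \<Longrightarrow> (deriv ^^ j) f l = 0"
  shows "\<exists>g. g holomorphic_on UNIV \<and> (\<forall>z. f z = (z - l) ^ k * g z)"
  using v
proof (induction k)
  case 0
  then show ?case using f by auto
next
  case (Suc k)
  then obtain g where g: "g holomorphic_on UNIV" and fg: "\<And>z. f z = (z - l) ^ k * g z"
    by (metis less_SucI)
  have "(deriv ^^ k) f l = fact k * g l"
    using higher_deriv_power_mult_at[OF g, of k k l] by (simp add: fg[abs_def])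
  then have "g l = 0"
    using Suc.prems[of k] by simp
  define h where "h z = (if z = l then deriv g l else (g z - g l) / (z - l))" for z
  have "h holomorphic_on UNIV"
    unfolding h_def[abs_def] by (rule pole_lemma_open[OF g]) simp
  moreover have "g z = (z - l) * h z" for z
    using \<open>g l = 0\<close> by (simp add: h_def)
  ultimately show ?case
    by (intro exI[of _ h]) (simp add: fg mult.assoc mult.left_commute)
qed

section \<open>Cauchy's formulas as means over the unit circle\<close>

lemma circlepath_0_1: "circlepath 0 1 x = cis (2 * pi * x)"
  by (simp add: circlepath cis_conv_exp mult_ac)

lemma has_contour_integral_circlepath_0_1:
  "(f has_contour_integral i) (circlepath 0 1) \<longleftrightarrow>
   ((\<lambda>x. f (cis (2 * pi * x)) * (2 * pi * \<i> * cis (2 * pi * x))) has_integral i) {0..1}"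
  by (simp add: has_contour_integral vector_derivative_circlepath circlepath_0_1 cis_conv_exp mult_ac)

text \<open>Dividing by \<open>2 * pi * \<i>\<close> turns contour integrals into means over
  \<open>{0..1}\<close>; what is left of the derivative of the path is the factor
  \<open>cis (2 * pi * x)\<close>.\<close>

lemma circle_mean_of_contour_integral:
  assumes "(f has_contour_integral (2 * pi * \<i>) * I) (circlepath 0 1)"
  shows "((\<lambda>x. f (cis (2 * pi * x)) * cis (2 * pi * x)) has_integral I) {0..1}"
proof -
  have "((\<lambda>x. f (cis (2 * pi * x)) * (2 * pi * \<i> * cis (2 * pi * x)) * (1 / (2 * pi * \<i>)))
      has_integral ((2 * pi * \<i>) * I) * (1 / (2 * pi * \<i>))) {0..1}"
    by (rule has_integral_mult_left) (use assms in \<open>simp only: has_contour_integral_circlepath_0_1\<close>)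
  then show ?thesis
    by (simp add: field_simps)
qed

lemma circle_mean_Cauchy_inside:
  assumes "continuous_on (cball 0 1) f" "f holomorphic_on ball 0 1" "cmod b < 1"
  shows "((\<lambda>x. f (cis (2 * pi * x)) / (cis (2 * pi * x) - b) * cis (2 * pi * x)) has_integral f b) {0..1}"
proof (rule circle_mean_of_contour_integral)
  show "((\<lambda>u. f u / (u - b)) has_contour_integral (2 * pi * \<i>) * f b) (circlepath 0 1)"
    using Cauchy_integral_circlepath[of 0 1 f b] assms
    by (auto simp: dist_norm)
qed

lemma circle_mean_Cauchy_outside:
  assumes "f holomorphic_on UNIV" "cmod b > 1"
  shows "((\<lambda>x. f (cis (2 * pi * x)) / (cis (2 * pi * x) - b) * cis (2 * pi * x)) has_integral 0) {0..1}"
proof (rule circle_mean_of_contour_integral)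
  have "((\<lambda>w. f w / (w - b)) has_contour_integral 0) (circlepath 0 1)"
    by (rule Cauchy_theorem_disc_simple[of _ 0 "cmod b"])
       (use assms in \<open>auto intro!: holomorphic_intros intro: holomorphic_on_subset simp: dist_norm\<close>)
  then show "((\<lambda>w. f w / (w - b)) has_contour_integral (2 * pi * \<i>) * 0) (circlepath 0 1)"
    by simp
qed

lemma circle_mean_coeff:
  assumes "f holomorphic_on UNIV"
  shows "((\<lambda>x. f (cis (2 * pi * x)) / cis (2 * pi * x) ^ j) has_integral (deriv ^^ j) f 0 / fact j) {0..1}"
proof -
  have "((\<lambda>u. f u / (u - 0) ^ Suc j) has_contour_integral ((2 * pi * \<i>) / (fact j) * (deriv ^^ j) f 0))
           (circlepath 0 1)"
    by (rule Cauchy_has_contour_integral_higher_derivative_circlepath)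
       (use assms in \<open>auto intro: holomorphic_on_imp_continuous_on holomorphic_on_subset\<close>)
  then have "((\<lambda>u. f u / u ^ Suc j) has_contour_integral ((2 * pi * \<i>) * ((deriv ^^ j) f 0 / fact j)))
           (circlepath 0 1)"
    by simp
  from circle_mean_of_contour_integral[OF this] show ?thesis
    by (simp add: field_simps)
qed

subsection \<open>Masses, quotient norms and translations\<close>

text \<open>Values in [0, infinity] allow masses to be compared and summed before membership in the
  space is known.\<close>

definition fock_mass :: "real \<Rightarrow> real \<Rightarrow> (complex \<Rightarrow> complex) \<Rightarrow> complex set \<Rightarrow> ennreal" where
  "fock_mass p \<alpha> f S = (\<integral>\<^sup>+z. ennreal (fock_integrand p \<alpha> f z) * indicator S z \<partial>lborel)"

text \<open>The Weyl operator: translation by \<open>w\<close>, with the exponential that turns the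
  weight at \<open>z\<close> into the weight at \<open>z - w\<close>. It reduces every statement
  about a point \<open>l\<close> to the origin.\<close>

definition fock_translate :: "real \<Rightarrow> complex \<Rightarrow> (complex \<Rightarrow> complex) \<Rightarrow> complex \<Rightarrow> complex" where
  "fock_translate \<alpha> w f z = exp (of_real \<alpha> * cnj w * z - of_real (\<alpha> * (cmod w)\<^sup>2 / 2)) * f (z - w)"

lemma fock_integrand_nonneg [simp]: "0 \<le> fock_integrand p \<alpha> f z"
  by (simp add: fock_integrand_def)

lemma measurable_entire [measurable_dest]:
  "f holomorphic_on UNIV \<Longrightarrow> f \<in> borel_measurable (borel :: complex measure)"
  by (intro borel_measurable_continuous_onI holomorphic_on_imp_continuous_on)

lemma measurable_fock_integrand [measurable]:
  assumes [measurable]: "f \<in> borel_measurable borel"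
  shows "fock_integrand p \<alpha> f \<in> borel_measurable borel"
  unfolding fock_integrand_def[abs_def] by measurable

lemma fock_mass_mono: "S \<subseteq> T \<Longrightarrow> fock_mass p \<alpha> f S \<le> fock_mass p \<alpha> f T"
  unfolding fock_mass_def by (intro nn_integral_mono mult_left_mono) (auto split: split_indicator)

lemma fock_space_iff:
  "f \<in> fock_space p \<alpha> \<longleftrightarrow> f holomorphic_on UNIV \<and> fock_mass p \<alpha> f UNIV < \<infinity>"
proof (cases "f holomorphic_on UNIV")
  case True
  then show ?thesis
    using measurable_fock_integrand[OF measurable_entire[OF True], of p \<alpha>]
    by (simp add: fock_space_def fock_mass_def integrable_iff_bounded)
qed (simp add: fock_space_def)

lemma fock_space_holomorphic: "f \<in> fock_space p \<alpha> \<Longrightarrow> f holomorphic_on UNIV"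
  by (simp add: fock_space_def)

lemma fock_mass_finite: "f \<in> fock_space p \<alpha> \<Longrightarrow> fock_mass p \<alpha> f S < \<infinity>"
  by (meson fock_mass_mono fock_space_iff le_less_trans subset_UNIV)

lemma fock_norm_nonneg [simp]: "0 \<le> fock_norm p \<alpha> f"
  by (simp add: fock_norm_def)

lemma fock_norm_powr:
  assumes "f \<in> fock_space p \<alpha>" "0 < p"
  shows "ennreal (fock_norm p \<alpha> f powr p) = fock_mass p \<alpha> f UNIV"
proof -
  have "fock_norm p \<alpha> f powr p = (LINT z|lborel. fock_integrand p \<alpha> f z)"
    using \<open>0 < p\<close> by (simp add: fock_norm_def powr_powr integral_nonneg_AE)
  then show ?thesis
    using assms by (simp add: fock_mass_def fock_space_def nn_integral_eq_integral)
qed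

lemma fock_mass_union_complement:
  assumes [measurable]: "f \<in> borel_measurable borel" "S \<in> sets borel"
  shows "fock_mass p \<alpha> f UNIV = fock_mass p \<alpha> f S + fock_mass p \<alpha> f (- S)"
  unfolding fock_mass_def
  by (subst nn_integral_add[symmetric]) (auto intro!: nn_integral_cong split: split_indicator)

lemma powr_add_le:
  fixes a b p :: real
  assumes "0 \<le> a" "0 \<le> b" "0 \<le> p"
  shows "(a + b) powr p \<le> 2 powr p * (a powr p + b powr p)"
proof -
  have "(a + b) powr p \<le> (2 * max a b) powr p"
    using assms by (intro powr_mono2) auto
  also have "\<dots> = 2 powr p * max a b powr p"
    by (simp add: powr_mult)
  also have "max a b powr p \<le> a powr p + b powr p"
    by (auto simp: max_def)
  finally show ?thesis by simp
qed

lemma fock_integrand_add_le: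
  assumes "0 \<le> p"
  shows "fock_integrand p \<alpha> (\<lambda>z. f z + g z) z \<le> 2 powr p * (fock_integrand p \<alpha> f z + fock_integrand p \<alpha> g z)"
proof -
  have "cmod (f z + g z) powr p \<le> (cmod (f z) + cmod (g z)) powr p"
    using assms by (intro powr_mono2 norm_triangle_ineq) auto
  also have "\<dots> \<le> 2 powr p * (cmod (f z) powr p + cmod (g z) powr p)"
    using assms by (intro powr_add_le) auto
  finally have "cmod (f z + g z) powr p * exp (- (p * \<alpha> * (cmod z)\<^sup>2 / 2)) \<le>
     2 powr p * (cmod (f z) powr p + cmod (g z) powr p) * exp (- (p * \<alpha> * (cmod z)\<^sup>2 / 2))"
    by (intro mult_right_mono) auto
  then show ?thesis
    by (simp add: fock_integrand_def algebra_simps)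
qed

lemma fock_mass_add_le:
  assumes [measurable]: "f \<in> borel_measurable borel" "g \<in> borel_measurable borel" "S \<in> sets borel"
    and p: "0 \<le> p"
  shows "fock_mass p \<alpha> (\<lambda>z. f z + g z) S \<le> ennreal (2 powr p) * (fock_mass p \<alpha> f S + fock_mass p \<alpha> g S)"
proof -
  have "fock_mass p \<alpha> (\<lambda>z. f z + g z) S \<le> (\<integral>\<^sup>+z. ennreal (2 powr p) *
      (ennreal (fock_integrand p \<alpha> f z) * indicator S z + ennreal (fock_integrand p \<alpha> g z) * indicator S z) \<partial>lborel)"
    unfolding fock_mass_def
    by (intro nn_integral_mono) (auto split: split_indicator
        simp: ennreal_plus[symmetric] ennreal_mult[symmetric] simp del: ennreal_plus
        intro!: ennreal_leI fock_integrand_add_le p)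
  also have "\<dots> = ennreal (2 powr p) * (fock_mass p \<alpha> f S + fock_mass p \<alpha> g S)"
    by (simp add: fock_mass_def nn_integral_cmult nn_integral_add)
  finally show ?thesis .
qed

lemma fock_mass_cmult:
  assumes [measurable]: "f \<in> borel_measurable borel" and [measurable]: "S \<in> sets borel"
  shows "fock_mass p \<alpha> (\<lambda>z. c * f z) S = ennreal (cmod c powr p) * fock_mass p \<alpha> f S"
proof -
  have "fock_mass p \<alpha> (\<lambda>z. c * f z) S
      = (\<integral>\<^sup>+z. ennreal (cmod c powr p) * (ennreal (fock_integrand p \<alpha> f z) * indicator S z) \<partial>lborel)"
    unfolding fock_mass_def
    by (intro nn_integral_cong)
       (simp add: fock_integrand_def norm_mult powr_mult ennreal_mult' mult_ac)
  then show ?thesis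
    by (simp add: nn_integral_cmult fock_mass_def)
qed

lemma fock_mass_minus_commute: "fock_mass p \<alpha> (\<lambda>z. f z - g z) S = fock_mass p \<alpha> (\<lambda>z. g z - f z) S"
  by (simp add: fock_mass_def fock_integrand_def norm_minus_commute)

lemma fock_space_add:
  assumes "f \<in> fock_space p \<alpha>" "g \<in> fock_space p \<alpha>" "0 \<le> p"
  shows "(\<lambda>z. f z + g z) \<in> fock_space p \<alpha>"
proof -
  have "fock_mass p \<alpha> (\<lambda>z. f z + g z) UNIV \<le> ennreal (2 powr p) * (fock_mass p \<alpha> f UNIV + fock_mass p \<alpha> g UNIV)"
    using assms by (intro fock_mass_add_le) (auto intro: measurable_entire simp: fock_space_def)
  also have "\<dots> < \<infinity>"
    using assms by (auto simp: ennreal_mult_less_top fock_space_iff)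
  finally show ?thesis
    using assms by (auto simp: fock_space_iff intro!: holomorphic_intros)
qed

lemma fock_space_cmult:
  assumes "f \<in> fock_space p \<alpha>"
  shows "(\<lambda>z. c * f z) \<in> fock_space p \<alpha>"
  using assms by (auto simp: fock_space_iff fock_mass_cmult measurable_entire ennreal_mult_less_top
      intro!: holomorphic_intros)

lemma fock_space_diff:
  assumes "f \<in> fock_space p \<alpha>" "g \<in> fock_space p \<alpha>" "0 \<le> p"
  shows "(\<lambda>z. f z - g z) \<in> fock_space p \<alpha>"
  using fock_space_add[OF assms(1) fock_space_cmult[OF assms(2), of "-1"] assms(3)] by simp

lemma vanishing_space_subset: "g \<in> vanishing_space p \<alpha> l k \<Longrightarrow> g \<in> fock_space p \<alpha>"
  by (simp add: vanishing_space_def)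

lemma zero_in_vanishing_space: "(\<lambda>z. 0) \<in> vanishing_space p \<alpha> l k"
  by (simp add: vanishing_space_def fock_space_def fock_integrand_def[abs_def])

lemma quotient_norm_nonneg: "0 \<le> quotient_norm p \<alpha> l k f"
  unfolding quotient_norm_def using zero_in_vanishing_space[of p \<alpha> l k] by (intro cINF_greatest) auto

lemma quotient_norm_le:
  assumes "g \<in> vanishing_space p \<alpha> l k"
  shows "quotient_norm p \<alpha> l k f \<le> fock_norm p \<alpha> (\<lambda>z. f z - g z)"
  unfolding quotient_norm_def by (intro cINF_lower assms bdd_belowI[of _ 0]) auto

lemma quotient_norm_powr_le:
  assumes "g \<in> vanishing_space p \<alpha> l k" "f \<in> fock_space p \<alpha>" "0 < p"
  shows "ennreal (quotient_norm p \<alpha> l k f powr p) \<le> fock_mass p \<alpha> (\<lambda>z. f z - g z) UNIV"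
proof -
  have "quotient_norm p \<alpha> l k f powr p \<le> fock_norm p \<alpha> (\<lambda>z. f z - g z) powr p"
    using assms by (intro powr_mono2 quotient_norm_le quotient_norm_nonneg) auto
  then have "ennreal (quotient_norm p \<alpha> l k f powr p) \<le> ennreal (fock_norm p \<alpha> (\<lambda>z. f z - g z) powr p)"
    by (rule ennreal_leI)
  also have "\<dots> = fock_mass p \<alpha> (\<lambda>z. f z - g z) UNIV"
    using assms by (intro fock_norm_powr fock_space_diff vanishing_space_subset[OF assms(1)]) auto
  finally show ?thesis .
qed

text \<open>Taking \<open>g = 0\<close> shows that \<open>c\<close> is finite; then the
  \<open>p\<close>-th root of the bound passes to the infimum over \<open>g\<close>.\<close>

lemma quotient_norm_powr_ge:
  assumes f: "f \<in> fock_space p \<alpha>" and p: "0 < p"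
    and le: "\<And>g. g \<in> vanishing_space p \<alpha> l k \<Longrightarrow> c \<le> fock_mass p \<alpha> (\<lambda>z. f z - g z) UNIV"
  shows "c \<le> ennreal (quotient_norm p \<alpha> l k f powr p)"
proof -
  have sp: "(\<lambda>z. f z - g z) \<in> fock_space p \<alpha>" if "g \<in> vanishing_space p \<alpha> l k" for g
    using that p by (intro fock_space_diff f vanishing_space_subset[OF that]) auto
  have "c < \<infinity>"
    using le[OF zero_in_vanishing_space] f by (auto simp: fock_space_iff)
  then obtain r where r: "c = ennreal r" "0 \<le> r"
    by (metis ennreal_cases infinity_ennreal_def less_irrefl)
  have "r powr (1 / p) \<le> fock_norm p \<alpha> (\<lambda>z. f z - g z)" if g: "g \<in> vanishing_space p \<alpha> l k" for g
  proof -
    have "ennreal r \<le> ennreal (fock_norm p \<alpha> (\<lambda>z. f z - g z) powr p)"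
      using le[OF g] fock_norm_powr[OF sp[OF g] p] r by simp
    then have "r powr (1 / p) \<le> (fock_norm p \<alpha> (\<lambda>z. f z - g z) powr p) powr (1 / p)"
      using r p by (intro powr_mono2) auto
    then show ?thesis
      using p by (simp add: powr_powr)
  qed
  then have "r powr (1 / p) \<le> quotient_norm p \<alpha> l k f"
    unfolding quotient_norm_def using zero_in_vanishing_space[of p \<alpha> l k] by (intro cINF_greatest) auto
  then have "(r powr (1 / p)) powr p \<le> quotient_norm p \<alpha> l k f powr p"
    using p by (intro powr_mono2) auto
  then show ?thesis
    using r p by (auto simp: powr_powr intro: ennreal_leI)
qed

section \<open>Translations act isometrically\<close>

lemma holomorphic_entire_compose:
  assumes "f holomorphic_on UNIV" "g holomorphic_on S"
  shows "(\<lambda>z. f (g z)) holomorphic_on S"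
  using holomorphic_on_compose_gen[OF assms(2,1)] by (simp add: o_def)

text \<open>The exponential in \<open>fock_translate\<close> supplies exactly the mixed term and the
  constant term in the expansion of \<open>(cmod (z - w))\<^sup>2\<close>.\<close>

lemma fock_integrand_translate:
  "fock_integrand p \<alpha> (fock_translate \<alpha> w f) z = fock_integrand p \<alpha> f (z - w)"
proof -
  have eq: "\<alpha> * (cmod (z - w))\<^sup>2 = \<alpha> * (cmod z)\<^sup>2 + \<alpha> * (cmod w)\<^sup>2 - 2 * (\<alpha> * Re (cnj w * z))"
    unfolding cmod_power2 by (simp add: power2_eq_square algebra_simps)
  have "cmod (fock_translate \<alpha> w f z) = exp (\<alpha> * Re (cnj w * z) - \<alpha> * (cmod w)\<^sup>2 / 2) * cmod (f (z - w))"
    by (simp add: fock_translate_def norm_mult mult.assoc distrib_left right_diff_distrib)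
  then have "fock_integrand p \<alpha> (fock_translate \<alpha> w f) z = cmod (f (z - w)) powr p *
      (exp (p * (\<alpha> * Re (cnj w * z) - \<alpha> * (cmod w)\<^sup>2 / 2)) * exp (- (p * \<alpha> * (cmod z)\<^sup>2 / 2)))"
    by (simp add: fock_integrand_def powr_mult powr_def[of "exp _"] mult_ac)
  also have "exp (p * (\<alpha> * Re (cnj w * z) - \<alpha> * (cmod w)\<^sup>2 / 2)) * exp (- (p * \<alpha> * (cmod z)\<^sup>2 / 2))
      = exp (- (p * (\<alpha> * (cmod (z - w))\<^sup>2) / 2))"
    unfolding eq exp_add[symmetric] by (simp add: algebra_simps add_divide_distrib diff_divide_distrib)
  finally show ?thesis
    by (simp add: fock_integrand_def mult.assoc)
qed

lemma holomorphic_fock_translate: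
  "f holomorphic_on UNIV \<Longrightarrow> fock_translate \<alpha> w f holomorphic_on UNIV"
  unfolding fock_translate_def[abs_def]
  by (rule holomorphic_on_mult[OF _ holomorphic_entire_compose]) (auto intro!: holomorphic_intros)

lemma fock_translate_inverse [simp]: "fock_translate \<alpha> (- w) (fock_translate \<alpha> w f) = f"
proof
  fix z
  have "fock_translate \<alpha> (- w) (fock_translate \<alpha> w f) z =
     exp (- of_real \<alpha> * cnj w * z - of_real (\<alpha> * (cmod w)\<^sup>2 / 2) +
         (of_real \<alpha> * cnj w * (z + w) - of_real (\<alpha> * (cmod w)\<^sup>2 / 2))) * f z"
    unfolding exp_add by (simp add: fock_translate_def mult.assoc)
  also have "- of_real \<alpha> * cnj w * z - of_real (\<alpha> * (cmod w)\<^sup>2 / 2) +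
         (of_real \<alpha> * cnj w * (z + w) - of_real (\<alpha> * (cmod w)\<^sup>2 / 2))
      = of_real \<alpha> * (w * cnj w - of_real ((cmod w)\<^sup>2))"
    by (simp add: field_simps)
  also have "\<dots> = 0"
    by (simp only: complex_norm_square diff_self mult_zero_right)
  finally show "fock_translate \<alpha> (- w) (fock_translate \<alpha> w f) z = f z" by simp
qed

lemma fock_mass_translate:
  assumes "f holomorphic_on UNIV" and [measurable]: "S \<in> sets borel"
  shows "fock_mass p \<alpha> (fock_translate \<alpha> w f) S = fock_mass p \<alpha> f {u. w + u \<in> S}"
proof -
  have [measurable]: "fock_translate \<alpha> w f \<in> borel_measurable borel"
    by (intro measurable_entire holomorphic_fock_translate assms)
  have "indicator S (w + u) = (indicator {u. w + u \<in> S} u :: ennreal)" for u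
    by (simp add: indicator_def)
  moreover have m: "(\<lambda>z. ennreal (fock_integrand p \<alpha> (fock_translate \<alpha> w f) z) * indicator S z)
      \<in> borel_measurable borel"
    by measurable
  have "fock_mass p \<alpha> (fock_translate \<alpha> w f) S = (\<integral>\<^sup>+u.
      ennreal (fock_integrand p \<alpha> (fock_translate \<alpha> w f) (w + u)) * indicator S (w + u) \<partial>lborel)"
    unfolding fock_mass_def nn_integral_affine_complex[OF m one_neq_zero, of w] by simp
  ultimately show ?thesis
    by (simp add: fock_mass_def fock_integrand_translate)
qed

lemma fock_mass_translate_ball:
  assumes "f holomorphic_on UNIV"
  shows "fock_mass p \<alpha> (fock_translate \<alpha> w f) (ball c r) = fock_mass p \<alpha> f (ball (c - w) r)"
proof -
  have "{u. w + u \<in> ball c r} = ball (c - w) r"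
    by (simp only: set_eq_iff mem_Collect_eq mem_ball dist_norm diff_diff_eq simp_thms)
  then show ?thesis
    by (simp add: fock_mass_translate[OF assms])
qed

lemma fock_mass_translate_UNIV:
  assumes "f holomorphic_on UNIV"
  shows "fock_mass p \<alpha> (fock_translate \<alpha> w f) UNIV = fock_mass p \<alpha> f UNIV"
  by (simp add: fock_mass_translate[OF assms])

lemma fock_space_translate:
  "f \<in> fock_space p \<alpha> \<Longrightarrow> fock_translate \<alpha> w f \<in> fock_space p \<alpha>"
  by (simp add: fock_space_iff holomorphic_fock_translate fock_mass_translate_UNIV)

section \<open>Vanishing spaces as multiples of a power\<close>

lemma vanishing_space_factor:
  assumes "f \<in> vanishing_space p \<alpha> l k"
  obtains g where "g holomorphic_on UNIV" "\<And>z. f z = (z - l) ^ k * g z"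
proof -
  have "f holomorphic_on UNIV" "\<And>j. j < k \<Longrightarrow> (deriv ^^ j) f l = 0"
    using assms by (auto simp: vanishing_space_def fock_space_def)
  then obtain g where "g holomorphic_on UNIV" "\<forall>z. f z = (z - l) ^ k * g z"
    using entire_vanishing_factor[of f k l] by blast
  then show ?thesis using that by blast
qed

lemma vanishing_spaceI:
  assumes "f \<in> fock_space p \<alpha>" "g holomorphic_on UNIV" "\<And>z. f z = (z - l) ^ k * g z"
  shows "f \<in> vanishing_space p \<alpha> l k"
proof -
  have "f = (\<lambda>z. (z - l) ^ k * g z)"
    using assms(3) by auto
  then show ?thesis
    using assms(1) higher_deriv_power_mult_at[OF assms(2), of _ k l]
    by (auto simp: vanishing_space_def)
qed

lemma vanishing_space_translate:
  assumes "f \<in> vanishing_space p \<alpha> l k"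
  shows "fock_translate \<alpha> w f \<in> vanishing_space p \<alpha> (l + w) k"
proof -
  obtain g where g: "g holomorphic_on UNIV" "\<And>z. f z = (z - l) ^ k * g z"
    using vanishing_space_factor[OF assms] by metis
  show ?thesis
  proof (rule vanishing_spaceI)
    show "fock_translate \<alpha> w f z = (z - (l + w)) ^ k * fock_translate \<alpha> w g z" for z
      using g(2) by (simp add: fock_translate_def mult_ac diff_diff_eq add.commute)
  qed (use assms g holomorphic_fock_translate fock_space_translate vanishing_space_subset in blast)+
qed

subsection \<open>The Poisson integral\<close>

text \<open>The graph of \<open>x powr p\<close> lies above its tangent at 1; put
  \<open>x = g / b\<close> and multiply by \<open>b powr p\<close>.\<close>

lemma Young_powr:
  fixes b g p :: real
  assumes "0 \<le> g" "0 \<le> b" "1 \<le> p"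
  shows "p * b powr (p - 1) * g \<le> g powr p + (p - 1) * b powr p"
proof (cases "b = 0 \<or> g = 0")
  case True
  then show ?thesis using assms by auto
next
  case False
  then have pos: "0 < b" "0 < g"
    using assms by auto
  have "1 + p * (g / b - 1) \<le> (g / b) powr p"
  proof -
    have "convex_on {0<..} (\<lambda>x. x powr p)"
      using assms by (intro powr_convex) auto
    then have "((g / b) powr p - 1 powr p) \<ge> (p * 1 powr (p - 1)) * (g / b - 1)"
      using pos assms
      by (intro convex_on_imp_above_tangent[where A = "{0<..}"])
         (auto intro!: derivative_eq_intros simp: interior_open)
    then show ?thesis by simp
  qed
  then have "b powr p * (1 + p * (g / b - 1)) \<le> b powr p * (g / b) powr p"
    by (intro mult_left_mono) auto
  also have "b powr p * (g / b) powr p = g powr p"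
    using pos by (simp add: powr_divide)
  also have "b powr p * (1 + p * (g / b - 1)) = p * (b powr p / b) * g - (p - 1) * b powr p"
    using pos by (simp add: field_simps)
  also have "b powr p / b = b powr (p - 1)"
    using pos by (simp add: powr_diff)
  finally show ?thesis by simp
qed

text \<open>Integrate \<open>Young_powr\<close> with \<open>b\<close> fixed: its left side is linear
  in \<open>g\<close>, so \<open>le\<close> applies, and since \<open>W\<close> has mass at most 1
  the finite term \<open>(p - 1) * b powr p\<close> cancels. \<open>W\<close> may have mass less
  than 1, as it does for truncated or merely bounded kernels.\<close>

lemma Jensen_powr_nn_integral:
  assumes [measurable]: "W \<in> borel_measurable M" "g \<in> borel_measurable M"
    and W: "(\<integral>\<^sup>+x. W x \<partial>M) \<le> 1" and g: "\<And>x. 0 \<le> g x" and p: "1 \<le> p" and b: "0 \<le> b"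
    and le: "ennreal b \<le> (\<integral>\<^sup>+x. W x * ennreal (g x) \<partial>M)"
  shows "ennreal (b powr p) \<le> (\<integral>\<^sup>+x. W x * ennreal (g x powr p) \<partial>M)"
proof -
  have eq: "b powr (p - 1) * b = b powr p"
    using b p by (cases "b = 0") (auto simp: powr_diff)
  have "ennreal (b powr p) + ennreal ((p - 1) * b powr p) = ennreal (p * b powr p)"
    using p mult_right_mono[OF p, of "b powr p"] by (subst ennreal_plus[symmetric]) (auto simp: algebra_simps)
  also have "\<dots> = ennreal (p * b powr (p - 1)) * ennreal b"
    using p b eq by (simp add: ennreal_mult[symmetric] mult.assoc)
  also have "\<dots> \<le> ennreal (p * b powr (p - 1)) * (\<integral>\<^sup>+x. W x * ennreal (g x) \<partial>M)"
    by (intro mult_left_mono le) auto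
  also have "\<dots> = (\<integral>\<^sup>+x. W x * ennreal (p * b powr (p - 1) * g x) \<partial>M)"
    using p g by (subst nn_integral_cmult[symmetric])
      (auto intro!: nn_integral_cong simp: ennreal_mult mult_ac)
  also have "\<dots> \<le> (\<integral>\<^sup>+x. W x * ennreal (g x powr p + (p - 1) * b powr p) \<partial>M)"
    by (intro nn_integral_mono mult_left_mono ennreal_leI Young_powr g b p) auto
  also have "\<dots> = (\<integral>\<^sup>+x. W x * ennreal (g x powr p) \<partial>M) + (\<integral>\<^sup>+x. W x \<partial>M) * ennreal ((p - 1) * b powr p)"
    using p by (subst nn_integral_multc[symmetric]) (auto simp: nn_integral_add[symmetric] distrib_left)
  also have "\<dots> \<le> (\<integral>\<^sup>+x. W x * ennreal (g x powr p) \<partial>M) + 1 * ennreal ((p - 1) * b powr p)"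
    by (intro add_left_mono mult_right_mono W) auto
  finally show ?thesis
    by (simp add: ennreal_add_left_cancel_le add.commute[of _ "ennreal ((p - 1) * b powr p)"])
qed

text \<open>Continuity makes the gauge integral delivered by Cauchy's formula a Lebesgue integral,
  where nonnegative integration takes over.\<close>

lemma norm_circle_mean_le:
  fixes h :: "real \<Rightarrow> complex"
  assumes I: "(h has_integral I) {0..1}" and c: "continuous_on {0..1} h"
  shows "ennreal (cmod I) \<le> (\<integral>\<^sup>+x. ennreal (cmod (h x)) * indicator {0..1} x \<partial>lborel)"
proof -
  have i: "set_integrable lborel {0..1} h"
    by (rule borel_integrable_atLeastAtMost'[OF c])
  have "I = (LINT x|lborel. indicator {0..1} x *\<^sub>R h x)"
    using set_borel_integral_eq_integral(2)[OF i] integral_unique[OF I]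
    unfolding set_lebesgue_integral_def by simp
  then have "ennreal (cmod I) \<le> (\<integral>\<^sup>+x. ennreal (cmod (indicator {0..1} x *\<^sub>R h x)) \<partial>lborel)"
    using integral_norm_bound_ennreal[OF i[unfolded set_integrable_def]] by simp
  also have "\<dots> = (\<integral>\<^sup>+x. ennreal (cmod (h x)) * indicator {0..1} x \<partial>lborel)"
    by (intro nn_integral_cong) (auto split: split_indicator)
  finally show ?thesis .
qed

definition poisson :: "real \<Rightarrow> real \<Rightarrow> real" where
  "poisson r x = (1 - r\<^sup>2) / (cmod (cis (2 * pi * x) - of_real r))\<^sup>2"

lemma cis_neq_real: "\<bar>r\<bar> < 1 \<Longrightarrow> cis t \<noteq> of_real r"
  by (metis less_irrefl norm_cis norm_of_real)

lemma poisson_nonneg: "0 \<le> r \<Longrightarrow> r < 1 \<Longrightarrow> 0 \<le> poisson r x"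
  by (simp add: poisson_def power_le_one)

lemma continuous_poisson: "\<bar>r\<bar> < 1 \<Longrightarrow> continuous_on A (poisson r)"
  unfolding poisson_def[abs_def]
  by (intro continuous_intros) (use cis_neq_real[of r] in auto)

lemma measurable_poisson [measurable]: "poisson r \<in> borel_measurable borel"
  unfolding poisson_def[abs_def] cis_conv_exp by measurable

text \<open>Cauchy's formula at \<open>r\<close> for the function \<open>u \<mapsto> f u * (1 - r\<^sup>2) / (1 - r * u)\<close>.\<close>

lemma poisson_mean:
  assumes f: "f holomorphic_on UNIV" and r: "0 \<le> r" "r < 1"
  shows "((\<lambda>x. of_real (poisson r x) * f (cis (2 * pi * x))) has_integral f (of_real r)) {0..1}"
proof -
  define F where "F u = f u * (of_real (1 - r\<^sup>2) / (1 - of_real r * u))" for u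
  have nz: "1 - of_real r * u \<noteq> 0" if "cmod u \<le> 1" for u :: complex
  proof
    assume "1 - of_real r * u = 0"
    then have "cmod (of_real r * u) = 1" by simp
    moreover have "cmod (of_real r * u) \<le> r * 1"
      using that r by (simp only: norm_mult norm_of_real) (intro mult_mono, auto)
    ultimately show False using r by simp
  qed
  have "F holomorphic_on cball 0 1"
    unfolding F_def using nz
    by (intro holomorphic_intros holomorphic_on_subset[OF f]) auto
  then have "((\<lambda>x. F (cis (2 * pi * x)) / (cis (2 * pi * x) - of_real r) * cis (2 * pi * x))
      has_integral F (of_real r)) {0..1}"
    by (intro circle_mean_Cauchy_inside)
       (use r in \<open>auto intro: holomorphic_on_imp_continuous_on elim: holomorphic_on_subset\<close>)
  moreover have "1 - (complex_of_real r)\<^sup>2 \<noteq> 0"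
    using nz[of "of_real r"] r by (simp add: power2_eq_square)
  then have "F (of_real r) = f (of_real r)"
    by (simp add: F_def power2_eq_square)
  \<comment> \<open>On the unit circle \<open>1 - r * u = u * (cnj u - r)\<close>; this makes the
    Cauchy kernel of \<open>F\<close> the real Poisson kernel.\<close>
  moreover have "F u / (u - of_real r) * u = of_real ((1 - r\<^sup>2) / (cmod (u - of_real r))\<^sup>2) * f u"
    if u: "cmod u = 1" for u
  proof -
    have eq1: "of_real ((cmod (u - of_real r))\<^sup>2) = (u - of_real r) * (cnj u - of_real r)"
      by (simp add: complex_norm_square del: of_real_power)
    have eq2: "1 - of_real r * u = u * (cnj u - of_real r)"
      using u complex_norm_square[of u] by (simp add: algebra_simps)
    have "u \<noteq> 0" using u by auto
    then show ?thesis
      unfolding F_def of_real_divide eq1 eq2 by (simp add: mult_ac)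
  qed
  ultimately show ?thesis
    by (simp add: poisson_def)
qed

lemma nn_integral_poisson:
  assumes r: "0 \<le> r" "r < 1"
  shows "(\<integral>\<^sup>+x. ennreal (poisson r x) * indicator {0..1} x \<partial>lborel) = 1"
proof -
  have "((\<lambda>x. complex_of_real (poisson r x)) has_integral of_real 1) {0..1}"
    using poisson_mean[of "\<lambda>_. 1" r] r by simp
  then have "((\<lambda>x. Re (complex_of_real (poisson r x))) has_integral Re (of_real 1)) {0..1}"
    by (rule has_integral_Re)
  then have "(poisson r has_integral 1) {0..1}"
    by simp
  then have "((\<lambda>x. if x \<in> {0..1} then poisson r x else 0) has_integral 1) UNIV"
    by (simp only: has_integral_restrict_UNIV)
  then have "(\<integral>\<^sup>+x. ennreal (if x \<in> {0..1} then poisson r x else 0) \<partial>lborel) = ennreal 1"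
    by (intro nn_integral_has_integral_lborel) (use poisson_nonneg r in auto)
  moreover have "ennreal (if x \<in> {0..1} then poisson r x else 0) = ennreal (poisson r x) * indicator {0..1} x" for x
    by simp
  ultimately show ?thesis
    by simp
qed

text \<open>Poisson's formula for \<open>\<lambda>u. f (z * u)\<close> at the real point
  \<open>r\<close>, followed by Jensen's inequality. The dilated point \<open>r * z\<close> is
  thereby controlled by the circle through \<open>z\<close>.\<close>

lemma poisson_powr_le:
  assumes f: "f holomorphic_on UNIV" and r: "0 \<le> r" "r < 1" and p: "1 \<le> p"
  shows "ennreal (cmod (f (of_real r * z)) powr p)
     \<le> (\<integral>\<^sup>+x. (ennreal (poisson r x) * indicator {0..1} x) *
           ennreal (cmod (f (z * cis (2 * pi * x))) powr p) \<partial>lborel)"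
proof (rule Jensen_powr_nn_integral)
  have fz: "(\<lambda>u. f (z * u)) holomorphic_on UNIV"
    by (intro holomorphic_entire_compose[OF f] holomorphic_intros)
  have "(\<lambda>x. f (z * cis (2 * pi * x))) \<in> borel_measurable borel"
    unfolding cis_conv_exp
    by (intro measurable_compose[OF _ measurable_entire[OF f]]) measurable
  then show "(\<lambda>x. cmod (f (z * cis (2 * pi * x)))) \<in> borel_measurable lborel"
    by measurable
  have c: "continuous_on {0..1} (\<lambda>x. of_real (poisson r x) * f (z * cis (2 * pi * x)))"
    unfolding cis_conv_exp using r
    by (intro continuous_intros continuous_poisson
         continuous_on_compose2[OF holomorphic_on_imp_continuous_on[OF f]]) auto
  have "ennreal (cmod (f (of_real r * z))) \<le>
     (\<integral>\<^sup>+x. ennreal (cmod (of_real (poisson r x) * f (z * cis (2 * pi * x)))) * indicator {0..1} x \<partial>lborel)"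
    using norm_circle_mean_le[OF poisson_mean[OF fz r] c] by (simp add: mult.commute)
  also have "\<dots> = (\<integral>\<^sup>+x. (ennreal (poisson r x) * indicator {0..1} x) *
           ennreal (cmod (f (z * cis (2 * pi * x)))) \<partial>lborel)"
    using r by (intro nn_integral_cong) (simp add: norm_mult poisson_nonneg ennreal_mult' mult_ac)
  finally show "ennreal (cmod (f (of_real r * z))) \<le> \<dots>" .
qed (use p nn_integral_poisson[OF r] in auto)

subsection \<open>Functions vanishing to high order at a point\<close>

lemma sets_ball_complex [measurable]: "ball (c::complex) r \<in> sets borel"
  by simp

text \<open>From \<open>t \<le> exp (t - 1)\<close> at \<open>t = a / b\<close>, raised to the power
  \<open>m\<close>. The function \<open>x ^ m * exp (- (\<alpha> * x\<^sup>2 / 2))\<close> peaks at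
  \<open>x = R\<close>; for \<open>b = R\<close> the last exponent is
  \<open>- \<alpha> * (a - R)\<^sup>2 / 2\<close>, a Gaussian drop from the peak.\<close>

lemma weight_ratio_le:
  fixes a b \<alpha> R :: real
  assumes a: "0 \<le> a" and b: "0 < b" and m: "real m = \<alpha> * R\<^sup>2"
  shows "a ^ m * exp (- (\<alpha> * a\<^sup>2 / 2))
       \<le> b ^ m * exp (- (\<alpha> * b\<^sup>2 / 2)) * exp (\<alpha> * ((a - b) * (R\<^sup>2 / b - (a + b) / 2)))"
proof -
  have "a / b \<le> exp (a / b - 1)"
    using exp_ge_add_one_self[of "a / b - 1"] by simp
  then have "(a / b) ^ m \<le> exp (a / b - 1) ^ m"
    using a b by (intro power_mono) auto
  also have "\<dots> = exp (real m * (a / b - 1))"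
    by (simp add: exp_of_nat_mult)
  finally have "b ^ m * (a / b) ^ m * exp (- (\<alpha> * a\<^sup>2 / 2)) \<le> b ^ m * exp (real m * (a / b - 1)) * exp (- (\<alpha> * a\<^sup>2 / 2))"
    using b by (intro mult_right_mono mult_left_mono) auto
  moreover have "b ^ m * (a / b) ^ m = a ^ m"
    using b by (simp add: power_divide)
  moreover have "exp (real m * (a / b - 1)) * exp (- (\<alpha> * a\<^sup>2 / 2))
      = exp (- (\<alpha> * b\<^sup>2 / 2)) * exp (\<alpha> * ((a - b) * (R\<^sup>2 / b - (a + b) / 2)))"
    using b unfolding m exp_add[symmetric] by (simp add: field_simps power2_eq_square)
  ultimately show ?thesis
    by (simp add: mult.assoc)
qed

text \<open>Compare \<open>f z / z ^ m\<close> with its Poisson integral after the dilation that takes the radius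
  \<open>R - C\<close> to \<open>R\<close>.\<close>

lemma fock_mass_vanishing_core_0:
  assumes h: "h holomorphic_on UNIV" and f: "\<And>z. f z = z ^ m * h z"
    and m: "real m = \<alpha> * R\<^sup>2" "1 \<le> m" and C: "0 < C" "C < R" and p: "1 \<le> p" and \<alpha>: "0 < \<alpha>"
  shows "fock_mass p \<alpha> f (ball 0 (R - C))
     \<le> ennreal (exp (- (p * \<alpha> * C\<^sup>2 / 2))) * fock_mass p \<alpha> f (ball 0 R)"
proof -
  define x where "x = (R - C) / R"
  have x: "0 < x" "x < 1" "(1 - x) * R = C" "x * R = R - C"
    using C by (auto simp: x_def field_simps)
  have [measurable]: "h \<in> borel_measurable borel"
    by (rule measurable_entire[OF h])
  have f': "f = (\<lambda>z. z ^ m * h z)" using f by auto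
  have [measurable]: "f \<in> borel_measurable borel"
    unfolding f' by measurable
  define U :: "complex \<Rightarrow> ennreal" where
    "U z = ennreal ((cmod z ^ m * exp (- (\<alpha> * (cmod z)\<^sup>2 / 2))) powr p) * indicator (ball 0 R) z" for z
  have [measurable]: "U \<in> borel_measurable borel"
    unfolding U_def by measurable
  have int: "fock_integrand p \<alpha> f z = (cmod z ^ m * exp (- (\<alpha> * (cmod z)\<^sup>2 / 2))) powr p * cmod (h z) powr p" for z
    by (simp add: fock_integrand_def f norm_mult norm_power powr_mult powr_def[of "exp _"] mult_ac)
  have le: "fock_integrand p \<alpha> f (of_real x * z)
      \<le> exp (- (p * \<alpha> * C\<^sup>2 / 2)) * (cmod z ^ m * exp (- (\<alpha> * (cmod z)\<^sup>2 / 2))) powr p * cmod (h (of_real x * z)) powr p"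
    if z: "cmod z < R" for z
  \<comment> \<open>The weight comparison divides by \<open>cmod z\<close>; at the origin
    \<open>f\<close> is zero because \<open>1 \<le> m\<close>.\<close>
  proof (cases "z = 0")
    case True
    then show ?thesis
      using m by (simp add: fock_integrand_def f zero_power)
  next
    case False
    define b where "b = cmod z"
    have b: "0 < b" "b < R" using False z by (auto simp: b_def)
    have "(x * b - b) * (R\<^sup>2 / b - (x * b + b) / 2) = - ((1 - x) * (R\<^sup>2 - b\<^sup>2 * (1 + x) / 2))"
      using b by (simp add: field_simps power2_eq_square)
    \<comment> \<open>The worst radius is \<open>b = R\<close>, where the exponent is exactly
      \<open>- C\<^sup>2 / 2\<close>.\<close>
    also have "\<dots> \<le> - ((1 - x) * (R\<^sup>2 - R\<^sup>2 * (1 + x) / 2))"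
    proof -
      have "b\<^sup>2 \<le> R\<^sup>2"
      using b by (intro power_mono) auto
    then show ?thesis
      using x(1,2) by (intro le_imp_neg_le mult_left_mono diff_left_mono divide_right_mono mult_right_mono) auto
    qed
    also have "\<dots> = - (((1 - x) * R)\<^sup>2 / 2)"
      by (simp add: field_simps power2_eq_square)
    finally have "\<alpha> * ((x * b - b) * (R\<^sup>2 / b - (x * b + b) / 2)) \<le> \<alpha> * (- (C\<^sup>2 / 2))"
      unfolding x(3) using \<alpha> by (intro mult_left_mono) auto
    then have "b ^ m * exp (- (\<alpha> * b\<^sup>2 / 2)) * exp (\<alpha> * ((x * b - b) * (R\<^sup>2 / b - (x * b + b) / 2)))
        \<le> b ^ m * exp (- (\<alpha> * b\<^sup>2 / 2)) * exp (\<alpha> * (- (C\<^sup>2 / 2)))"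
      using b by (intro mult_left_mono) auto
    moreover have "(x * b) ^ m * exp (- (\<alpha> * (x * b)\<^sup>2 / 2)) \<le>
        b ^ m * exp (- (\<alpha> * b\<^sup>2 / 2)) * exp (\<alpha> * ((x * b - b) * (R\<^sup>2 / b - (x * b + b) / 2)))"
      using m(1) b x(1) by (intro weight_ratio_le) auto
    ultimately have "(x * b) ^ m * exp (- (\<alpha> * (x * b)\<^sup>2 / 2))
        \<le> b ^ m * exp (- (\<alpha> * b\<^sup>2 / 2)) * exp (\<alpha> * (- (C\<^sup>2 / 2)))"
      by (rule order_trans[rotated])
    then have "((x * b) ^ m * exp (- (\<alpha> * (x * b)\<^sup>2 / 2))) powr p
        \<le> (b ^ m * exp (- (\<alpha> * b\<^sup>2 / 2)) * exp (\<alpha> * (- (C\<^sup>2 / 2)))) powr p"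
      using b x(1) p by (intro powr_mono2) auto
    also have "\<dots> = exp (- (p * \<alpha> * C\<^sup>2 / 2)) * (b ^ m * exp (- (\<alpha> * b\<^sup>2 / 2))) powr p"
      by (simp add: powr_mult powr_def[of "exp _"] mult_ac)
    finally show ?thesis
      unfolding int using x(1) by (simp add: b_def norm_mult mult_right_mono)
  qed
  have "fock_mass p \<alpha> f (ball 0 (R - C)) = ennreal (x\<^sup>2) *
      (\<integral>\<^sup>+z. ennreal (fock_integrand p \<alpha> f (0 + of_real x * z)) * indicator (ball 0 (R - C)) (0 + of_real x * z) \<partial>lborel)"
    unfolding fock_mass_def using x(1)
    by (intro nn_integral_affine_complex borel_measurable_times_ennreal borel_measurable_indicator sets_ball_complex) auto
  \<comment> \<open>The Jacobian \<open>x\<^sup>2\<close> of the dilation is discarded, being at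
    most 1.\<close>
  also have "\<dots> \<le> 1 * (\<integral>\<^sup>+z. ennreal (fock_integrand p \<alpha> f (of_real x * z)) * indicator (ball 0 R) z \<partial>lborel)"
  proof (rule mult_mono, goal_cases)
    case 2
    show ?case
    proof (rule nn_integral_mono)
      fix z :: complex
      have "cmod (of_real x * z) < R - C \<longleftrightarrow> cmod z < R"
        using x(1) by (simp add: norm_mult x(4)[symmetric])
      then have "indicator (ball 0 (R - C)) (0 + of_real x * z) = (indicator (ball 0 R) z :: ennreal)"
        by (simp add: indicator_def)
      then show "ennreal (fock_integrand p \<alpha> f (0 + of_real x * z)) * indicator (ball 0 (R - C)) (0 + of_real x * z)
         \<le> ennreal (fock_integrand p \<alpha> f (of_real x * z)) * indicator (ball 0 R) z"
        by simp
    qed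
  qed (use x(1,2) in \<open>auto simp: power_le_one ennreal_le_1\<close>)
  also have "\<dots> \<le> 1 * (\<integral>\<^sup>+z. ennreal (exp (- (p * \<alpha> * C\<^sup>2 / 2))) * (U z * ennreal (cmod (h (of_real x * z)) powr p)) \<partial>lborel)"
    using le by (intro mult_left_mono nn_integral_mono)
      (auto simp: U_def ennreal_mult[symmetric] mult.assoc intro!: ennreal_leI split: split_indicator)
  also have "\<dots> = ennreal (exp (- (p * \<alpha> * C\<^sup>2 / 2))) * (\<integral>\<^sup>+z. U z * ennreal (cmod (h (of_real x * z)) powr p) \<partial>lborel)"
    by (simp add: nn_integral_cmult)
  also have "\<dots> \<le> ennreal (exp (- (p * \<alpha> * C\<^sup>2 / 2))) * (\<integral>\<^sup>+z. U z *
     (\<integral>\<^sup>+t. (ennreal (poisson x t) * indicator {0..1} t) *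
           ennreal (cmod (h (z * cis (2 * pi * t))) powr p) \<partial>lborel) \<partial>lborel)"
    using h x(1,2) p by (intro mult_left_mono nn_integral_mono poisson_powr_le) auto
  \<comment> \<open>\<open>U\<close> is radial, so it may be evaluated at the rotated point;
    rotation averaging then removes the Poisson kernel, which has mass 1.\<close>
  also have "\<dots> = ennreal (exp (- (p * \<alpha> * C\<^sup>2 / 2))) * (\<integral>\<^sup>+z.
     (\<integral>\<^sup>+t. (ennreal (poisson x t) * indicator {0..1} t) *
       (U (z * cis (2 * pi * t)) *  ennreal (cmod (h (z * cis (2 * pi * t))) powr p)) \<partial>lborel) \<partial>lborel)"
  proof -
    have [measurable]: "cis \<in> borel_measurable borel"
      unfolding cis_conv_exp by measurable
    have "U (z * cis (2 * pi * t)) = U z" for z t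
      by (simp add: U_def norm_mult indicator_def)
    then show ?thesis
      by (subst nn_integral_cmult[symmetric]) (auto simp: mult_ac)
  qed
  also have "\<dots> = ennreal (exp (- (p * \<alpha> * C\<^sup>2 / 2))) * (\<integral>\<^sup>+z. U z * ennreal (cmod (h z) powr p) \<partial>lborel)"
    using x(1,2) by (subst nn_integral_rotation_average) (auto simp: nn_integral_poisson)
  also have "(\<integral>\<^sup>+z. U z * ennreal (cmod (h z) powr p) \<partial>lborel) = fock_mass p \<alpha> f (ball 0 R)"
    by (auto simp: fock_mass_def int U_def ennreal_mult mult_ac intro!: nn_integral_cong)
  finally show ?thesis .
qed

lemma fock_mass_vanishing_core:
  assumes f: "f \<in> vanishing_space p \<alpha> l m"
    and m: "1 \<le> m" and C: "0 < C" "C < sqrt (real m / \<alpha>)" and p: "1 \<le> p" and \<alpha>: "0 < \<alpha>"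
  shows "fock_mass p \<alpha> f (ball l (sqrt (real m / \<alpha>) - C))
     \<le> ennreal (exp (- (p * \<alpha> * C\<^sup>2 / 2))) * fock_mass p \<alpha> f (ball l (sqrt (real m / \<alpha>)))"
proof -
  have "fock_translate \<alpha> (- l) f \<in> vanishing_space p \<alpha> (l + - l) m"
    by (rule vanishing_space_translate[OF f])
  then obtain h where "h holomorphic_on UNIV" "\<And>z. fock_translate \<alpha> (- l) f z = (z - (l + - l)) ^ m * h z"
    using vanishing_space_factor by metis
  moreover have "f holomorphic_on UNIV"
    using f by (meson fock_space_holomorphic vanishing_space_subset)
  ultimately show ?thesis
    using fock_mass_vanishing_core_0[of h "fock_translate \<alpha> (- l) f" m \<alpha> "sqrt (real m / \<alpha>)" C p] assms
    by (simp add: fock_mass_translate_ball)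
qed

text \<open>For each competitor \<open>g\<close>, write \<open>f\<close> as
  \<open>(f - g) + g\<close> on the shrunk disc, contract \<open>g\<close>, and write
  \<open>g\<close> as \<open>(g - f) + f\<close> on the full disc. Each splitting costs
  \<open>2 powr p\<close>, hence the factor \<open>4 powr p\<close>.\<close>

lemma fock_mass_core_le_quotient_norm:
  assumes f: "f \<in> fock_space p \<alpha>"
    and m: "1 \<le> m" and C: "0 < C" "C < sqrt (real m / \<alpha>)" and p: "1 \<le> p" and \<alpha>: "0 < \<alpha>"
  shows "fock_mass p \<alpha> f (ball l (sqrt (real m / \<alpha>) - C))
     \<le> ennreal (2 powr p * (1 + 2 powr p)) * ennreal (quotient_norm p \<alpha> l m f powr p)
       + ennreal (4 powr p * exp (- (p * \<alpha> * C\<^sup>2 / 2))) * fock_mass p \<alpha> f (ball l (sqrt (real m / \<alpha>)))"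
proof -
  define X where "X = fock_mass p \<alpha> f (ball l (sqrt (real m / \<alpha>) - C))"
  define \<epsilon> where "\<epsilon> = exp (- (p * \<alpha> * C\<^sup>2 / 2))"
  define Y where "Y = fock_mass p \<alpha> f (ball l (sqrt (real m / \<alpha>)))"
  define A where "A = 2 powr p * (1 + 2 powr p)"
  have \<epsilon>: "0 \<le> \<epsilon>" "\<epsilon> \<le> 1" using p \<alpha> by (auto simp: \<epsilon>_def)
  have A: "0 < A" by (simp add: A_def add_pos_pos)
  have fin: "X < \<infinity>" "Y < \<infinity>"
    using fock_mass_finite[OF f] by (auto simp: X_def Y_def)
  have [measurable]: "f \<in> borel_measurable borel"
    using f by (simp add: measurable_entire fock_space_def)
  have *: "X \<le> ennreal A * fock_mass p \<alpha> (\<lambda>z. f z - g z) UNIV + ennreal (4 powr p * \<epsilon>) * Y"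
    if g: "g \<in> vanishing_space p \<alpha> l m" for g
  proof -
    have [measurable]: "g \<in> borel_measurable borel"
      using vanishing_space_subset[OF g] by (simp add: measurable_entire fock_space_def)
    define Q where "Q = fock_mass p \<alpha> (\<lambda>z. f z - g z) UNIV"
    have Q: "fock_mass p \<alpha> (\<lambda>z. f z - g z) S \<le> Q" "fock_mass p \<alpha> (\<lambda>z. g z - f z) S \<le> Q" for S
      using fock_mass_mono[of S UNIV p \<alpha>] unfolding Q_def
      by (auto simp: fock_mass_minus_commute[of p \<alpha> g f])
    have "X \<le> ennreal (2 powr p) * (fock_mass p \<alpha> (\<lambda>z. f z - g z) (ball l (sqrt (real m / \<alpha>) - C))
          + fock_mass p \<alpha> g (ball l (sqrt (real m / \<alpha>) - C)))"
      using fock_mass_add_le[of "\<lambda>z. f z - g z" g "ball l (sqrt (real m / \<alpha>) - C)" p \<alpha>] p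
      by (simp add: X_def)
    also have "\<dots> \<le> ennreal (2 powr p) * (Q + fock_mass p \<alpha> g (ball l (sqrt (real m / \<alpha>) - C)))"
      by (intro mult_left_mono add_right_mono Q) simp
    also have "\<dots> \<le> ennreal (2 powr p) * (Q + ennreal \<epsilon> * fock_mass p \<alpha> g (ball l (sqrt (real m / \<alpha>))))"
      unfolding \<epsilon>_def using assms by (intro mult_left_mono add_left_mono fock_mass_vanishing_core g) auto
    also have "\<dots> \<le> ennreal (2 powr p) * (Q + ennreal \<epsilon> * (ennreal (2 powr p) *
        (fock_mass p \<alpha> (\<lambda>z. g z - f z) (ball l (sqrt (real m / \<alpha>))) + Y)))"
      using fock_mass_add_le[of "\<lambda>z. g z - f z" f "ball l (sqrt (real m / \<alpha>))" p \<alpha>] p unfolding Y_def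
      by (intro mult_left_mono add_left_mono) simp_all
    also have "\<dots> \<le> ennreal (2 powr p) * (Q + ennreal \<epsilon> * (ennreal (2 powr p) * (Q + Y)))"
      by (intro mult_left_mono add_left_mono add_right_mono Q) simp_all
    also have "\<dots> = ennreal (2 powr p) * Q + ennreal (2 powr p) * ennreal (2 powr p) * ennreal \<epsilon> * Q
       + ennreal (2 powr p) * ennreal (2 powr p) * ennreal \<epsilon> * Y"
      by (simp add: distrib_left distrib_right mult_ac add_ac)
    also have "\<dots> \<le> ennreal (2 powr p) * Q + ennreal (2 powr p) * ennreal (2 powr p) * 1 * Q
       + ennreal (2 powr p) * ennreal (2 powr p) * ennreal \<epsilon> * Y"
      using \<epsilon> by (intro add_mono mult_mono order_refl) (auto simp: ennreal_le_1)
    also have "\<dots> = ennreal A * Q + ennreal (4 powr p * \<epsilon>) * Y"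
    proof -
      have "(4::real) powr p = 2 powr p * 2 powr p"
        by (simp add: powr_mult[symmetric])
      then show ?thesis
        using \<epsilon> by (simp add: A_def ennreal_mult distrib_left distrib_right ennreal_plus mult_ac)
    qed
    finally show ?thesis by (simp add: Q_def)
  qed
  \<comment> \<open>The term without \<open>g\<close> is moved to the left (by truncated
    subtraction) before the infimum over \<open>g\<close> is taken.\<close>
  have "(X - ennreal (4 powr p * \<epsilon>) * Y) / ennreal A \<le> ennreal (quotient_norm p \<alpha> l m f powr p)"
  proof (rule quotient_norm_powr_ge[OF f])
    fix g assume g: "g \<in> vanishing_space p \<alpha> l m"
    have "X - ennreal (4 powr p * \<epsilon>) * Y \<le> ennreal A * fock_mass p \<alpha> (\<lambda>z. f z - g z) UNIV"
      using *[OF g] fin by (auto simp: ennreal_minus_le_iff add.commute)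
    then show "(X - ennreal (4 powr p * \<epsilon>) * Y) / ennreal A \<le> fock_mass p \<alpha> (\<lambda>z. f z - g z) UNIV"
      using A by (intro divide_le_posI_ennreal) auto
  qed (use p in auto)
  then have "ennreal A * ((X - ennreal (4 powr p * \<epsilon>) * Y) / ennreal A) \<le> ennreal A * ennreal (quotient_norm p \<alpha> l m f powr p)"
    by (rule mult_left_mono) simp
  also have "ennreal A * ((X - ennreal (4 powr p * \<epsilon>) * Y) / ennreal A) = X - ennreal (4 powr p * \<epsilon>) * Y"
    using A by (simp add: ennreal_times_divide mult.commute[of "ennreal A"] ennreal_mult_divide_eq)
  finally have "X \<le> ennreal (4 powr p * \<epsilon>) * Y + ennreal A * ennreal (quotient_norm p \<alpha> l m f powr p)"
    by (simp add: ennreal_minus_le_iff)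
  then show ?thesis
    by (simp add: X_def Y_def A_def \<epsilon>_def add.commute)
qed

subsection \<open>Smoothed Taylor polynomials\<close>

definition taylor_poly :: "(complex \<Rightarrow> complex) \<Rightarrow> nat \<Rightarrow> complex \<Rightarrow> complex" where
  "taylor_poly f n z = (\<Sum>j<n. (deriv ^^ j) f 0 / fact j * z ^ j)"

lemma holomorphic_taylor_poly [holomorphic_intros]: "taylor_poly f n holomorphic_on S"
  unfolding taylor_poly_def[abs_def] by (intro holomorphic_intros)

lemma higher_deriv_taylor_poly:
  "(deriv ^^ j) (taylor_poly f n) 0 = (if j < n then (deriv ^^ j) f 0 else 0)"
proof (induction n)
  case 0
  then show ?case by (simp add: taylor_poly_def[abs_def])
next
  case (Suc n)
  define a where "a = (deriv ^^ n) f 0 / fact n"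
  have "(deriv ^^ j) (taylor_poly f (Suc n)) 0 = (deriv ^^ j) (\<lambda>z. taylor_poly f n z + a * z ^ n) 0"
    by (simp add: taylor_poly_def[abs_def] a_def)
  also have "\<dots> = (deriv ^^ j) (taylor_poly f n) 0 + (deriv ^^ j) (\<lambda>z. a * z ^ n) 0"
    by (rule higher_deriv_add[of _ UNIV]) (auto intro!: holomorphic_intros)
  also have "(deriv ^^ j) (\<lambda>z. a * z ^ n) 0 = a * (deriv ^^ j) (\<lambda>z. z ^ n) 0"
    by (rule higher_deriv_cmult[of _ UNIV]) (auto intro!: holomorphic_intros)
  also have "(deriv ^^ j) (\<lambda>z. z ^ n) 0 = (if j = n then fact n else (0::complex))"
    using higher_deriv_power[of j 0 n 0]
    by (cases j n rule: linorder_cases) (auto simp: pochhammer_fact pochhammer_0_left)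
  finally show ?case
    using Suc.IH by (auto simp: a_def less_Suc_eq)
qed

lemma taylor_poly_remainder:
  assumes f: "f holomorphic_on UNIV" and k: "k \<le> n"
  shows "\<exists>g. g holomorphic_on UNIV \<and> (\<forall>z. f z - taylor_poly f n z = z ^ k * g z)"
proof -
  have "(deriv ^^ j) (\<lambda>z. f z - taylor_poly f n z) 0 = 0" if "j < k" for j
    using that k by (subst higher_deriv_diff[of _ UNIV])
      (auto simp: higher_deriv_taylor_poly intro!: holomorphic_intros f)
  from entire_vanishing_factor[OF _ this] show ?thesis
    by (auto intro!: holomorphic_intros f)
qed

text \<open>Expand \<open>w ^ n / (1 - w) = 1 / (1 - w) - (\<Sum>j<n. w ^ j)\<close> with \<open>w = z / u\<close>: the first part is
  Cauchy's formula, the second gives the Taylor coefficients.\<close>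

lemma circle_mean_taylor_remainder:
  assumes f: "f holomorphic_on UNIV" and \<zeta>: "\<zeta> \<noteq> 0" and ne: "cmod z \<noteq> cmod \<zeta>"
  shows "((\<lambda>x. f (\<zeta> * cis (2 * pi * x)) * ((z / (\<zeta> * cis (2 * pi * x))) ^ n / (1 - z / (\<zeta> * cis (2 * pi * x)))))
      has_integral (if cmod z < cmod \<zeta> then f z else 0) - taylor_poly f n z) {0..1}"
proof -
  define F where "F u = f (\<zeta> * u)" for u
  have F: "F holomorphic_on UNIV"
    unfolding F_def by (intro holomorphic_entire_compose[OF f] holomorphic_intros)
  have F': "F holomorphic_on S" for S
    using F by (rule holomorphic_on_subset) auto
  define b where "b = z / \<zeta>"
  have b: "cmod b \<noteq> 1"
    using ne \<zeta> by (auto simp: b_def norm_divide)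
  have 1: "((\<lambda>x. F (cis (2 * pi * x)) / (cis (2 * pi * x) - b) * cis (2 * pi * x)) has_integral
     (if cmod z < cmod \<zeta> then f z else 0)) {0..1}"
  proof (cases "cmod z < cmod \<zeta>")
    case True
    then have "cmod b < 1"
      using \<zeta> by (simp add: b_def norm_divide)
    then have "((\<lambda>x. F (cis (2 * pi * x)) / (cis (2 * pi * x) - b) * cis (2 * pi * x)) has_integral F b) {0..1}"
      using F' by (intro circle_mean_Cauchy_inside holomorphic_on_imp_continuous_on) auto
    then show ?thesis
      using True \<zeta> by (simp add: F_def b_def)
  next
    case False
    then have "cmod b > 1"
      using b \<zeta> by (simp add: b_def norm_divide)
    then show ?thesis
      using circle_mean_Cauchy_outside[OF F] False by simp
  qed
  have 2: "((\<lambda>x. (\<Sum>j<n. b ^ j * (F (cis (2 * pi * x)) / cis (2 * pi * x) ^ j))) has_integral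
     taylor_poly f n z) {0..1}"
  proof -
    have "(deriv ^^ j) F 0 = \<zeta> ^ j * (deriv ^^ j) f 0" for j
      unfolding F_def using higher_deriv_compose_linear[OF f, of UNIV 0 \<zeta> j] by simp
    then have "taylor_poly f n z = (\<Sum>j<n. b ^ j * ((deriv ^^ j) F 0 / fact j))"
      using \<zeta> by (simp add: taylor_poly_def b_def power_divide mult.commute)
    then show ?thesis
      by (simp only:) (intro has_integral_sum has_integral_mult_right circle_mean_coeff F finite_lessThan)
  qed
  have eq: "F u / (u - b) * u - (\<Sum>j<n. b ^ j * (F u / u ^ j)) = F u * ((b / u) ^ n / (1 - b / u))"
    if "cmod u = 1" for u
  proof -
    have u: "u \<noteq> 0" "u \<noteq> b" using that b by auto
    then have "b / u \<noteq> 1" by (auto simp: field_simps)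
    then have "(\<Sum>j<n. (b / u) ^ j) = ((b / u) ^ n - 1) / (b / u - 1)"
      by (rule geometric_sum)
    also have "\<dots> = 1 / (1 - b / u) - (b / u) ^ n / (1 - b / u)"
      using \<open>b / u \<noteq> 1\<close> by (simp add: divide_simps) (simp add: algebra_simps)
    finally have "F u * (\<Sum>j<n. (b / u) ^ j) = F u * (1 / (1 - b / u)) - F u * ((b / u) ^ n / (1 - b / u))"
      by (simp add: right_diff_distrib)
    moreover have "1 / (1 - b / u) = u / (u - b)"
      using u by (simp add: divide_simps)
    ultimately show ?thesis
      by (simp add: sum_distrib_left power_divide mult_ac)
  qed
  have "((\<lambda>x. F (cis (2 * pi * x)) * ((b / cis (2 * pi * x)) ^ n / (1 - b / cis (2 * pi * x))))
      has_integral (if cmod z < cmod \<zeta> then f z else 0) - taylor_poly f n z) {0..1}"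
    using has_integral_diff[OF 1 2] by (simp only: eq norm_cis)
  then show ?thesis
    by (simp add: F_def b_def)
qed

text \<open>Averaging the Taylor polynomials over their degrees replaces the kernel \<open>w ^ m / (1 - w)\<close>
  by one that decays like \<open>\<bar>1 - w\<bar> powr -4\<close>, which is integrable over the plane.\<close>

definition smooth_kernel :: "nat \<Rightarrow> nat \<Rightarrow> complex \<Rightarrow> complex" where
  "smooth_kernel m K w = w ^ m * ((\<Sum>k<K. w ^ k) / of_nat K) ^ 3 / (1 - w)"

text \<open>Three independent averages over the degree produce the cube in
  \<open>smooth_kernel\<close>; no degree bound in the average is below \<open>m\<close>.\<close>

definition smooth_taylor :: "(complex \<Rightarrow> complex) \<Rightarrow> nat \<Rightarrow> nat \<Rightarrow> complex \<Rightarrow> complex" where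
  "smooth_taylor f m K z =
     (\<Sum>i<K. \<Sum>j<K. \<Sum>k<K. taylor_poly f (m + i + j + k) z) / of_nat K ^ 3"

lemma smooth_kernel_expand:
  "smooth_kernel m K w = (\<Sum>i<K. \<Sum>j<K. \<Sum>k<K. w ^ (m + i + j + k) / (1 - w)) / of_nat K ^ 3"
proof -
  have "(\<Sum>k<K. w ^ k) ^ 3 = (\<Sum>i<K. \<Sum>j<K. \<Sum>k<K. w ^ i * (w ^ j * w ^ k))"
    unfolding power3_eq_cube mult.assoc sum_distrib_right sum_distrib_left by (simp only: mult_ac)
  then have "smooth_kernel m K w = w ^ m * (\<Sum>i<K. \<Sum>j<K. \<Sum>k<K. w ^ i * (w ^ j * w ^ k)) / of_nat K ^ 3 / (1 - w)"
    by (simp add: smooth_kernel_def power_divide)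
  also have "\<dots> = (\<Sum>i<K. \<Sum>j<K. \<Sum>k<K. w ^ (m + i + j + k) / (1 - w)) / of_nat K ^ 3"
    by (simp add: sum_distrib_left sum_divide_distrib power_add mult_ac)
  finally show ?thesis .
qed

lemma holomorphic_smooth_taylor: "smooth_taylor f m K holomorphic_on S"
proof (cases "K = 0")
  case False
  then show ?thesis
    unfolding smooth_taylor_def[abs_def] by (intro holomorphic_intros) auto
qed (simp add: smooth_taylor_def[abs_def])

lemma circle_mean_smooth_taylor:
  assumes f: "f holomorphic_on UNIV" and \<zeta>: "\<zeta> \<noteq> 0" and ne: "cmod z \<noteq> cmod \<zeta>" and K: "0 < K"
  shows "((\<lambda>x. f (\<zeta> * cis (2 * pi * x)) * smooth_kernel m K (z / (\<zeta> * cis (2 * pi * x))))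
      has_integral (if cmod z < cmod \<zeta> then f z else 0) - smooth_taylor f m K z) {0..1}"
proof -
  define c where "c = (if cmod z < cmod \<zeta> then f z else 0)"
  have "((\<lambda>x. (\<Sum>i<K. \<Sum>j<K. \<Sum>k<K. f (\<zeta> * cis (2 * pi * x)) *
       ((z / (\<zeta> * cis (2 * pi * x))) ^ (m + i + j + k) / (1 - z / (\<zeta> * cis (2 * pi * x))))) * (1 / of_nat K ^ 3))
     has_integral (\<Sum>i<K. \<Sum>j<K. \<Sum>k<K. c - taylor_poly f (m + i + j + k) z) * (1 / of_nat K ^ 3)) {0..1}"
    unfolding c_def
    by (intro has_integral_sum has_integral_mult_left circle_mean_taylor_remainder f \<zeta> ne finite_lessThan)
  moreover have "(\<Sum>i<K. \<Sum>j<K. \<Sum>k<K. c - taylor_poly f (m + i + j + k) z) * (1 / of_nat K ^ 3)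
      = c - smooth_taylor f m K z"
    using K by (simp add: sum_subtractf smooth_taylor_def diff_divide_distrib power3_eq_cube)
  moreover have "(\<Sum>i<K. \<Sum>j<K. \<Sum>k<K. y * (w ^ (m + i + j + k) / (1 - w))) * (1 / of_nat K ^ 3)
     = y * smooth_kernel m K w" for y w :: complex
    by (simp add: smooth_kernel_expand sum_distrib_left)
  ultimately show ?thesis
    by (simp add: c_def)
qed

text \<open>Every polynomial in the average keeps at least the first \<open>m\<close> Taylor
  coefficients of \<open>f\<close>, hence so does the average.\<close>

lemma smooth_taylor_remainder:
  assumes f: "f holomorphic_on UNIV" and K: "0 < K"
  shows "\<exists>g. g holomorphic_on UNIV \<and> (\<forall>z. f z - smooth_taylor f m K z = z ^ m * g z)"
proof -
  have "\<exists>g. \<forall>i j k. g i j k holomorphic_on UNIV \<and> (\<forall>z. f z - taylor_poly f (m + i + j + k) z = z ^ m * g i j k z)"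
    using taylor_poly_remainder[OF f, of m] by (intro choice allI) auto
  then obtain g where g: "\<And>i j k. g i j k holomorphic_on UNIV"
    and eq: "\<And>i j k z. f z - taylor_poly f (m + i + j + k) z = z ^ m * g i j k z"
    by metis
  define G where "G z = (\<Sum>i<K. \<Sum>j<K. \<Sum>k<K. g i j k z) / of_nat K ^ 3" for z
  have "G holomorphic_on UNIV"
    unfolding G_def using K by (intro holomorphic_intros g) auto
  moreover have "f z - smooth_taylor f m K z = z ^ m * G z" for z
  proof -
    have "f z - smooth_taylor f m K z = (\<Sum>i<K. \<Sum>j<K. \<Sum>k<K. f z - taylor_poly f (m + i + j + k) z) / of_nat K ^ 3"
      using K by (simp add: sum_subtractf smooth_taylor_def diff_divide_distrib power3_eq_cube)
    then show ?thesis
      by (simp add: eq G_def sum_distrib_left)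
  qed
  ultimately show ?thesis by blast
qed

text \<open>An integrable majorant of the inverse fourth power away from 0, in product form so that
  its integral splits into two arctangent integrals.\<close>

definition decay :: "complex \<Rightarrow> real" where
  "decay z = 1 / ((1 + (Re z)\<^sup>2) * (1 + (Im z)\<^sup>2))"

lemma decay_pos: "0 < decay z"
  by (simp add: decay_def add_pos_nonneg)

lemma decay_nonneg [simp]: "0 \<le> decay z"
  using decay_pos[of z] by simp

lemma measurable_decay [measurable]: "decay \<in> borel_measurable borel"
  unfolding decay_def[abs_def] by measurable

lemma nn_integral_inverse_quadratic: "(\<integral>\<^sup>+x. ennreal (1 / (1 + x\<^sup>2)) \<partial>lborel) \<le> ennreal pi"
proof -
  have half: "(\<integral>\<^sup>+x. ennreal (1 / (1 + x\<^sup>2)) * indicator {0..} x \<partial>lborel) = ennreal (pi / 2)"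
  proof -
    have "(\<integral>\<^sup>+x. ennreal (1 / (1 + x\<^sup>2)) * indicator {0..} x \<partial>lborel) = ennreal (pi / 2 - arctan 0)"
      by (rule nn_integral_FTC_atLeast)
         (auto intro!: derivative_eq_intros tendsto_arctan_at_top simp: field_simps)
    then show ?thesis by simp
  qed
  have "(\<integral>\<^sup>+x. ennreal (1 / (1 + x\<^sup>2)) \<partial>lborel)
      \<le> (\<integral>\<^sup>+x. ennreal (1 / (1 + x\<^sup>2)) * indicator {0..} x + ennreal (1 / (1 + (0 + -1 * x)\<^sup>2)) * indicator {0..} (0 + -1 * x) \<partial>lborel)"
    by (intro nn_integral_mono) (auto split: split_indicator)
  also have "\<dots> = ennreal (pi / 2) + (\<integral>\<^sup>+x. ennreal (1 / (1 + (0 + -1 * x)\<^sup>2)) * indicator {0..} (0 + -1 * x) \<partial>lborel)"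
    by (subst nn_integral_add) (auto simp: half)
  also have "(\<integral>\<^sup>+x. ennreal (1 / (1 + (0 + -1 * x)\<^sup>2)) * indicator {0..} (0 + -1 * x) \<partial>lborel) = ennreal (pi / 2)"
    using nn_integral_real_affine[of "\<lambda>x. ennreal (1 / (1 + x\<^sup>2)) * indicator {0..} x" "-1" 0] half by simp
  also have "ennreal (pi / 2) + ennreal (pi / 2) = ennreal pi"
    by (subst ennreal_plus[symmetric]) auto
  finally show ?thesis .
qed

lemma nn_integral_decay: "(\<integral>\<^sup>+z. ennreal (decay (w - z)) \<partial>lborel) \<le> ennreal (pi\<^sup>2)"
proof -
  have "(\<integral>\<^sup>+z. ennreal (decay (w - z)) \<partial>lborel) = (\<integral>\<^sup>+z. ennreal (decay z) \<partial>lborel)"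
    by (subst nn_integral_affine_complex[of "\<lambda>z. ennreal (decay z)" "-1" w]) auto
  also have "\<dots> = (\<integral>\<^sup>+x. \<integral>\<^sup>+y. ennreal (1 / (1 + x\<^sup>2)) * ennreal (1 / (1 + y\<^sup>2)) \<partial>lborel \<partial>lborel)"
    by (subst nn_integral_complex) (auto simp: decay_def ennreal_mult[symmetric] intro!: nn_integral_cong)
  also have "\<dots> = (\<integral>\<^sup>+x. ennreal (1 / (1 + x\<^sup>2)) \<partial>lborel) * (\<integral>\<^sup>+x. ennreal (1 / (1 + x\<^sup>2)) \<partial>lborel)"
    by (subst nn_integral_cmult) (auto simp: nn_integral_multc)
  also have "\<dots> \<le> ennreal pi * ennreal pi"
    by (intro mult_mono nn_integral_inverse_quadratic) auto
  finally show ?thesis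
    by (simp add: ennreal_mult[symmetric] power2_eq_square)
qed

text \<open>Both factors in the denominator of \<open>decay\<close> are at most
  \<open>1 + (cmod z)\<^sup>2\<close>, which is at most
  \<open>(1 + 1 / \<delta>\<^sup>2) * (cmod z)\<^sup>2\<close> when
  \<open>\<delta> \<le> cmod z\<close>.\<close>

lemma decay_ge:
  assumes d: "0 < \<delta>" "\<delta> \<le> cmod z"
  shows "1 / cmod z ^ 4 \<le> (1 + 1 / \<delta>\<^sup>2)\<^sup>2 * decay z"
proof -
  define e where "e = (cmod z)\<^sup>2"
  have "0 < cmod z" using d by linarith
  then have e: "0 < e" "e = (Re z)\<^sup>2 + (Im z)\<^sup>2" "\<delta>\<^sup>2 \<le> e"
    using d power_mono[OF d(2), of 2] zero_less_power[of "cmod z" 2] unfolding e_def by (simp_all add: cmod_power2)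
  have "(1 + (Re z)\<^sup>2) * (1 + (Im z)\<^sup>2) \<le> (1 + e) * (1 + e)"
    using e by (intro mult_mono) auto
  also have "1 + e \<le> (1 + 1 / \<delta>\<^sup>2) * e"
    using e d by (simp add: field_simps)
  then have "(1 + e) * (1 + e) \<le> ((1 + 1 / \<delta>\<^sup>2) * e) * ((1 + 1 / \<delta>\<^sup>2) * e)"
    using e by (intro mult_mono) (auto intro: order_trans)
  finally have le: "(1 + (Re z)\<^sup>2) * (1 + (Im z)\<^sup>2) \<le> (1 + 1 / \<delta>\<^sup>2)\<^sup>2 * e\<^sup>2"
    by (simp add: power2_eq_square mult_ac)
  have ineq: "1 / a \<le> c * (1 / b)" if "0 < a" "0 < b" "b \<le> c * a" for a b c :: real
    using that by (simp add: field_simps)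
  have "0 < (1 + (Re z)\<^sup>2) * (1 + (Im z)\<^sup>2)"
    by (intro mult_pos_pos add_pos_nonneg) auto
  then have "1 / e\<^sup>2 \<le> (1 + 1 / \<delta>\<^sup>2)\<^sup>2 * (1 / ((1 + (Re z)\<^sup>2) * (1 + (Im z)\<^sup>2)))"
    using le e(1) by (intro ineq) auto
  then show ?thesis
    by (simp add: decay_def e_def flip: power_mult)
qed

text \<open>The geometric sum is \<open>(w ^ K - 1) / (w - 1)\<close>; both terms of the numerator
  are at most \<open>max 1 (cmod w) ^ K\<close>, on either side of the unit circle.\<close>

lemma norm_power_mean_le:
  assumes w: "w \<noteq> 1" and K: "0 < K"
  shows "cmod ((\<Sum>k<K. w ^ k) / of_nat K) \<le> 2 * max 1 (cmod w) ^ K / (real K * cmod (1 - w))"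
proof -
  have "cmod (w ^ K - 1) \<le> cmod w ^ K + 1"
    by (metis norm_one norm_power norm_triangle_ineq4)
  also have "\<dots> \<le> max 1 (cmod w) ^ K + max 1 (cmod w) ^ K"
    by (intro add_mono power_mono) (auto simp: one_le_power)
  finally have "cmod (w ^ K - 1) \<le> 2 * max 1 (cmod w) ^ K" by simp
  moreover have "(\<Sum>k<K. w ^ k) = (w ^ K - 1) / (w - 1)"
    using w by (rule geometric_sum)
  then have "cmod (\<Sum>k<K. w ^ k) * cmod (1 - w) = cmod (w ^ K - 1)"
    unfolding norm_minus_commute[of 1 w] using w by (simp add: norm_divide)
  ultimately have "cmod (\<Sum>k<K. w ^ k) * cmod (1 - w) \<le> 2 * max 1 (cmod w) ^ K"
    by simp
  then have "cmod (\<Sum>k<K. w ^ k) \<le> 2 * max 1 (cmod w) ^ K / cmod (1 - w)"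
    using w by (simp add: pos_le_divide_eq)
  then have "cmod (\<Sum>k<K. w ^ k) / real K \<le> 2 * max 1 (cmod w) ^ K / cmod (1 - w) / real K"
    by (rule divide_right_mono) simp
  then show ?thesis
    by (simp add: norm_divide mult.commute)
qed

text \<open>With \<open>w = z / u\<close> and \<open>d = cmod (z - u)\<close>, each of the three
  power means gains \<open>1 / (sqrt \<alpha> * d)\<close> and the factor \<open>1 / (1 - w)\<close>
  contributes \<open>cmod u / d\<close>, whence \<open>R / d ^ 4\<close>. Outside the circle the
  means may grow exponentially in the radial distance, but the weighted power \<open>w ^ m\<close>
  drops like a Gaussian there, since \<open>u\<close> lies close to the peak radius
  \<open>R\<close>.\<close>

lemma norm_smooth_kernel_le:
  assumes \<alpha>: "0 < \<alpha>" and m: "real m = \<alpha> * R\<^sup>2" "0 < R" and K: "K = nat \<lceil>sqrt \<alpha> * R\<rceil>" "1 \<le> sqrt \<alpha> * R"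
    and \<delta>: "\<delta> = 1 / (8 * sqrt \<alpha>)"
    and u: "R / 2 \<le> cmod u" "R - 4 * \<delta> \<le> cmod u" "cmod u \<le> R" and z: "\<delta> \<le> \<bar>cmod z - cmod u\<bar>"
  shows "cmod (smooth_kernel m K (z / u)) * exp (- (\<alpha> * (cmod z)\<^sup>2 / 2))
     \<le> 8 * exp 92 / sqrt \<alpha> ^ 3 * R * (1 + 1 / \<delta>\<^sup>2)\<^sup>2 * decay (z - u) * exp (- (\<alpha> * (cmod u)\<^sup>2 / 2))"
proof -
  define s where "s = sqrt \<alpha>"
  have s: "0 < s" "\<alpha> = s * s" using \<alpha> by (auto simp: s_def)
  define r where "r = cmod z"
  define \<rho> where "\<rho> = cmod u"
  define d where "d = cmod (z - u)"
  have \<rho>: "0 < \<rho>" "R / 2 \<le> \<rho>" "R - 4 * \<delta> \<le> \<rho>" "\<rho> \<le> R" using u m by (auto simp: \<rho>_def)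
  have \<delta>0: "0 < \<delta>" using \<alpha> by (simp add: \<delta>)
  have d: "\<delta> \<le> d" "0 < d"
    using z \<delta>0 norm_triangle_ineq3[of z u] by (auto simp: d_def)
  have u0: "u \<noteq> 0" using \<rho> by (auto simp: \<rho>_def)
  have "0 \<le> \<lceil>sqrt \<alpha> * R\<rceil>"
    using K(2) by (simp add: zero_le_ceiling)
  then have "real K = of_int \<lceil>sqrt \<alpha> * R\<rceil>"
    by (simp add: K(1))
  moreover have "1 \<le> s * R"
    using K(2) by (simp add: s_def)
  \<comment> \<open>Rounding up at most doubles, because \<open>1 \<le> s * R\<close>.\<close>
  ultimately have K': "s * R \<le> real K" "real K \<le> 2 * (s * R)"
    using ceiling_correct[of "s * R"] by (auto simp: s_def)
  then have "0 < real K"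
    using \<open>1 \<le> s * R\<close> by linarith
  then have "0 < K" by simp
  note K' = K' this
  have w1: "z / u \<noteq> 1"
    using d u0 by (auto simp: d_def)
  have n1: "cmod (1 - z / u) = d / \<rho>"
  proof -
    have "1 - z / u = (u - z) / u"
      using u0 by (simp add: diff_divide_distrib)
    then show ?thesis
      by (simp add: d_def \<rho>_def norm_divide norm_minus_commute)
  qed
  have nw: "cmod (z / u) = r / \<rho>"
    by (simp add: r_def \<rho>_def norm_divide)
  define M where "M = max 1 (r / \<rho>)"
  have M1: "1 \<le> M" by (simp add: M_def)
  have "cmod ((\<Sum>k<K. (z / u) ^ k) / of_nat K) \<le> 2 * M ^ K / (real K * (d / \<rho>))"
    using norm_power_mean_le[OF w1 K'(3)] by (simp only: nw n1 M_def)
  also have "\<dots> \<le> 2 * M ^ K / (s * d)"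
  proof (rule divide_left_mono)
    have "s * d * \<rho> \<le> real K * d"
    proof -
      have "s * \<rho> \<le> real K"
        using K'(1) \<rho> s mult_left_mono[of \<rho> R s] by linarith
      then have "(s * \<rho>) * d \<le> real K * d"
        using d by (intro mult_right_mono) auto
      then show ?thesis by (simp add: mult_ac)
    qed
    then show "s * d \<le> real K * (d / \<rho>)"
      using \<rho> by (simp add: field_simps)
    show "0 < real K * (d / \<rho>) * (s * d)"
      using K' \<rho> d s by (intro mult_pos_pos divide_pos_pos) auto
    show "0 \<le> 2 * M ^ K" using M1 by simp
  qed
  finally have mean: "cmod ((\<Sum>k<K. (z / u) ^ k) / of_nat K) ^ 3 \<le> (2 * M ^ K / (s * d)) ^ 3"
    by (intro power_mono) auto
  have "M \<le> exp (\<bar>r - \<rho>\<bar> / \<rho>)"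
  proof -
    have "r / \<rho> = 1 + (r - \<rho>) / \<rho>" using \<rho> by (simp add: field_simps)
    also have "\<dots> \<le> 1 + \<bar>r - \<rho>\<bar> / \<rho>" using \<rho> by (simp add: divide_right_mono)
    also have "\<dots> \<le> exp (\<bar>r - \<rho>\<bar> / \<rho>)" by (rule exp_ge_add_one_self)
    finally show ?thesis
      using \<rho> by (simp add: M_def)
  qed
  then have "M ^ (3 * K) \<le> exp (\<bar>r - \<rho>\<bar> / \<rho>) ^ (3 * K)"
    using M1 by (intro power_mono) auto
  also have "\<dots> = exp (real (3 * K) * (\<bar>r - \<rho>\<bar> / \<rho>))"
    by (simp only: exp_of_nat_mult)
  also have "\<dots> \<le> exp (12 * (s * \<bar>r - \<rho>\<bar>))"
  proof -
    have "s * R \<le> s * (2 * \<rho>)"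
      using \<rho> s by (intro mult_left_mono) auto
    also have "\<dots> = 2 * (s * \<rho>)" by simp
    finally have "3 * real K \<le> 12 * (s * \<rho>)"
      using K'(2) by linarith
    then have "real (3 * K) \<le> 12 * s * \<rho>" by simp
    then have "real (3 * K) * (\<bar>r - \<rho>\<bar> / \<rho>) \<le> 12 * s * \<rho> * (\<bar>r - \<rho>\<bar> / \<rho>)"
      using \<rho> by (intro mult_right_mono) auto
    then show ?thesis using \<rho> by simp
  qed
  finally have M: "M ^ (3 * K) \<le> exp (12 * (s * \<bar>r - \<rho>\<bar>))" .
  have weight: "r ^ m * exp (- (\<alpha> * r\<^sup>2 / 2)) \<le> \<rho> ^ m * exp (- (\<alpha> * \<rho>\<^sup>2 / 2)) *
       exp (\<alpha> * ((r - \<rho>) * (R\<^sup>2 / \<rho> - (r + \<rho>) / 2)))"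
    using m \<rho> by (intro weight_ratio_le) (auto simp: r_def)
  \<comment> \<open>With \<open>t = s * \<bar>r - \<rho>\<bar>\<close>, the linear terms are
    \<open>3 / 2 * t\<close>, since \<open>u\<close> may be off the peak radius by
    \<open>4 * \<delta>\<close>, and \<open>12 * t\<close> from the three means; the Gaussian
    contributes \<open>- t\<^sup>2 / 2\<close>. The maximum is \<open>729 / 8\<close>, rounded up to
    92.\<close>
  have expo: "\<alpha> * ((r - \<rho>) * (R\<^sup>2 / \<rho> - (r + \<rho>) / 2)) + 12 * (s * \<bar>r - \<rho>\<bar>) \<le> 92"
  proof -
    define y where "y = r - \<rho>"
    define t where "t = s * \<bar>y\<bar>"
    have "(R\<^sup>2 - \<rho>\<^sup>2) / \<rho> \<le> 12 * \<delta>"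
    proof -
      have "R\<^sup>2 - \<rho>\<^sup>2 = (R - \<rho>) * (R + \<rho>)" by (simp add: power2_eq_square algebra_simps)
      also have "\<dots> \<le> (4 * \<delta>) * (3 * \<rho>)"
        using \<rho> \<delta>0 m by (intro mult_mono) auto
      finally show ?thesis using \<rho> by (simp add: divide_le_eq mult_ac)
    qed
    moreover have "0 \<le> (R\<^sup>2 - \<rho>\<^sup>2) / \<rho>"
      using \<rho> by (auto intro!: divide_nonneg_pos power_mono)
    ultimately have "y * ((R\<^sup>2 - \<rho>\<^sup>2) / \<rho>) \<le> \<bar>y\<bar> * (12 * \<delta>)"
      by (intro mult_mono) auto
    moreover have "(r - \<rho>) * (R\<^sup>2 / \<rho> - (r + \<rho>) / 2) = y * ((R\<^sup>2 - \<rho>\<^sup>2) / \<rho>) - y\<^sup>2 / 2"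
      using \<rho> by (simp add: y_def field_simps power2_eq_square)
    ultimately have "\<alpha> * ((r - \<rho>) * (R\<^sup>2 / \<rho> - (r + \<rho>) / 2)) \<le> \<alpha> * (\<bar>y\<bar> * (12 * \<delta>) - y\<^sup>2 / 2)"
      using \<alpha> by (intro mult_left_mono) auto
    also have "\<dots> = 3 / 2 * t - t\<^sup>2 / 2"
    proof -
      have "\<delta> = 1 / (8 * s)" by (simp add: \<delta> s_def)
      then show ?thesis
        unfolding s(2) t_def using s(1) by (simp add: power_mult_distrib field_simps power2_eq_square)
    qed
    finally have "\<alpha> * ((r - \<rho>) * (R\<^sup>2 / \<rho> - (r + \<rho>) / 2)) + 12 * (s * \<bar>r - \<rho>\<bar>) \<le> 27 / 2 * t - t\<^sup>2 / 2"
      by (simp add: t_def y_def)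
    also have "\<dots> = 729 / 8 - (t - 27 / 2)\<^sup>2 / 2"
      by (simp add: power2_eq_square field_simps)
    also have "\<dots> \<le> 92" using zero_le_power2[of "t - 27 / 2"] by linarith
    finally show ?thesis .
  qed
  have "cmod (smooth_kernel m K (z / u)) * exp (- (\<alpha> * r\<^sup>2 / 2))
      = (r / \<rho>) ^ m * cmod ((\<Sum>k<K. (z / u) ^ k) / of_nat K) ^ 3 / (d / \<rho>) * exp (- (\<alpha> * r\<^sup>2 / 2))"
    unfolding smooth_kernel_def norm_divide[of "_ * _"] norm_mult norm_power n1 nw ..
  also have "\<dots> = (r ^ m * exp (- (\<alpha> * r\<^sup>2 / 2))) * cmod ((\<Sum>k<K. (z / u) ^ k) / of_nat K) ^ 3 * (\<rho> / d / \<rho> ^ m)"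
    by (simp add: power_divide mult_ac)
  also have "\<dots> \<le> (\<rho> ^ m * exp (- (\<alpha> * \<rho>\<^sup>2 / 2)) * exp (\<alpha> * ((r - \<rho>) * (R\<^sup>2 / \<rho> - (r + \<rho>) / 2))))
      * (2 * M ^ K / (s * d)) ^ 3 * (\<rho> / d / \<rho> ^ m)"
    by (rule mult_right_mono[OF mult_mono[OF weight mean]]) (use \<rho>(1) d(2) s(1) M1 in auto)
  also have "\<dots> = exp (- (\<alpha> * \<rho>\<^sup>2 / 2)) * exp (\<alpha> * ((r - \<rho>) * (R\<^sup>2 / \<rho> - (r + \<rho>) / 2)))
      * M ^ (3 * K) * (8 / s ^ 3) * \<rho> * (1 / d ^ 4)"
  proof -
    have "(2 * M ^ K / (s * d)) ^ 3 = 8 * M ^ (3 * K) / (s ^ 3 * d ^ 3)"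
      by (simp add: power_divide power_mult_distrib power_mult[symmetric] mult.commute)
    moreover have "d ^ 4 = d ^ 3 * d"
      by (simp add: eval_nat_numeral)
    ultimately show ?thesis
      using \<rho> by (simp add: mult_ac)
  qed
  also have "\<dots> \<le> exp (- (\<alpha> * \<rho>\<^sup>2 / 2)) * exp (\<alpha> * ((r - \<rho>) * (R\<^sup>2 / \<rho> - (r + \<rho>) / 2)))
      * exp (12 * (s * \<bar>r - \<rho>\<bar>)) * (8 / s ^ 3) * R * ((1 + 1 / \<delta>\<^sup>2)\<^sup>2 * decay (z - u))"
    using \<rho> s d M M1 decay_ge[OF \<delta>0 d(1)[unfolded d_def]] unfolding d_def[symmetric]
    by (intro mult_mono mult_nonneg_nonneg) auto
  also have "\<dots> = exp (- (\<alpha> * \<rho>\<^sup>2 / 2)) * exp (\<alpha> * ((r - \<rho>) * (R\<^sup>2 / \<rho> - (r + \<rho>) / 2)) + 12 * (s * \<bar>r - \<rho>\<bar>))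
      * ((8 / s ^ 3) * R * ((1 + 1 / \<delta>\<^sup>2)\<^sup>2 * decay (z - u)))"
    by (simp add: exp_add mult_ac)
  also have "\<dots> \<le> exp (- (\<alpha> * \<rho>\<^sup>2 / 2)) * exp 92 * ((8 / s ^ 3) * R * ((1 + 1 / \<delta>\<^sup>2)\<^sup>2 * decay (z - u)))"
    using expo s m by (intro mult_mono mult_nonneg_nonneg) auto
  finally show ?thesis
    by (simp add: r_def \<rho>_def s_def mult_ac)
qed

section \<open>The error and the norm of a smoothed Taylor polynomial\<close>

lemma emeasure_annulus:
  assumes "0 \<le> a" "a \<le> b"
  shows "emeasure lborel (ball 0 b - cball (0::complex) a) = ennreal (pi * (b\<^sup>2 - a\<^sup>2))"
proof (cases "a = b")
  case True
  have "ball 0 b - cball (0::complex) b = {}" by auto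
  then show ?thesis unfolding True by (simp only:) simp
next
  case False
  then have "emeasure lborel (ball 0 b - cball (0::complex) a) = emeasure lborel (ball (0::complex) b) - emeasure lborel (cball (0::complex) a)"
    using assms by (intro emeasure_Diff) (auto simp: emeasure_cball)
  also have "\<dots> = ennreal (pi * b\<^sup>2) - ennreal (pi * a\<^sup>2)"
    using assms by (simp add: emeasure_ball emeasure_cball unit_ball_vol_2)
  finally show ?thesis
    by (simp add: ennreal_minus right_diff_distrib)
qed

text \<open>The kernel representation holds on every circle; averaging it over an annulus that avoids \<open>z\<close>
  removes the singularity of the kernel.\<close>

lemma smooth_taylor_error_le:
  assumes f: "f holomorphic_on UNIV" and K: "0 < K" and R: "0 < R" and ab: "0 \<le> a" "a < b" "b \<le> R"
    and area: "\<delta> * R \<le> b\<^sup>2 - a\<^sup>2" and \<delta>: "0 < \<delta>"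
    and c: "\<And>u. a < cmod u \<Longrightarrow> cmod u < b \<Longrightarrow> cmod z \<noteq> cmod u \<and> (if cmod z < cmod u then f z else 0) = c"
    and ker: "\<And>u. a < cmod u \<Longrightarrow> cmod u < b \<Longrightarrow>
      cmod (smooth_kernel m K (z / u)) * exp (- (\<alpha> * (cmod z)\<^sup>2 / 2)) \<le> B * R * decay (z - u) * exp (- (\<alpha> * (cmod u)\<^sup>2 / 2))"
    and B: "0 < B" and p: "1 \<le> p"
  shows "ennreal ((cmod (c - smooth_taylor f m K z) * exp (- (\<alpha> * (cmod z)\<^sup>2 / 2))) powr p)
     \<le> ennreal ((pi * B / \<delta>) powr p) * (\<integral>\<^sup>+u. ennreal (decay (z - u) / pi\<^sup>2) *
         (ennreal (fock_integrand p \<alpha> f u) * indicator (ball 0 R) u) \<partial>lborel)"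
proof -
  define A where "A = ball 0 b - cball (0::complex) a"
  have [measurable]: "A \<in> sets borel" by (simp add: A_def)
  have inA: "u \<in> A \<longleftrightarrow> a < cmod u \<and> cmod u < b" for u by (auto simp: A_def)
  have [measurable]: "f \<in> borel_measurable borel" by (rule measurable_entire[OF f])
  have [measurable]: "smooth_kernel m K \<in> borel_measurable borel"
    unfolding smooth_kernel_def[abs_def] by measurable
  have [measurable]: "cis \<in> borel_measurable borel"
    unfolding cis_conv_exp by measurable
  define w where "w u = exp (- (\<alpha> * (cmod u)\<^sup>2 / 2))" for u :: complex
  have [measurable]: "w \<in> borel_measurable borel" unfolding w_def[abs_def] by measurable
  have w0: "0 < w u" for u by (simp add: w_def)
  define E where "E = cmod (c - smooth_taylor f m K z) * w z"
  have E0: "0 \<le> E" using w0[of z] by (simp add: E_def)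
  define G where "G u = ennreal (cmod (f u) * cmod (smooth_kernel m K (z / u)) * w z) * indicator A u" for u
  have [measurable]: "G \<in> borel_measurable borel" unfolding G_def[abs_def] by measurable
  define g where "g u = cmod (f u) * w u * indicator (ball 0 R) u" for u
  have [measurable]: "g \<in> borel_measurable borel" unfolding g_def[abs_def]
    by (intro borel_measurable_times borel_measurable_indicator sets_ball_complex) measurable
  have g0: "0 \<le> g u" for u using w0[of u] by (simp add: g_def)
  \<comment> \<open>For fixed \<open>u\<close> the representation is used on the circle through
    \<open>u\<close>, which stays in \<open>A\<close>; there the kernel has no pole because
    \<open>cmod z\<close> differs from \<open>cmod u\<close>.\<close>
  have circle: "ennreal E * indicator A u \<le> (\<integral>\<^sup>+x. indicator {0..1} x * G (u * cis (2 * pi * x)) \<partial>lborel)" for u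
  proof (cases "u \<in> A")
    case True
    have u: "u \<noteq> 0" "cmod z \<noteq> cmod u" and cu: "(if cmod z < cmod u then f z else 0) = c"
      using True c[of u] ab by (auto simp: inA)
    have rot: "u * cis t \<in> A" for t using True by (simp add: inA norm_mult)
    have int: "((\<lambda>x. f (u * cis (2 * pi * x)) * smooth_kernel m K (z / (u * cis (2 * pi * x))))
      has_integral c - smooth_taylor f m K z) {0..1}"
      using circle_mean_smooth_taylor[OF f u K, of m] by (simp only: cu)
    have ne: "z / (u * cis t) \<noteq> 1" for t
    proof
      assume "z / (u * cis t) = 1"
      then have "z = u * cis t" using u by (simp add: field_simps)
      then show False using u by (simp add: norm_mult)
    qed
    have "continuous_on {0..1} (\<lambda>x. f (u * cis (2 * pi * x)) * smooth_kernel m K (z / (u * cis (2 * pi * x))))"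
      unfolding smooth_kernel_def using ne u K
      by (intro continuous_intros continuous_on_compose2[OF holomorphic_on_imp_continuous_on[OF f]]) auto
    from norm_circle_mean_le[OF int this]
    have "ennreal (cmod (c - smooth_taylor f m K z)) * ennreal (w z) \<le> (\<integral>\<^sup>+x. ennreal (cmod (f (u * cis (2 * pi * x)) * smooth_kernel m K (z / (u * cis (2 * pi * x))))) *
                   indicator {0..1} x \<partial>lborel) * ennreal (w z)"
      by (rule mult_right_mono) simp
    also have "\<dots> = (\<integral>\<^sup>+x. ennreal (cmod (f (u * cis (2 * pi * x)) * smooth_kernel m K (z / (u * cis (2 * pi * x))))) *
                   indicator {0..1} x * ennreal (w z) \<partial>lborel)"
      by (rule nn_integral_multc[symmetric]) measurable
    also have "\<dots> = (\<integral>\<^sup>+x. indicator {0..1} x * G (u * cis (2 * pi * x)) \<partial>lborel)"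
      using w0[of z] rot by (intro nn_integral_cong) (simp add: G_def norm_mult ennreal_mult mult_ac)
    finally show ?thesis
      using True w0[of z] by (simp add: E_def ennreal_mult)
  qed simp
  \<comment> \<open>The annulus has area at least \<open>pi * \<delta> * R\<close>; this
    \<open>R\<close> cancels the factor \<open>R\<close> in the kernel bound
    \<open>ker\<close>.\<close>
  have "ennreal E * ennreal (pi * (\<delta> * R)) \<le> ennreal E * emeasure lborel A"
    unfolding A_def using ab area by (subst emeasure_annulus) (auto intro!: mult_left_mono ennreal_leI)
  also have "\<dots> = (\<integral>\<^sup>+u. ennreal E * indicator A u \<partial>lborel)"
    by (simp add: nn_integral_cmult)
  also have "\<dots> \<le> (\<integral>\<^sup>+u. \<integral>\<^sup>+x. indicator {0..1} x * G (u * cis (2 * pi * x)) \<partial>lborel \<partial>lborel)"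
    by (intro nn_integral_mono circle)
  also have "\<dots> = (\<integral>\<^sup>+x. indicator {0..1::real} x \<partial>lborel) * (\<integral>\<^sup>+u. G u \<partial>lborel)"
    by (rule nn_integral_rotation_average) measurable
  also have "\<dots> = (\<integral>\<^sup>+u. G u \<partial>lborel)"
    by simp
  also have "\<dots> \<le> (\<integral>\<^sup>+u. ennreal (B * R * pi\<^sup>2) * (ennreal (decay (z - u) / pi\<^sup>2) * ennreal (g u)) \<partial>lborel)"
  proof (rule nn_integral_mono)
    fix u
    show "G u \<le> ennreal (B * R * pi\<^sup>2) * (ennreal (decay (z - u) / pi\<^sup>2) * ennreal (g u))"
    proof (cases "u \<in> A")
      case True
      then have uR: "u \<in> ball 0 R" using ab by (simp add: inA)
      have "cmod (f u) * (cmod (smooth_kernel m K (z / u)) * w z) \<le> cmod (f u) * (B * R * decay (z - u) * w u)"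
        using ker[of u] True unfolding w_def inA by (intro mult_left_mono) auto
      also have "\<dots> = (B * R * pi\<^sup>2) * ((decay (z - u) / pi\<^sup>2) * g u)"
        using uR by (simp add: g_def)
      finally have "ennreal (cmod (f u) * cmod (smooth_kernel m K (z / u)) * w z) \<le> ennreal ((B * R * pi\<^sup>2) * ((decay (z - u) / pi\<^sup>2) * g u))"
        by (intro ennreal_leI) (simp add: mult.assoc)
      also have "\<dots> = ennreal (B * R * pi\<^sup>2) * (ennreal (decay (z - u) / pi\<^sup>2) * ennreal (g u))"
      proof -
        have split: "ennreal (x * (y * t)) = ennreal x * (ennreal y * ennreal t)" if "0 \<le> x" "0 \<le> y" "0 \<le> t" for x y t
          using that by (simp add: ennreal_mult)
        show ?thesis
          by (rule split) (use g0[of u] B R in auto)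
      qed
      finally show ?thesis using True by (simp add: G_def)
    qed (simp add: G_def)
  qed
  also have "\<dots> = ennreal (B * R * pi\<^sup>2) * (\<integral>\<^sup>+u. ennreal (decay (z - u) / pi\<^sup>2) * ennreal (g u) \<partial>lborel)"
    by (rule nn_integral_cmult) measurable
  finally have main: "ennreal E * ennreal (pi * (\<delta> * R)) \<le> \<dots>" .
  \<comment> \<open>Normalized so that \<open>main\<close> bounds \<open>b'\<close> by a mean of
    \<open>g\<close> against \<open>decay / pi\<^sup>2\<close>, whose mass is at most 1; then
    Jensen's inequality applies.\<close>
  define b' where "b' = E * \<delta> / (pi * B)"
  have b'0: "0 \<le> b'" using E0 B \<delta> by (simp add: b'_def)
  have "E * (pi * (\<delta> * R)) = (B * R * pi\<^sup>2) * b'"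
    using B by (simp add: b'_def power2_eq_square)
  then have "ennreal E * ennreal (pi * (\<delta> * R)) = ennreal (B * R * pi\<^sup>2) * ennreal b'"
    using E0 b'0 B R \<delta> by (simp flip: ennreal_mult)
  with main have "ennreal (B * R * pi\<^sup>2) * ennreal b' \<le> ennreal (B * R * pi\<^sup>2) * (\<integral>\<^sup>+u. ennreal (decay (z - u) / pi\<^sup>2) * ennreal (g u) \<partial>lborel)"
    by (simp only:)
  then have bI: "ennreal b' \<le> (\<integral>\<^sup>+u. ennreal (decay (z - u) / pi\<^sup>2) * ennreal (g u) \<partial>lborel)"
    using B R by (subst (asm) ennreal_mult_le_mult_iff) auto
  have W: "(\<integral>\<^sup>+u. ennreal (decay (z - u) / pi\<^sup>2) \<partial>lborel) \<le> 1"
  proof -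
    have "(\<integral>\<^sup>+u. ennreal (decay (z - u) / pi\<^sup>2) \<partial>lborel) = (\<integral>\<^sup>+u. ennreal (1 / pi\<^sup>2) * ennreal (decay (z - u)) \<partial>lborel)"
      by (intro nn_integral_cong) (simp flip: ennreal_mult)
    also have "\<dots> = ennreal (1 / pi\<^sup>2) * (\<integral>\<^sup>+u. ennreal (decay (z - u)) \<partial>lborel)"
      by (rule nn_integral_cmult) measurable
    also have "\<dots> \<le> ennreal (1 / pi\<^sup>2) * ennreal (pi\<^sup>2)"
      by (intro mult_left_mono nn_integral_decay) auto
    also have "\<dots> = 1"
      by (simp flip: ennreal_mult)
    finally show ?thesis .
  qed
  have "ennreal (b' powr p) \<le> (\<integral>\<^sup>+u. ennreal (decay (z - u) / pi\<^sup>2) * ennreal (g u powr p) \<partial>lborel)"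
    by (rule Jensen_powr_nn_integral[OF _ _ W g0 p b'0 bI]) measurable
  also have "\<dots> = (\<integral>\<^sup>+u. ennreal (decay (z - u) / pi\<^sup>2) *
         (ennreal (fock_integrand p \<alpha> f u) * indicator (ball 0 R) u) \<partial>lborel)"
  proof (rule nn_integral_cong)
    fix u
    have "ennreal (g u powr p) = ennreal (fock_integrand p \<alpha> f u) * indicator (ball 0 R) u"
      using p by (auto simp: g_def w_def fock_integrand_def powr_mult powr_def[of "exp _"] mult_ac split: split_indicator)
    then show "ennreal (decay (z - u) / pi\<^sup>2) * ennreal (g u powr p) = ennreal (decay (z - u) / pi\<^sup>2) *
         (ennreal (fock_integrand p \<alpha> f u) * indicator (ball 0 R) u)"
      by simp
  qed
  finally have "ennreal ((pi * B / \<delta>) powr p) * ennreal (b' powr p) \<le> ennreal ((pi * B / \<delta>) powr p) * \<dots>"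
    by (rule mult_left_mono) simp
  moreover have E_eq: "E = (pi * B / \<delta>) * b'"
    using B \<delta> by (simp add: b'_def)
  have "ennreal (E powr p) = ennreal ((pi * B / \<delta>) powr p) * ennreal (b' powr p)"
    unfolding E_eq powr_mult[of "pi * B / \<delta>"] by (simp only: ennreal_mult powr_ge_zero)
  ultimately show ?thesis
    by (simp add: E_def w_def)
qed

text \<open>The polynomial is compared with \<open>c\<close>, which is \<open>f\<close> cut off at
  the radius \<open>R - 2 * \<delta>\<close>. The difference is bounded pointwise by a convolution
  with \<open>decay\<close>, which does not increase the total mass beyond a constant
  factor.\<close>

lemma smooth_taylor_mass_le:
  fixes f :: "complex \<Rightarrow> complex" and p \<alpha> :: real and m :: nat
  defines "\<delta> \<equiv> 1 / (8 * sqrt \<alpha>)" and "R \<equiv> sqrt (real m / \<alpha>)"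
  defines "B \<equiv> 8 * exp 92 / sqrt \<alpha> ^ 3 * (1 + 1 / \<delta>\<^sup>2)\<^sup>2"
  defines "D \<equiv> (pi * B / \<delta>) powr p"
  assumes f: "f holomorphic_on UNIV" and \<alpha>: "0 < \<alpha>" and m: "1 \<le> m" and p: "1 \<le> p"
  shows "fock_mass p \<alpha> (smooth_taylor f m (nat \<lceil>sqrt \<alpha> * R\<rceil>)) UNIV
      \<le> ennreal (2 powr p * (1 + D)) * fock_mass p \<alpha> f (ball 0 R)"
proof -
  define K where "K = nat \<lceil>sqrt \<alpha> * R\<rceil>"
  define g where "g = smooth_taylor f m K"
  define \<Phi> where "\<Phi> u = ennreal (fock_integrand p \<alpha> f u) * indicator (ball 0 R) u" for u
  have \<delta>: "0 < \<delta>" using \<alpha> by (simp add: \<delta>_def)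
  have "0 < 1 + 1 / \<delta>\<^sup>2" by (intro add_pos_nonneg) auto
  then have B: "0 < B" using \<alpha> by (simp add: B_def)
  have D: "0 \<le> D" by (simp add: D_def)
  have "sqrt \<alpha> * R = sqrt (real m)"
    using \<alpha> by (simp add: R_def real_sqrt_mult[symmetric])
  moreover have "1 \<le> sqrt (real m)" using m by simp
  ultimately have sR: "1 \<le> sqrt \<alpha> * R" by simp
  \<comment> \<open>Consequently all annuli below, which start at \<open>R - 4 * \<delta>\<close> or
    later, lie outside radius \<open>R / 2\<close>.\<close>
  have R8: "8 * \<delta> \<le> R"
    using sR \<alpha> by (simp add: \<delta>_def field_simps)
  have R0: "0 < R" using R8 \<delta> by linarith
  have mR: "real m = \<alpha> * R\<^sup>2"
    using \<alpha> by (simp add: R_def)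
  have K0: "0 < K"
    using sR by (simp add: K_def)
  have [measurable]: "f \<in> borel_measurable borel" "g \<in> borel_measurable borel"
    by (auto intro!: measurable_entire f simp: g_def holomorphic_smooth_taylor)
  have [measurable]: "\<Phi> \<in> borel_measurable borel"
    unfolding \<Phi>_def[abs_def] by (intro borel_measurable_times_ennreal borel_measurable_indicator sets_ball_complex) auto
  define c where "c z = (if cmod z < R - 2 * \<delta> then f z else 0)" for z
  define J where "J z = (\<integral>\<^sup>+u. ennreal (decay (z - u) / pi\<^sup>2) * \<Phi> u \<partial>lborel)" for z
  have J_measurable [measurable]: "J \<in> borel_measurable borel"
    unfolding J_def[abs_def] by measurable
  have err: "ennreal ((cmod (c z - g z) * exp (- (\<alpha> * (cmod z)\<^sup>2 / 2))) powr p)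
     \<le> ennreal D * J z" for z
  proof -
    \<comment> \<open>The annulus of integration is placed on the other side of the cut: outside
      \<open>z\<close> if \<open>z\<close> is in the inner disc, inside \<open>z\<close> otherwise.
      The radial distance to \<open>z\<close> is then at least \<open>\<delta>\<close>, and Cauchy's
      formula returns \<open>f z\<close> or 0 accordingly.\<close>
    define a b where "a = (if cmod z < R - 2 * \<delta> then R - \<delta> else R - 4 * \<delta>)"
      and "b = (if cmod z < R - 2 * \<delta> then R else R - 3 * \<delta>)"
    have ab: "0 \<le> a" "a < b" "b \<le> R" "R / 2 \<le> a" "R - 4 * \<delta> \<le> a"
      using R8 \<delta> by (auto simp: a_def b_def)
    have "(b - a) * R \<le> (b - a) * (b + a)"
      using ab R8 \<delta> by (intro mult_left_mono) (auto simp: a_def b_def)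
    moreover have "b - a = \<delta>" by (simp add: a_def b_def)
    ultimately have area: "\<delta> * R \<le> b\<^sup>2 - a\<^sup>2"
      by (simp add: power2_eq_square algebra_simps)
    have sep: "\<delta> \<le> \<bar>cmod z - cmod u\<bar>" if "a < cmod u" "cmod u < b" for u
      using that \<delta> by (auto simp: a_def b_def split: if_splits)
    have "(if cmod z < cmod u then f z else 0) = c z" if "a < cmod u" "cmod u < b" for u
      using that \<delta> by (auto simp: a_def b_def c_def split: if_splits)
    moreover have "cmod z \<noteq> cmod u" if "a < cmod u" "cmod u < b" for u
      using sep[OF that] \<delta> by auto
    moreover have "cmod (smooth_kernel m K (z / u)) * exp (- (\<alpha> * (cmod z)\<^sup>2 / 2))
        \<le> B * R * decay (z - u) * exp (- (\<alpha> * (cmod u)\<^sup>2 / 2))" if u: "a < cmod u" "cmod u < b" for u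
    proof -
      have "cmod (smooth_kernel m K (z / u)) * exp (- (\<alpha> * (cmod z)\<^sup>2 / 2))
        \<le> 8 * exp 92 / sqrt \<alpha> ^ 3 * R * (1 + 1 / \<delta>\<^sup>2)\<^sup>2 * decay (z - u) * exp (- (\<alpha> * (cmod u)\<^sup>2 / 2))"
        by (rule norm_smooth_kernel_le) (use \<alpha> mR R0 sR ab u sep in \<open>auto simp: K_def \<delta>_def\<close>)
      also have "\<dots> = B * R * decay (z - u) * exp (- (\<alpha> * (cmod u)\<^sup>2 / 2))"
        by (simp add: B_def)
      finally show ?thesis .
    qed
    ultimately show ?thesis
      unfolding D_def g_def J_def \<Phi>_def using ab(1-3) area \<delta> B R0
      by (intro smooth_taylor_error_le[OF f K0, of R a b \<delta>] p) auto
  qed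
  have pt: "ennreal (fock_integrand p \<alpha> g z) \<le> ennreal (2 powr p) * (\<Phi> z +
      ennreal D * J z)" for z
  proof -
    define w where "w = exp (- (\<alpha> * (cmod z)\<^sup>2 / 2))"
    have w: "0 < w" by (simp add: w_def)
    have wp: "exp (- (p * \<alpha> * (cmod z)\<^sup>2 / 2)) = w powr p"
      by (simp add: w_def powr_def mult_ac)
    have "cmod (g z) * w \<le> cmod (c z) * w + cmod (c z - g z) * w"
      using norm_triangle_ineq4[of "c z" "c z - g z"] w by (simp flip: distrib_right)
    then have "(cmod (g z) * w) powr p \<le> (cmod (c z) * w + cmod (c z - g z) * w) powr p"
      using p w by (intro powr_mono2) auto
    also have "\<dots> \<le> 2 powr p * ((cmod (c z) * w) powr p + (cmod (c z - g z) * w) powr p)"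
      using p w by (intro powr_add_le) auto
    finally have "ennreal (fock_integrand p \<alpha> g z) \<le> ennreal (2 powr p * ((cmod (c z) * w) powr p + (cmod (c z - g z) * w) powr p))"
      by (intro ennreal_leI) (simp add: fock_integrand_def wp powr_mult)
    also have "\<dots> = ennreal (2 powr p) * (ennreal ((cmod (c z) * w) powr p) + ennreal ((cmod (c z - g z) * w) powr p))"
      by (simp add: ennreal_mult)
    also have "\<dots> \<le> ennreal (2 powr p) * (\<Phi> z + ennreal D * J z)"
    proof (intro mult_left_mono add_mono)
      show "ennreal ((cmod (c z) * w) powr p) \<le> \<Phi> z"
        using \<delta> by (auto simp: c_def \<Phi>_def fock_integrand_def wp powr_mult split: split_indicator)
      show "ennreal ((cmod (c z - g z) * w) powr p) \<le> ennreal D * J z"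
        using err[of z] by (simp add: w_def)
    qed auto
    finally show ?thesis .
  qed
  \<comment> \<open>After exchanging the integrals, the mass of the kernel is taken in the variable
    \<open>z\<close>, where it is again at most 1.\<close>
  have dbl: "(\<integral>\<^sup>+z. J z \<partial>lborel) \<le> (\<integral>\<^sup>+u. \<Phi> u \<partial>lborel)"
  proof -
    have "(\<integral>\<^sup>+z. J z \<partial>lborel)
        = (\<integral>\<^sup>+u. \<integral>\<^sup>+z. ennreal (decay (z - u) / pi\<^sup>2) * \<Phi> u \<partial>lborel \<partial>lborel)"
      unfolding J_def by (rule lborel_pair.Fubini') measurable
    also have "\<dots> \<le> (\<integral>\<^sup>+u. \<Phi> u \<partial>lborel)"
    proof (rule nn_integral_mono)
      fix u
      have "(\<integral>\<^sup>+z. ennreal (decay (z - u) / pi\<^sup>2) * \<Phi> u \<partial>lborel)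
         = (\<integral>\<^sup>+z. ennreal (decay (u - z)) * (ennreal (1 / pi\<^sup>2) * \<Phi> u) \<partial>lborel)"
      proof (rule nn_integral_cong)
        fix z
        have "decay (z - u) = decay (u - z)"
          by (simp add: decay_def power2_commute)
        then show "ennreal (decay (z - u) / pi\<^sup>2) * \<Phi> u = ennreal (decay (u - z)) * (ennreal (1 / pi\<^sup>2) * \<Phi> u)"
          by (simp add: mult.assoc[symmetric] flip: ennreal_mult)
      qed
      also have "\<dots> = (\<integral>\<^sup>+z. ennreal (decay (u - z)) \<partial>lborel) * (ennreal (1 / pi\<^sup>2) * \<Phi> u)"
        by (rule nn_integral_multc) measurable
      also have "\<dots> \<le> ennreal (pi\<^sup>2) * (ennreal (1 / pi\<^sup>2) * \<Phi> u)"
        by (intro mult_right_mono nn_integral_decay) auto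
      also have "\<dots> = \<Phi> u"
        by (simp add: mult.assoc[symmetric] flip: ennreal_mult)
      finally show "(\<integral>\<^sup>+z. ennreal (decay (z - u) / pi\<^sup>2) * \<Phi> u \<partial>lborel) \<le> \<Phi> u" .
    qed
    finally show ?thesis .
  qed
  have "fock_mass p \<alpha> g UNIV \<le> (\<integral>\<^sup>+z. ennreal (2 powr p) * (\<Phi> z +
      ennreal D * J z) \<partial>lborel)"
    unfolding fock_mass_def using pt by (intro nn_integral_mono) simp
  also have "\<dots> = ennreal (2 powr p) * ((\<integral>\<^sup>+z. \<Phi> z \<partial>lborel) + ennreal D *
      (\<integral>\<^sup>+z. J z \<partial>lborel))"
    by (simp add: nn_integral_cmult nn_integral_add)
  also have "\<dots> \<le> ennreal (2 powr p) * ((\<integral>\<^sup>+z. \<Phi> z \<partial>lborel) + ennreal D * (\<integral>\<^sup>+z. \<Phi> z \<partial>lborel))"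
    by (intro mult_left_mono add_left_mono dbl) auto
  also have "\<dots> = ennreal (2 powr p * (1 + D)) * (\<integral>\<^sup>+z. \<Phi> z \<partial>lborel)"
    using D by (simp add: ennreal_mult ennreal_plus distrib_left distrib_right mult_ac)
  also have "(\<integral>\<^sup>+z. \<Phi> z \<partial>lborel) = fock_mass p \<alpha> f (ball 0 R)"
    by (simp add: fock_mass_def \<Phi>_def)
  finally show ?thesis by (simp add: g_def K_def)
qed

text \<open>With \<open>h\<close> the smoothed Taylor polynomial translated to \<open>l\<close>, the
  competitor \<open>f - h\<close> leaves exactly \<open>h\<close> as remainder, and the norm of
  \<open>h\<close> only involves \<open>f\<close> on the disc. \<open>A\<close> is obtained before
  \<open>f\<close>, \<open>l\<close> and \<open>m\<close>.\<close>

lemma quotient_norm_le_local_mass: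
  fixes p \<alpha> :: real
  assumes \<alpha>: "0 < \<alpha>" and p: "1 \<le> p"
  obtains A where "0 < A"
    "\<And>f l m. f \<in> fock_space p \<alpha> \<Longrightarrow> 1 \<le> m \<Longrightarrow>
       ennreal (quotient_norm p \<alpha> l m f powr p) \<le> ennreal A * fock_mass p \<alpha> f (ball l (sqrt (real m / \<alpha>)))"
proof -
  define \<delta> where "\<delta> = 1 / (8 * sqrt \<alpha>)"
  define B where "B = 8 * exp 92 / sqrt \<alpha> ^ 3 * (1 + 1 / \<delta>\<^sup>2)\<^sup>2"
  define A where "A = 2 powr p * (1 + (pi * B / \<delta>) powr p)"
  have "0 < A" by (simp add: A_def add_pos_nonneg)
  moreover have "ennreal (quotient_norm p \<alpha> l m f powr p) \<le> ennreal A * fock_mass p \<alpha> f (ball l (sqrt (real m / \<alpha>)))"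
    if f: "f \<in> fock_space p \<alpha>" and m: "1 \<le> m" for f l m
  proof -
    define f0 where "f0 = fock_translate \<alpha> (- l) f"
    define K where "K = nat \<lceil>sqrt \<alpha> * sqrt (real m / \<alpha>)\<rceil>"
    define g0 where "g0 = smooth_taylor f0 m K"
    define h where "h = fock_translate \<alpha> l g0"
    have f0: "f0 \<in> fock_space p \<alpha>" unfolding f0_def by (rule fock_space_translate[OF f])
    note f0h = fock_space_holomorphic[OF f0]
    have le: "fock_mass p \<alpha> g0 UNIV \<le> ennreal A * fock_mass p \<alpha> f0 (ball 0 (sqrt (real m / \<alpha>)))"
      unfolding g0_def K_def A_def B_def \<delta>_def by (rule smooth_taylor_mass_le[OF f0h \<alpha> m p])
    also have "\<dots> < \<infinity>"
      using fock_mass_finite[OF f0] by (simp add: ennreal_mult_less_top)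
    finally have g0: "g0 \<in> fock_space p \<alpha>"
      by (simp add: fock_space_iff g0_def holomorphic_smooth_taylor)
    have K: "0 < K"
      using \<alpha> m by (simp add: K_def)
    obtain e where e: "e holomorphic_on UNIV" "\<forall>z. f0 z - g0 z = z ^ m * e z"
      using smooth_taylor_remainder[OF f0h K] unfolding g0_def by blast
    have "(\<lambda>z. f0 z - g0 z) \<in> fock_space p \<alpha>"
      using f0 g0 p by (intro fock_space_diff) auto
    then have "(\<lambda>z. f0 z - g0 z) \<in> vanishing_space p \<alpha> 0 m"
      by (rule vanishing_spaceI[OF _ e(1)]) (use e(2) in simp)
    then have "fock_translate \<alpha> l (\<lambda>z. f0 z - g0 z) \<in> vanishing_space p \<alpha> (0 + l) m"
      by (rule vanishing_space_translate)
    moreover have "fock_translate \<alpha> l (\<lambda>z. f0 z - g0 z) = (\<lambda>z. f z - h z)"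
      using fock_translate_inverse[of \<alpha> "- l" f]
      by (auto simp: h_def f0_def fock_translate_def right_diff_distrib fun_eq_iff)
    ultimately have "(\<lambda>z. f z - h z) \<in> vanishing_space p \<alpha> l m" by simp
    from quotient_norm_powr_le[OF this f] p
    have "ennreal (quotient_norm p \<alpha> l m f powr p) \<le> fock_mass p \<alpha> h UNIV" by simp
    also have "\<dots> = fock_mass p \<alpha> g0 UNIV"
      unfolding h_def by (rule fock_mass_translate_UNIV[OF fock_space_holomorphic[OF g0]])
    also note le
    also have "fock_mass p \<alpha> f0 (ball 0 (sqrt (real m / \<alpha>))) = fock_mass p \<alpha> f (ball l (sqrt (real m / \<alpha>)))"
      unfolding f0_def by (simp add: fock_mass_translate_ball fock_space_holomorphic[OF f])
    finally show ?thesis .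
  qed
  ultimately show ?thesis using that by blast
qed

subsection \<open>Sums over a divisor\<close>

abbreviation quotient_sum :: "real \<Rightarrow> real \<Rightarrow> complex set \<Rightarrow> (complex \<Rightarrow> nat) \<Rightarrow> (complex \<Rightarrow> complex) \<Rightarrow> ennreal" where
  "quotient_sum p \<alpha> \<Lambda> m f \<equiv> (\<Sum>\<^sub>\<infinity>l\<in>\<Lambda>. ennreal (quotient_norm p \<alpha> l (m l) f powr p))"

lemma infsum_ennreal_leI:
  fixes f :: "'a \<Rightarrow> ennreal"
  assumes "\<And>F. finite F \<Longrightarrow> F \<subseteq> A \<Longrightarrow> sum f F \<le> c"
  shows "infsum f A \<le> c"
  unfolding nonneg_infsum_complete[of A f, simplified] using assms by (intro SUP_least) auto

lemma sum_le_infsum_ennreal: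
  fixes f :: "'a \<Rightarrow> ennreal"
  assumes "finite F" "F \<subseteq> A"
  shows "sum f F \<le> infsum f A"
  unfolding nonneg_infsum_complete[of A f, simplified] using assms by (intro SUP_upper) auto

lemma fock_mass_eq_emeasure:
  assumes f: "f holomorphic_on UNIV" and S: "S \<in> sets borel"
  shows "fock_mass p \<alpha> f S = emeasure (density lborel (\<lambda>z. ennreal (fock_integrand p \<alpha> f z))) S"
proof -
  have [measurable]: "f \<in> borel_measurable borel" by (rule measurable_entire[OF f])
  show ?thesis
    using S by (subst emeasure_density) (auto simp: fock_mass_def)
qed

lemma fock_mass_tail:
  assumes f: "f \<in> fock_space p \<alpha>" and e: "0 < e"
  obtains r where "0 < r" "fock_mass p \<alpha> f (- ball 0 r) < e"
proof -
  define M where "M = density lborel (\<lambda>z. ennreal (fock_integrand p \<alpha> f z))"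
  note fh = fock_space_holomorphic[OF f]
  have sets: "- ball 0 (real n) \<in> sets borel" for n :: nat
    by (intro borel_closed closed_Compl open_ball)
  have eq: "fock_mass p \<alpha> f (- ball 0 (real n)) = emeasure M (- ball 0 (real n))" for n
    unfolding M_def by (rule fock_mass_eq_emeasure[OF fh sets])
  have "(\<lambda>n. emeasure M (- ball 0 (real n))) \<longlonglongrightarrow> emeasure M (\<Inter>n. - ball 0 (real n))"
  proof (rule Lim_emeasure_decseq)
    show "range (\<lambda>n. - ball (0::complex) (real n)) \<subseteq> sets M"
      using sets by (auto simp: M_def)
    show "decseq (\<lambda>n. - ball (0::complex) (real n))"
      by (auto simp: decseq_def)
    show "emeasure M (- ball 0 (real n)) \<noteq> \<infinity>" for n
      using fock_mass_finite[OF f, of "- ball 0 (real n)"] by (simp add: eq)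
  qed
  moreover have "(\<Inter>n. - ball (0::complex) (real n)) = {}"
  proof (rule equals0I)
    fix z :: complex
    assume z: "z \<in> (\<Inter>n. - ball 0 (real n))"
    obtain n where "cmod z < real n"
      using reals_Archimedean2 by blast
    then have "z \<in> ball 0 (real n)" by simp
    moreover have "z \<notin> ball 0 (real n)"
      using INT_D[OF z, of n] by simp
    ultimately show False by contradiction
  qed
  ultimately have "(\<lambda>n. fock_mass p \<alpha> f (- ball 0 (real n))) \<longlonglongrightarrow> 0"
    by (simp add: eq)
  then have "\<forall>\<^sub>F n in sequentially. fock_mass p \<alpha> f (- ball 0 (real n)) < e"
    using e by (simp add: order_tendstoD(2))
  then have "\<forall>\<^sub>F n in sequentially. fock_mass p \<alpha> f (- ball 0 (real n)) < e \<and> 0 < n"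
    using eventually_gt_at_top by (rule eventually_conj)
  then obtain n where "fock_mass p \<alpha> f (- ball 0 (real n)) < e" "0 < n"
    using eventually_happens'[OF sequentially_bot] by blast
  then show ?thesis using that[of "real n"] by simp
qed

text \<open>Subadditivity along a finite exhaustion of \<open>I\<close>. The bound is asked for
  finite sums because the estimates to be summed are available over finite parts of the
  divisor.\<close>

lemma fock_mass_UN_leI:
  assumes f: "f holomorphic_on UNIV" and "countable I" and D: "\<And>i. i \<in> I \<Longrightarrow> D i \<in> sets borel"
    and le: "\<And>F. finite F \<Longrightarrow> F \<subseteq> I \<Longrightarrow> (\<Sum>i\<in>F. fock_mass p \<alpha> f (D i)) \<le> c"
  shows "fock_mass p \<alpha> f (\<Union>i\<in>I. D i) \<le> c"
proof (cases "I = {}")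
  case True
  then show ?thesis by (simp add: fock_mass_def)
next
  case False
  define M where "M = density lborel (\<lambda>z. ennreal (fock_integrand p \<alpha> f z))"
  have sM: "sets M = sets borel" by (simp add: M_def)
  define F where "F n = from_nat_into I ` {..n}" for n :: nat
  have F: "finite (F n)" "F n \<subseteq> I" for n
    using from_nat_into[OF False] by (auto simp: F_def)
  have D': "D i \<in> sets M" if "i \<in> I" for i using D[OF that] sM by simp
  have UF: "(\<Union>n. F n) = I"
  proof -
    have "(\<Union>n. {..n::nat}) = UNIV" by auto
    then show ?thesis
      using range_from_nat_into[OF False \<open>countable I\<close>] unfolding F_def by (simp only: image_UN[symmetric])
  qed
  have "(\<Union>i\<in>I. D i) = (\<Union>n. \<Union>i\<in>F n. D i)"
    unfolding UF[symmetric] by auto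
  moreover have "(\<Union>i\<in>I. D i) \<in> sets borel"
    using \<open>countable I\<close> D by (intro sets.countable_UN') auto
  ultimately have "fock_mass p \<alpha> f (\<Union>i\<in>I. D i) = emeasure M (\<Union>n. \<Union>i\<in>F n. D i)"
    by (simp add: fock_mass_eq_emeasure[OF f] M_def)
  also have "\<dots> = (SUP n. emeasure M (\<Union>i\<in>F n. D i))"
  proof (rule SUP_emeasure_incseq[symmetric])
    show "range (\<lambda>n. \<Union>i\<in>F n. D i) \<subseteq> sets M"
      using F D' by (auto intro!: sets.finite_UN)
    show "incseq (\<lambda>n. \<Union>i\<in>F n. D i)"
      by (fastforce simp: incseq_def F_def)
  qed
  also have "\<dots> \<le> c"
  proof (rule SUP_least)
    fix n
    have "emeasure M (\<Union>i\<in>F n. D i) \<le> (\<Sum>i\<in>F n. emeasure M (D i))"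
      using F D' by (intro emeasure_subadditive_finite) auto
    also have "\<dots> = (\<Sum>i\<in>F n. fock_mass p \<alpha> f (D i))"
    proof (rule sum.cong)
      fix i assume "i \<in> F n"
      then have "D i \<in> sets borel" using F(2)[of n] D by blast
      then show "emeasure M (D i) = fock_mass p \<alpha> f (D i)"
        by (simp add: fock_mass_eq_emeasure[OF f] M_def)
    qed simp
    also have "\<dots> \<le> c"
      by (intro le F)
    finally show "emeasure M (\<Union>i\<in>F n. D i) \<le> c" .
  qed
  finally show ?thesis .
qed

text \<open>Sum and integral are exchanged; at a point of \<open>T\<close> the discs are counted by
  the overlap constant. \<open>T\<close> is the plane for the sampling bounds, and the complement of
  a disc in the proof of the covering property.\<close>

lemma sum_fock_mass_le_overlap:
  assumes f: "f holomorphic_on UNIV" and F: "finite F" "F \<subseteq> \<Lambda>"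
    and T: "\<And>l. l \<in> F \<Longrightarrow> ball l (sqrt (real (m l) / \<alpha>)) \<subseteq> T" and [measurable]: "T \<in> sets borel"
  shows "(\<Sum>l\<in>F. fock_mass p \<alpha> f (ball l (sqrt (real (m l) / \<alpha>)))) \<le> overlap_const \<alpha> \<Lambda> m * fock_mass p \<alpha> f T"
proof -
  have [measurable]: "f \<in> borel_measurable borel" by (rule measurable_entire[OF f])
  have "(\<Sum>l\<in>F. fock_mass p \<alpha> f (ball l (sqrt (real (m l) / \<alpha>))))
      = (\<integral>\<^sup>+z. (\<Sum>l\<in>F. ennreal (fock_integrand p \<alpha> f z) * indicator (ball l (sqrt (real (m l) / \<alpha>))) z) \<partial>lborel)"
    unfolding fock_mass_def
    by (rule nn_integral_sum[symmetric]) (intro borel_measurable_times_ennreal borel_measurable_indicator, auto)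
  also have "\<dots> \<le> (\<integral>\<^sup>+z. overlap_const \<alpha> \<Lambda> m * (ennreal (fock_integrand p \<alpha> f z) * indicator T z) \<partial>lborel)"
  proof (rule nn_integral_mono)
    fix z
    show "(\<Sum>l\<in>F. ennreal (fock_integrand p \<alpha> f z) * indicator (ball l (sqrt (real (m l) / \<alpha>))) z)
      \<le> overlap_const \<alpha> \<Lambda> m * (ennreal (fock_integrand p \<alpha> f z) * indicator T z)"
    proof (cases "z \<in> T")
      case True
      have "(\<Sum>l\<in>F. indicator (ball l (sqrt (real (m l) / \<alpha>))) z) \<le> (\<Sum>\<^sub>\<infinity>l\<in>\<Lambda>. indicator (ball l (sqrt (real (m l) / \<alpha>))) z :: ennreal)"
        by (rule sum_le_infsum_ennreal[OF F])
      also have "\<dots> \<le> overlap_const \<alpha> \<Lambda> m"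
        unfolding overlap_const_def by (rule SUP_upper) auto
      finally have "ennreal (fock_integrand p \<alpha> f z) * (\<Sum>l\<in>F. indicator (ball l (sqrt (real (m l) / \<alpha>))) z)
          \<le> ennreal (fock_integrand p \<alpha> f z) * overlap_const \<alpha> \<Lambda> m"
        by (rule mult_left_mono) simp
      then show ?thesis
        using True by (simp add: sum_distrib_left mult.commute)
    next
      case False
      then have "(\<Sum>l\<in>F. ennreal (fock_integrand p \<alpha> f z) * indicator (ball l (sqrt (real (m l) / \<alpha>))) z) = 0"
        using T[THEN subsetD] by (intro sum.neutral) (auto simp: indicator_def)
      then show ?thesis by simp
    qed
  qed
  also have "\<dots> = overlap_const \<alpha> \<Lambda> m * fock_mass p \<alpha> f T"
    unfolding fock_mass_def by (rule nn_integral_cmult) measurable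
  finally show ?thesis .
qed

lemma infsum_quotient_norm_le:
  assumes f: "f \<in> fock_space p \<alpha>" and d: "divisor \<Lambda> m"
    and A: "\<And>l k. 1 \<le> k \<Longrightarrow> ennreal (quotient_norm p \<alpha> l k f powr p) \<le> ennreal A * fock_mass p \<alpha> f (ball l (sqrt (real k / \<alpha>)))"
    and T: "\<And>l. l \<in> \<Lambda> \<Longrightarrow> ball l (sqrt (real (m l) / \<alpha>)) \<subseteq> T" "T \<in> sets borel"
  shows "quotient_sum p \<alpha> \<Lambda> m f \<le> ennreal A * (overlap_const \<alpha> \<Lambda> m * fock_mass p \<alpha> f T)"
proof (rule infsum_ennreal_leI)
  fix F assume F: "finite F" "F \<subseteq> \<Lambda>"
  have "(\<Sum>l\<in>F. ennreal (quotient_norm p \<alpha> l (m l) f powr p))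
      \<le> (\<Sum>l\<in>F. ennreal A * fock_mass p \<alpha> f (ball l (sqrt (real (m l) / \<alpha>))))"
    using F d by (intro sum_mono A) (auto simp: divisor_def)
  also have "\<dots> \<le> ennreal A * (overlap_const \<alpha> \<Lambda> m * fock_mass p \<alpha> f T)"
    unfolding sum_distrib_left[symmetric] using F T
    by (intro mult_left_mono sum_fock_mass_le_overlap fock_space_holomorphic[OF f]) auto
  finally show "(\<Sum>l\<in>F. ennreal (quotient_norm p \<alpha> l (m l) f powr p)) \<le> \<dots>" .
qed

text \<open>After \<open>l\<close> is moved to the origin, this is the mean value inequality for
  \<open>cmod (g z) powr p\<close> (the Poisson bound with parameter 0), integrated over circles
  against the radial Gaussian.\<close>

lemma fock_integrand_le_local_mass:
  assumes f: "f holomorphic_on UNIV" and p: "1 \<le> p"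
  shows "ennreal (fock_integrand p \<alpha> f l) * fock_mass p \<alpha> (\<lambda>_. 1) (ball 0 r) \<le> fock_mass p \<alpha> f (ball l r)"
proof -
  define g where "g = fock_translate \<alpha> (- l) f"
  have g: "g holomorphic_on UNIV" unfolding g_def by (rule holomorphic_fock_translate[OF f])
  have [measurable]: "g \<in> borel_measurable borel" by (rule measurable_entire[OF g])
  define V :: "complex \<Rightarrow> ennreal" where "V z = ennreal (fock_integrand p \<alpha> (\<lambda>_. 1) z) * indicator (ball 0 r) z" for z
  have [measurable]: "V \<in> borel_measurable borel"
    unfolding V_def[abs_def] by (intro borel_measurable_times_ennreal borel_measurable_indicator sets_ball_complex) auto
  have g0: "fock_integrand p \<alpha> f l = cmod (g 0) powr p"
    using fock_integrand_translate[of p \<alpha> "- l" f 0] by (simp add: g_def[symmetric] fock_integrand_def)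
  have [measurable]: "cis \<in> borel_measurable borel"
    unfolding cis_conv_exp by measurable
  have "ennreal (fock_integrand p \<alpha> f l) * fock_mass p \<alpha> (\<lambda>_. 1) (ball 0 r)
      = (\<integral>\<^sup>+z. V z * ennreal (cmod (g (of_real 0 * z)) powr p) \<partial>lborel)"
    unfolding fock_mass_def V_def[symmetric] g0 by (simp add: nn_integral_multc mult.commute)
  also have "\<dots> \<le> (\<integral>\<^sup>+z. V z * (\<integral>\<^sup>+x. (ennreal (poisson 0 x) * indicator {0..1} x) *
           ennreal (cmod (g (z * cis (2 * pi * x))) powr p) \<partial>lborel) \<partial>lborel)"
    by (intro nn_integral_mono mult_left_mono poisson_powr_le g p) auto
  also have "\<dots> = (\<integral>\<^sup>+z. (\<integral>\<^sup>+x. (ennreal (poisson 0 x) * indicator {0..1} x) *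
           (V (z * cis (2 * pi * x)) * ennreal (cmod (g (z * cis (2 * pi * x))) powr p)) \<partial>lborel) \<partial>lborel)"
  proof (rule nn_integral_cong)
    fix z
    have "V (z * cis t) = V z" for t
      by (simp add: V_def norm_mult indicator_def fock_integrand_def)
    then show "V z * (\<integral>\<^sup>+x. (ennreal (poisson 0 x) * indicator {0..1} x) *
           ennreal (cmod (g (z * cis (2 * pi * x))) powr p) \<partial>lborel) =
        (\<integral>\<^sup>+x. (ennreal (poisson 0 x) * indicator {0..1} x) *
           (V (z * cis (2 * pi * x)) * ennreal (cmod (g (z * cis (2 * pi * x))) powr p)) \<partial>lborel)"
      by (subst nn_integral_cmult[symmetric]) (auto simp: mult_ac)
  qed
  also have "\<dots> = (\<integral>\<^sup>+z. V z * ennreal (cmod (g z) powr p) \<partial>lborel)"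
    by (subst nn_integral_rotation_average) (auto simp: nn_integral_poisson)
  also have "\<dots> = fock_mass p \<alpha> g (ball 0 r)"
    unfolding fock_mass_def V_def
    by (intro nn_integral_cong) (auto simp: fock_integrand_def ennreal_mult mult_ac split: split_indicator)
  also have "\<dots> = fock_mass p \<alpha> f (ball l r)"
    unfolding g_def by (simp add: fock_mass_translate_ball[OF f])
  finally show ?thesis .
qed

text \<open>The Gaussian splits into one factor per coordinate, each at most
  \<open>C / (1 + t)\<close> with \<open>t\<close> the squared coordinate, so \<open>decay\<close>
  is an integrable majorant.\<close>

lemma one_in_fock_space:
  assumes p: "1 \<le> p" and \<alpha>: "0 < \<alpha>"
  shows "(\<lambda>_. 1) \<in> fock_space p \<alpha>"
proof -
  define c where "c = p * \<alpha> / 2"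
  have c: "0 < c" using p \<alpha> by (simp add: c_def)
  define C where "C = max 1 (1 / c)"
  have one: "exp (- (c * t)) \<le> C / (1 + t)" if "0 \<le> t" for t
  proof -
    have "1 + t \<le> C * (1 + c * t)"
    proof -
      have "1 \<le> C" "1 / c \<le> C" by (auto simp: C_def)
      then have "1 * t \<le> (C * c) * t"
        using c that by (intro mult_right_mono) (auto simp: field_simps)
      then show ?thesis using \<open>1 \<le> C\<close> by (simp add: algebra_simps)
    qed
    also have "\<dots> \<le> C * exp (c * t)"
      by (intro mult_left_mono exp_ge_add_one_self) (auto simp: C_def)
    finally show ?thesis
      using that by (simp add: exp_minus field_simps)
  qed
  have le: "fock_integrand p \<alpha> (\<lambda>_. 1) z \<le> C\<^sup>2 * decay (0 - z)" for z
  proof -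
    have "fock_integrand p \<alpha> (\<lambda>_. 1) z = exp (- (c * (Re z)\<^sup>2)) * exp (- (c * (Im z)\<^sup>2))"
      by (simp add: fock_integrand_def c_def cmod_power2 field_simps flip: exp_add)
    also have "\<dots> \<le> (C / (1 + (Re z)\<^sup>2)) * (C / (1 + (Im z)\<^sup>2))"
      by (intro mult_mono one) (auto simp: C_def)
    finally show ?thesis
      by (simp add: decay_def power2_eq_square)
  qed
  have "fock_mass p \<alpha> (\<lambda>_. 1) UNIV \<le> (\<integral>\<^sup>+z. ennreal (C\<^sup>2) * ennreal (decay (0 - z)) \<partial>lborel)"
    unfolding fock_mass_def using le
    by (intro nn_integral_mono) (auto simp flip: ennreal_mult intro!: ennreal_leI)
  also have "\<dots> = ennreal (C\<^sup>2) * (\<integral>\<^sup>+z. ennreal (decay (0 - z)) \<partial>lborel)"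
    by (rule nn_integral_cmult) measurable
  also have "\<dots> \<le> ennreal (C\<^sup>2) * ennreal (pi\<^sup>2)"
    by (intro mult_left_mono nn_integral_decay) auto
  also have "\<dots> < \<infinity>"
    by (simp add: ennreal_mult_less_top)
  finally show ?thesis
    by (simp add: fock_space_iff)
qed

lemma fock_mass_one_pos:
  assumes p: "1 \<le> p" and \<alpha>: "0 < \<alpha>" and r: "0 < r"
  shows "0 < fock_mass p \<alpha> (\<lambda>_. 1) (ball 0 r)"
proof -
  have "0 < ennreal (exp (- (p * \<alpha> * r\<^sup>2 / 2))) * emeasure lborel (ball (0::complex) r)"
    using r by (simp add: emeasure_ball ennreal_zero_less_mult_iff unit_ball_vol_2)
  also have "\<dots> = (\<integral>\<^sup>+z. ennreal (exp (- (p * \<alpha> * r\<^sup>2 / 2))) * indicator (ball (0::complex) r) z \<partial>lborel)"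
    by (rule nn_integral_cmult_indicator[symmetric]) simp
  also have "\<dots> \<le> fock_mass p \<alpha> (\<lambda>_. 1) (ball 0 r)"
    unfolding fock_mass_def using p \<alpha> r
    by (intro nn_integral_mono)
      (auto simp: fock_integrand_def intro!: ennreal_leI power_mono mult_left_mono split: split_indicator)
  finally show ?thesis .
qed

lemma fock_mass_one_ball:
  assumes p: "1 \<le> p" and \<alpha>: "0 < \<alpha>"
  obtains I where "0 < I" "fock_mass p \<alpha> (\<lambda>_. 1) (ball 0 1) = ennreal I"
proof -
  obtain I where I: "fock_mass p \<alpha> (\<lambda>_. 1) (ball 0 1) = ennreal I" "0 \<le> I"
    using fock_mass_finite[OF one_in_fock_space[OF p \<alpha>], of "ball 0 1"] by (metis ennreal_cases infinity_ennreal_def less_irrefl)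
  moreover have "0 < I" using I fock_mass_one_pos[OF p \<alpha>, of 1] by (simp add: ennreal_less_iff)
  ultimately show ?thesis using that by blast
qed

subsection \<open>A maximum principle with radial weights\<close>

text \<open>On a disc that misses the origin, \<open>z powr \<kappa>\<close> has a branch with argument at most \<open>\<kappa> * pi / 2\<close>;
  so \<open>(z powr \<kappa> / (1 + \<epsilon> * z powr \<kappa>)) ^ N\<close> is holomorphic there, and its modulus is comparable,
  with a constant tending to \<open>1\<close> when \<open>\<kappa> * N\<close> is fixed and \<open>N \<rightarrow> \<infinity>\<close>, to a bounded radial weight.\<close>

definition radial_weight :: "real \<Rightarrow> real \<Rightarrow> complex \<Rightarrow> real" where
  "radial_weight \<kappa> \<epsilon> z = cmod z powr \<kappa> / (1 + \<epsilon> * cmod z powr \<kappa>)"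

lemma radial_weight_nonneg: "0 \<le> \<epsilon> \<Longrightarrow> 0 \<le> radial_weight \<kappa> \<epsilon> z"
  by (simp add: radial_weight_def)

lemma radial_weight_le: "0 < \<epsilon> \<Longrightarrow> radial_weight \<kappa> \<epsilon> z \<le> 1 / \<epsilon>"
  by (simp add: radial_weight_def divide_simps add_pos_nonneg)

lemma radial_weight_le_powr: "0 \<le> \<epsilon> \<Longrightarrow> radial_weight \<kappa> \<epsilon> z \<le> cmod z powr \<kappa>"
  by (simp add: radial_weight_def divide_le_eq add_pos_nonneg algebra_simps)

lemma continuous_radial_weight:
  assumes "0 < \<kappa>" "0 \<le> \<epsilon>"
  shows "continuous_on A (radial_weight \<kappa> \<epsilon>)"
proof -
  have nz: "1 + \<epsilon> * cmod z powr \<kappa> \<noteq> 0" for z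
    using assms by (metis add_pos_nonneg less_irrefl mult_nonneg_nonneg powr_ge_zero zero_less_one)
  show ?thesis
    unfolding radial_weight_def[abs_def] using nz assms
    by (intro continuous_intros continuous_on_powr') auto
qed

lemma holomorphic_radial_weight:
  assumes S: "\<And>z. z \<in> S \<Longrightarrow> 0 < Re (z * cnj l)" and \<kappa>: "0 < \<kappa>" "\<kappa> < 1" and \<epsilon>: "0 < \<epsilon>"
  obtains \<psi> where "\<psi> holomorphic_on S"
    "\<And>z. z \<in> S \<Longrightarrow> radial_weight \<kappa> \<epsilon> z \<le> cmod (\<psi> z)"
    "\<And>z. z \<in> S \<Longrightarrow> cmod (\<psi> z) * cos (\<kappa> * pi / 2) \<le> radial_weight \<kappa> \<epsilon> z"
proof -
  \<comment> \<open>The rotation taking \<open>l\<close> to the positive axis maps \<open>S\<close>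
    into the right half plane, where the principal branch has argument less than
    \<open>pi / 2\<close>.\<close>
  define v where "v z = z * cnj (sgn l)" for z
  define P where "P z = v z powr of_real \<kappa>" for z
  define \<psi> where "\<psi> z = P z / (1 + of_real \<epsilon> * P z)" for z
  have co: "0 < cos (\<kappa> * pi / 2)" "cos (\<kappa> * pi / 2) \<le> 1"
    using \<kappa> mult_strict_right_mono[of \<kappa> 1 pi] by (auto intro!: cos_gt_zero)
  have v: "0 < Re (v z)" "cmod (v z) = cmod z" "v z \<noteq> 0" if "z \<in> S" for z
  proof -
    have l: "l \<noteq> 0" using S[OF that] by auto
    have "v z = (z * cnj l) / of_real (cmod l)"
      by (simp add: v_def sgn_eq)
    then show re: "0 < Re (v z)"
      using S[OF that] l by (simp add: Re_divide_of_real)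
    then show "v z \<noteq> 0" by auto
    show "cmod (v z) = cmod z" using l by (simp add: v_def norm_mult norm_sgn)
  qed
  have P: "cmod (P z) = cmod z powr \<kappa>" "cos (\<kappa> * pi / 2) * cmod z powr \<kappa> \<le> Re (P z)" if z: "z \<in> S" for z
  proof -
    have "z \<noteq> 0" using v[OF z] by auto
    have eq: "P z = exp (of_real \<kappa> * Ln (v z))"
      using v[OF z] by (simp add: P_def powr_def)
    show n: "cmod (P z) = cmod z powr \<kappa>"
      using v[OF z] \<open>z \<noteq> 0\<close> by (simp add: eq Re_Ln powr_def)
    have "\<bar>Im (Ln (v z))\<bar> < pi / 2"
      using v[OF z] Re_Ln_pos_lt by blast
    then have "\<bar>\<kappa> * Im (Ln (v z))\<bar> \<le> \<kappa> * (pi / 2)"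
      using \<kappa> by (simp add: abs_mult mult_left_mono)
    then have "cos (\<kappa> * (pi / 2)) \<le> cos \<bar>\<kappa> * Im (Ln (v z))\<bar>"
      using \<kappa> by (intro cos_monotone_0_pi_le) (auto simp: field_simps intro: order_trans[of _ pi])
    moreover have "Re (P z) = cmod (P z) * cos (\<kappa> * Im (Ln (v z)))"
      by (simp add: eq Re_exp)
    ultimately have "cmod z powr \<kappa> * cos (\<kappa> * (pi / 2)) \<le> Re (P z)"
      unfolding n by (simp add: mult_left_mono)
    then show "cos (\<kappa> * pi / 2) * cmod z powr \<kappa> \<le> Re (P z)"
      by (simp add: mult.commute)
  qed
  \<comment> \<open>The argument of \<open>P z\<close> is at most \<open>\<kappa> * pi / 2\<close>,
    so adding 1 causes no cancellation; only the factor \<open>cos (\<kappa> * pi / 2)\<close> is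
    lost against the radial denominator.\<close>
  have den: "cos (\<kappa> * pi / 2) * (1 + \<epsilon> * cmod z powr \<kappa>) \<le> cmod (1 + of_real \<epsilon> * P z)"
    "cmod (1 + of_real \<epsilon> * P z) \<le> 1 + \<epsilon> * cmod z powr \<kappa>" if z: "z \<in> S" for z
  proof -
    have "cos (\<kappa> * pi / 2) * (1 + \<epsilon> * cmod z powr \<kappa>) = cos (\<kappa> * pi / 2) + \<epsilon> * (cos (\<kappa> * pi / 2) * cmod z powr \<kappa>)"
      by (simp add: algebra_simps)
    also have "\<dots> \<le> 1 + \<epsilon> * Re (P z)"
      using co P(2)[OF z] \<epsilon> by (intro add_mono mult_left_mono) auto
    also have "\<dots> = Re (1 + of_real \<epsilon> * P z)" by simp
    also have "\<dots> \<le> cmod (1 + of_real \<epsilon> * P z)" by (rule complex_Re_le_cmod)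
    finally show "cos (\<kappa> * pi / 2) * (1 + \<epsilon> * cmod z powr \<kappa>) \<le> cmod (1 + of_real \<epsilon> * P z)" .
    show "cmod (1 + of_real \<epsilon> * P z) \<le> 1 + \<epsilon> * cmod z powr \<kappa>"
      using norm_triangle_ineq[of 1 "of_real \<epsilon> * P z"] \<epsilon> by (simp add: norm_mult P(1)[OF z])
  qed
  have pos: "0 < 1 + \<epsilon> * cmod z powr \<kappa>" for z
    using \<epsilon> by (intro add_pos_nonneg) auto
  have dpos: "0 < cmod (1 + of_real \<epsilon> * P z)" if "z \<in> S" for z
    using den(1)[OF that] pos[of z] co(1) by (smt (verit) mult_pos_pos)
  show ?thesis
  proof (rule that[of \<psi>])
    have "v z \<notin> \<real>\<^sub>\<le>\<^sub>0" if "z \<in> S" for z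
      using v(1)[OF that] by (auto simp: complex_nonpos_Reals_iff)
    then have "P holomorphic_on S"
      unfolding P_def v_def by (intro holomorphic_intros) auto
    then show "\<psi> holomorphic_on S"
      unfolding \<psi>_def using dpos by (intro holomorphic_intros) auto
    show "radial_weight \<kappa> \<epsilon> z \<le> cmod (\<psi> z)" if "z \<in> S" for z
      unfolding radial_weight_def \<psi>_def norm_divide P(1)[OF that] using den(2)[OF that] dpos[OF that] pos[of z]
      by (intro divide_left_mono mult_pos_pos) auto
    show "cmod (\<psi> z) * cos (\<kappa> * pi / 2) \<le> radial_weight \<kappa> \<epsilon> z" if "z \<in> S" for z
    proof -
      have "cmod (\<psi> z) \<le> cmod z powr \<kappa> / (cos (\<kappa> * pi / 2) * (1 + \<epsilon> * cmod z powr \<kappa>))"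
        unfolding \<psi>_def norm_divide P(1)[OF that] using den(1)[OF that] dpos[OF that] pos[of z] co
        by (intro divide_left_mono mult_pos_pos) auto
      then have "cmod (\<psi> z) * cos (\<kappa> * pi / 2) \<le> cmod z powr \<kappa> / (cos (\<kappa> * pi / 2) * (1 + \<epsilon> * cmod z powr \<kappa>)) * cos (\<kappa> * pi / 2)"
        using co by (intro mult_right_mono) auto
      also have "\<dots> = radial_weight \<kappa> \<epsilon> z"
        using co by (simp add: radial_weight_def)
      finally show ?thesis .
    qed
  qed
qed

lemma maximum_modulus_cball:
  assumes f: "f holomorphic_on cball c r" and r: "0 < r" and z: "z \<in> cball c r"
    and B: "\<And>w. w \<in> sphere c r \<Longrightarrow> cmod (f w) \<le> B"
  shows "cmod (f z) \<le> B"
proof (rule maximum_modulus_frontier[of f "cball c r" B z])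
  show "f holomorphic_on interior (cball c r)"
    using f by (rule holomorphic_on_subset) (rule interior_subset)
  show "continuous_on (closure (cball c r)) f"
    using f by (simp add: holomorphic_on_imp_continuous_on)
qed (use B z in auto)

definition fock_weighted :: "real \<Rightarrow> (complex \<Rightarrow> complex) \<Rightarrow> complex \<Rightarrow> real" where
  "fock_weighted \<alpha> f z = cmod (f z) * exp (- (\<alpha> * (cmod z)\<^sup>2 / 2))"

lemma fock_weighted_nonneg: "0 \<le> fock_weighted \<alpha> f z"
  by (simp add: fock_weighted_def)

lemma fock_weighted_powr: "fock_integrand p \<alpha> f z = fock_weighted \<alpha> f z powr p"
  by (simp add: fock_weighted_def fock_integrand_def powr_mult powr_def[of "exp _"] mult_ac)

lemma fock_weighted_translate: "fock_weighted \<alpha> (fock_translate \<alpha> w f) z = fock_weighted \<alpha> f (z - w)"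
  using fock_integrand_translate[of 1 \<alpha> w f z] by (simp add: fock_weighted_powr fock_weighted_nonneg)

text \<open>If \<open>f\<close> vanishes to order \<open>m = \<alpha> * R\<^sup>2\<close> at \<open>l\<close>, then the maximum principle for
  \<open>f z * \<psi> z / (z - l) ^ m\<close> gains a factor less than \<open>1\<close> between the radii \<open>R - C\<close> and \<open>R - C / 2\<close>.\<close>

lemma fock_weighted_vanishing_core:
  assumes f: "f \<in> vanishing_space p \<alpha> l m" and m: "1 \<le> m" and \<alpha>: "0 < \<alpha>" and R: "R = sqrt (real m / \<alpha>)"
    and C: "0 < C" "C < R" and \<psi>: "\<psi> holomorphic_on cball l (R - C / 2)" and z: "cmod (z - l) \<le> R - C"
    and B: "\<And>w. cmod (w - l) = R - C / 2 \<Longrightarrow> fock_weighted \<alpha> f w * cmod (\<psi> w) \<le> B"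
  shows "fock_weighted \<alpha> f z * cmod (\<psi> z) \<le> exp (- (\<alpha> * C\<^sup>2 / 4)) * B"
proof -
  \<comment> \<open>Stopping short of \<open>R\<close> keeps the closed disc away from the origin
    when only \<open>R \<le> cmod l\<close> is known, and still leaves room for a gain.\<close>
  define r where "r = R - C / 2"
  have r: "0 < r" "R - C < r" "r < R" "r - R = - (C / 2)" using C by (auto simp: r_def)
  have mR: "real m = \<alpha> * R\<^sup>2" using \<alpha> by (simp add: R)
  define g where "g = fock_translate \<alpha> (- l) f"
  have "g \<in> vanishing_space p \<alpha> (l + - l) m"
    unfolding g_def by (rule vanishing_space_translate[OF f])
  then obtain h where h: "h holomorphic_on UNIV" "\<And>u. g u = (u - (l + - l)) ^ m * h u"
    using vanishing_space_factor by metis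
  have gw: "fock_weighted \<alpha> f (u + l) = cmod u ^ m * cmod (h u) * exp (- (\<alpha> * (cmod u)\<^sup>2 / 2))" for u
    using fock_weighted_translate[of \<alpha> "- l" f u] h(2)[of u] by (simp add: g_def fock_weighted_def norm_mult norm_power)
  define \<phi> where "\<phi> u = h u * \<psi> (u + l)" for u
  have "\<phi> holomorphic_on cball 0 r"
  proof -
    have "(\<psi> \<circ> (\<lambda>u. u + l)) holomorphic_on cball 0 r"
      by (rule holomorphic_on_compose_gen[OF _ \<psi>]) (auto intro!: holomorphic_intros simp: dist_norm r_def norm_minus_commute)
    then show ?thesis
      unfolding \<phi>_def o_def by (intro holomorphic_on_mult holomorphic_on_subset[OF h(1)]) auto
  qed
  define B' where "B' = B / (r ^ m * exp (- (\<alpha> * r\<^sup>2 / 2)))"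
  define u where "u = z - l"
  have le: "cmod (\<phi> u) \<le> B'"
  proof (rule maximum_modulus_cball[OF \<open>\<phi> holomorphic_on cball 0 r\<close> r(1)])
    show "u \<in> cball 0 r" using z r by (simp add: u_def)
    fix w :: complex assume "w \<in> sphere 0 r"
    then have w: "cmod w = r" by simp
    have "fock_weighted \<alpha> f (w + l) * cmod (\<psi> (w + l)) \<le> B"
      using w by (intro B) (simp add: r_def)
    then show "cmod (\<phi> w) \<le> B'"
      using r(1) by (simp add: gw w B'_def \<phi>_def norm_mult pos_le_divide_eq mult_ac)
  qed
  have B0: "0 \<le> B'" using le norm_ge_zero order_trans by blast
  define x where "x = cmod u"
  have x: "0 \<le> x" "x \<le> R - C" using z by (auto simp: x_def u_def)
  \<comment> \<open>Both \<open>r - x\<close> and the second factor are at least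
    \<open>C / 2\<close>.\<close>
  have "(x - r) * (R\<^sup>2 / r - (x + r) / 2) \<le> - (C\<^sup>2 / 4)"
  proof -
    have "R \<le> R\<^sup>2 / r" using r by (simp add: power2_eq_square pos_le_divide_eq)
    moreover have "C / 2 \<le> R - (x + r) / 2" using x C(1) by (simp add: r_def field_simps)
    ultimately have "C / 2 \<le> R\<^sup>2 / r - (x + r) / 2" by (rule order_trans[rotated, OF diff_right_mono])
    moreover have "C / 2 \<le> r - x" using x by (simp add: r_def)
    ultimately have "(C / 2) * (C / 2) \<le> (r - x) * (R\<^sup>2 / r - (x + r) / 2)"
      using C by (intro mult_mono) auto
    moreover have "(x - r) * Y = - ((r - x) * Y)" for Y
      by (simp add: algebra_simps)
    ultimately show ?thesis by (simp add: power2_eq_square)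
  qed
  then have "exp (\<alpha> * ((x - r) * (R\<^sup>2 / r - (x + r) / 2))) \<le> exp (- (\<alpha> * C\<^sup>2 / 4))"
    using \<alpha> mult_left_mono[of _ _ \<alpha>] by fastforce
  then have "r ^ m * exp (- (\<alpha> * r\<^sup>2 / 2)) * exp (\<alpha> * ((x - r) * (R\<^sup>2 / r - (x + r) / 2)))
     \<le> r ^ m * exp (- (\<alpha> * r\<^sup>2 / 2)) * exp (- (\<alpha> * C\<^sup>2 / 4))"
    using r(1) by (intro mult_left_mono) auto
  with weight_ratio_le[OF x(1) r(1) mR]
  have wr: "x ^ m * exp (- (\<alpha> * x\<^sup>2 / 2)) \<le> r ^ m * exp (- (\<alpha> * r\<^sup>2 / 2)) * exp (- (\<alpha> * C\<^sup>2 / 4))"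
    by (rule order_trans)
  have "fock_weighted \<alpha> f z * cmod (\<psi> z) = (x ^ m * exp (- (\<alpha> * x\<^sup>2 / 2))) * cmod (\<phi> u)"
    using gw[of u] by (simp add: u_def[symmetric] x_def \<phi>_def norm_mult) (simp add: u_def)
  also have "\<dots> \<le> (r ^ m * exp (- (\<alpha> * r\<^sup>2 / 2)) * exp (- (\<alpha> * C\<^sup>2 / 4))) * B'"
    using x(1) r(1) by (intro mult_mono[OF wr le]) auto
  also have "\<dots> = exp (- (\<alpha> * C\<^sup>2 / 4)) * B"
    using r(1) by (simp add: B'_def)
  finally show ?thesis .
qed

subsection \<open>Sampling divisors have finite overlap and cover the plane\<close>

lemma exp_quadratic_small:
  fixes K b e :: real
  assumes "0 \<le> K" "0 < b" "0 < e"
  obtains C where "0 < C" "K * exp (- (b * C\<^sup>2)) \<le> e"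
proof
  define C where "C = sqrt (K / (e * b)) + 1"
  show C: "0 < C" using assms by (simp add: C_def add_nonneg_pos)
  have "K / (e * b) = (sqrt (K / (e * b)))\<^sup>2"
    using assms by simp
  also have "\<dots> \<le> C\<^sup>2"
    using assms by (intro power_mono) (auto simp: C_def)
  finally have "K \<le> e * (b * C\<^sup>2)"
    using assms by (simp add: divide_le_eq mult_ac)
  also have "b * C\<^sup>2 \<le> exp (b * C\<^sup>2)"
    using exp_ge_add_one_self[of "b * C\<^sup>2"] by linarith
  then have "e * (b * C\<^sup>2) \<le> e * exp (b * C\<^sup>2)"
    using assms(3) by (intro mult_left_mono) auto
  finally have "K * exp (- (b * C\<^sup>2)) \<le> e * exp (b * C\<^sup>2) * exp (- (b * C\<^sup>2))"
    by (rule mult_right_mono) simp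
  then show "K * exp (- (b * C\<^sup>2)) \<le> e"
    by (simp add: mult.assoc flip: exp_add)
qed

text \<open>The normalized reproducing kernel at \<open>z\<close>, up to a constant factor.\<close>

abbreviation fock_kernel :: "real \<Rightarrow> complex \<Rightarrow> complex \<Rightarrow> complex" where
  "fock_kernel \<alpha> z \<equiv> fock_translate \<alpha> z (\<lambda>_. 1)"

lemma fock_mass_kernel_UNIV: "fock_mass p \<alpha> (fock_kernel \<alpha> z) UNIV = fock_mass p \<alpha> (\<lambda>_. 1) UNIV"
  by (rule fock_mass_translate_UNIV) simp

text \<open>The kernel keeps half of its mass in \<open>ball z r\<close>, with \<open>r\<close>
  independent of \<open>z\<close>. If \<open>z\<close> is deep enough in the disc of
  \<open>l\<close>, that ball lies in the shrunk disc, and the core estimate forces a large quotient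
  norm.\<close>

lemma quotient_norm_kernel_core:
  assumes p: "1 \<le> p" and \<alpha>: "0 < \<alpha>"
  obtains C \<eta> where "0 < C" "0 < \<eta>"
    "\<And>z l m. 1 \<le> m \<Longrightarrow> cmod (z - l) < sqrt (real m / \<alpha>) - C \<Longrightarrow>
       \<eta> \<le> quotient_norm p \<alpha> l m (fock_kernel \<alpha> z) powr p"
proof -
  have one: "(\<lambda>_. 1) \<in> fock_space p \<alpha>" by (rule one_in_fock_space[OF p \<alpha>])
  obtain I where I: "fock_mass p \<alpha> (\<lambda>_. 1) UNIV = ennreal I" "0 \<le> I"
    using fock_mass_finite[OF one, of UNIV] by (metis ennreal_cases infinity_ennreal_def less_irrefl)
  have "0 < fock_mass p \<alpha> (\<lambda>_. 1) UNIV"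
    using fock_mass_one_pos[OF p \<alpha>, of 1] fock_mass_mono[of "ball 0 1" UNIV p \<alpha> "\<lambda>_. 1"] by simp
  then have I0: "0 < I" using I by (simp add: ennreal_less_iff)
  \<comment> \<open>With 1/4 the error term is at most \<open>I / 4\<close>, half of the mass
    \<open>I / 2\<close> kept in the ball.\<close>
  obtain C1 where C1: "0 < C1" "4 powr p * exp (- (p * \<alpha> / 2 * C1\<^sup>2)) \<le> 1 / 4"
    using exp_quadratic_small[of "4 powr p" "p * \<alpha> / 2" "1 / 4"] p \<alpha> by auto
  obtain r where r: "0 < r" "fock_mass p \<alpha> (\<lambda>_. 1) (- ball 0 r) < ennreal (I / 2)"
    using fock_mass_tail[OF one, of "ennreal (I / 2)"] I0 by auto
  have "ennreal (I / 2) + ennreal (I / 2) = fock_mass p \<alpha> (\<lambda>_. 1) (ball 0 r) + fock_mass p \<alpha> (\<lambda>_. 1) (- ball 0 r)"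
    using I I0 fock_mass_union_complement[of "\<lambda>_. 1" "ball 0 r" p \<alpha>] by (simp flip: ennreal_plus)
  also have "\<dots> \<le> fock_mass p \<alpha> (\<lambda>_. 1) (ball 0 r) + ennreal (I / 2)"
    using r by (intro add_left_mono) auto
  finally have half: "ennreal (I / 2) \<le> fock_mass p \<alpha> (\<lambda>_. 1) (ball 0 r)"
    by (simp add: ennreal_add_left_cancel_le add.commute)
  define c where "c = 2 powr p * (1 + 2 powr p)"
  have c: "0 < c" by (simp add: c_def add_pos_pos)
  have "I / (4 * c) \<le> quotient_norm p \<alpha> l m (fock_kernel \<alpha> z) powr p"
    if m: "1 \<le> m" and z: "cmod (z - l) < sqrt (real m / \<alpha>) - (C1 + r)" for z l m
  proof -
    define Q where "Q = quotient_norm p \<alpha> l m (fock_kernel \<alpha> z) powr p"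
    have Q0: "0 \<le> Q" by (simp add: Q_def)
    have C1R: "C1 < sqrt (real m / \<alpha>)" using z r(1) norm_ge_zero[of "z - l"] by linarith
    have "ennreal (I / 2) \<le> fock_mass p \<alpha> (fock_kernel \<alpha> z) (ball z r)"
      using half by (simp add: fock_mass_translate_ball)
    also have "\<dots> \<le> fock_mass p \<alpha> (fock_kernel \<alpha> z) (ball l (sqrt (real m / \<alpha>) - C1))"
    proof (rule fock_mass_mono)
      show "ball z r \<subseteq> ball l (sqrt (real m / \<alpha>) - C1)"
      proof
        fix w assume "w \<in> ball z r"
        moreover have "dist l w \<le> dist z l + dist z w" by (rule dist_triangle3)
        ultimately show "w \<in> ball l (sqrt (real m / \<alpha>) - C1)"
          using z by (simp add: dist_norm)
      qed
    qed
    also have "\<dots> \<le> ennreal c * ennreal Q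
       + ennreal (4 powr p * exp (- (p * \<alpha> * C1\<^sup>2 / 2))) * fock_mass p \<alpha> (fock_kernel \<alpha> z) (ball l (sqrt (real m / \<alpha>)))"
      unfolding c_def Q_def using m C1(1) C1R p \<alpha>
      by (intro fock_mass_core_le_quotient_norm fock_space_translate one) auto
    also have "\<dots> \<le> ennreal c * ennreal Q + ennreal (1 / 4) * ennreal I"
    proof (intro add_left_mono mult_mono)
      show "ennreal (4 powr p * exp (- (p * \<alpha> * C1\<^sup>2 / 2))) \<le> ennreal (1 / 4)"
        using C1(2) by (intro ennreal_leI) simp
      show "fock_mass p \<alpha> (fock_kernel \<alpha> z) (ball l (sqrt (real m / \<alpha>))) \<le> ennreal I"
        using fock_mass_mono[of "ball l (sqrt (real m / \<alpha>))" UNIV p \<alpha> "fock_kernel \<alpha> z"] I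
        by (simp add: fock_mass_kernel_UNIV)
    qed auto
    also have "\<dots> = ennreal (c * Q + 1 / 4 * I)"
      using c Q0 I by (simp flip: ennreal_mult ennreal_plus)
    finally have "I / 2 \<le> c * Q + 1 / 4 * I"
      using c Q0 I by (subst (asm) ennreal_le_iff) auto
    then show ?thesis
      using c by (simp add: Q_def[symmetric] divide_le_eq mult_ac)
  qed
  then show ?thesis
    using that[of "C1 + r" "I / (4 * c)"] C1(1) r(1) I0 c by simp
qed

text \<open>Every competitor vanishes at \<open>l\<close>, so the value of the kernel at
  \<open>l\<close> survives subtraction, and a point value is bounded by the mass. This serves the
  discs too small for the core estimate.\<close>

lemma quotient_norm_kernel_near:
  assumes p: "1 \<le> p" and \<alpha>: "0 < \<alpha>"
  obtains \<eta> where "0 < \<eta>"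
    "\<And>z l m. 1 \<le> m \<Longrightarrow> cmod (z - l) \<le> \<rho> \<Longrightarrow> \<eta> \<le> quotient_norm p \<alpha> l m (fock_kernel \<alpha> z) powr p"
proof -
  have one: "(\<lambda>_. 1) \<in> fock_space p \<alpha>" by (rule one_in_fock_space[OF p \<alpha>])
  obtain I where I: "0 < I" "fock_mass p \<alpha> (\<lambda>_. 1) (ball 0 1) = ennreal I"
    using fock_mass_one_ball[OF p \<alpha>] .
  define e where "e = exp (- (p * \<alpha> * \<rho>\<^sup>2 / 2))"
  have "e * I \<le> quotient_norm p \<alpha> l m (fock_kernel \<alpha> z) powr p"
    if m: "1 \<le> m" and z: "cmod (z - l) \<le> \<rho>" for z l m
  proof -
    have "ennreal (e * I) \<le> ennreal (quotient_norm p \<alpha> l m (fock_kernel \<alpha> z) powr p)"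
    proof (rule quotient_norm_powr_ge)
      show k: "fock_kernel \<alpha> z \<in> fock_space p \<alpha>" by (rule fock_space_translate[OF one])
      fix g assume g: "g \<in> vanishing_space p \<alpha> l m"
      have "g l = 0" using g m by (force simp: vanishing_space_def)
      have "e \<le> fock_integrand p \<alpha> (fock_kernel \<alpha> z) l"
      proof -
        have "(cmod (l - z))\<^sup>2 \<le> \<rho>\<^sup>2"
          using z by (intro power_mono) (auto simp: norm_minus_commute)
        then have "p * \<alpha> * (cmod (l - z))\<^sup>2 \<le> p * \<alpha> * \<rho>\<^sup>2"
          using p \<alpha> by (intro mult_left_mono) auto
        then show ?thesis
          unfolding fock_integrand_translate e_def by (simp add: fock_integrand_def)
      qed
      also have "\<dots> = fock_integrand p \<alpha> (\<lambda>w. fock_kernel \<alpha> z w - g w) l"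
        using \<open>g l = 0\<close> by (simp add: fock_integrand_def)
      finally have "ennreal (e * I) \<le> ennreal (fock_integrand p \<alpha> (\<lambda>w. fock_kernel \<alpha> z w - g w) l) * ennreal I"
        using I by (simp flip: ennreal_mult add: mult_right_mono ennreal_leI)
      also have "\<dots> \<le> fock_mass p \<alpha> (\<lambda>w. fock_kernel \<alpha> z w - g w) (ball l 1)"
        unfolding I(2)[symmetric]
        using k vanishing_space_subset[OF g] p
        by (intro fock_integrand_le_local_mass holomorphic_on_diff) (auto dest: fock_space_holomorphic)
      also have "\<dots> \<le> fock_mass p \<alpha> (\<lambda>w. fock_kernel \<alpha> z w - g w) UNIV"
        by (rule fock_mass_mono) simp
      finally show "ennreal (e * I) \<le> fock_mass p \<alpha> (\<lambda>w. fock_kernel \<alpha> z w - g w) UNIV" .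
    qed (use p in auto)
    then show ?thesis by (subst (asm) ennreal_le_iff) auto
  qed
  then show ?thesis
    using that[of "e * I"] I(1) by (simp add: e_def)
qed

text \<open>Shift along the axis on which \<open>d\<close> has its larger component, which is at
  least \<open>7 / 10 * cmod d\<close>. To first order this shortens \<open>d\<close> by
  \<open>14 / 10 * C\<close>, more than the required \<open>C\<close>; the quadratic term is paid
  for by \<open>4 * C < R\<close>. So a point near the rim of a disc can be moved deep inside by one
  of four fixed shifts.\<close>

lemma shift_towards_center:
  fixes d :: complex and C R :: real
  assumes C: "0 < C" and R: "4 * C < R" and d: "cmod d < R"
  shows "\<exists>s\<in>{of_real (2 * C), - of_real (2 * C), \<i> * of_real (2 * C), - (\<i> * of_real (2 * C))}. cmod (d - s) < R - C"
proof -
  define t where "t = max \<bar>Re d\<bar> \<bar>Im d\<bar>"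
  have "\<exists>s\<in>{of_real (2 * C), - of_real (2 * C), \<i> * of_real (2 * C), - (\<i> * of_real (2 * C))}.
      (cmod (d - s))\<^sup>2 = (cmod d)\<^sup>2 - 4 * C * t + 4 * C\<^sup>2"
  proof -
    have sq: "(cmod (d - of_real a))\<^sup>2 = (cmod d)\<^sup>2 - 2 * a * Re d + a\<^sup>2"
      "(cmod (d - \<i> * of_real a))\<^sup>2 = (cmod d)\<^sup>2 - 2 * a * Im d + a\<^sup>2" for a
      unfolding cmod_power2 by (simp_all add: power2_eq_square algebra_simps)
    consider "t = Re d" | "t = - Re d" | "t = Im d" | "t = - Im d"
      unfolding t_def by linarith
    then show ?thesis
    proof cases
      case 1
      then show ?thesis using sq(1)[of "2 * C"] by (intro bexI[of _ "of_real (2 * C)"]) auto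
    next
      case 2
      then show ?thesis using sq(1)[of "- (2 * C)"] by (intro bexI[of _ "- of_real (2 * C)"]) auto
    next
      case 3
      then show ?thesis using sq(2)[of "2 * C"] by (intro bexI[of _ "\<i> * of_real (2 * C)"]) auto
    next
      case 4
      then show ?thesis using sq(2)[of "- (2 * C)"] by (intro bexI[of _ "- (\<i> * of_real (2 * C))"]) auto
    qed
  qed
  moreover have "(cmod d)\<^sup>2 - 4 * C * t + 4 * C\<^sup>2 < (R - C)\<^sup>2"
  proof -
    have "(7 / 10 * cmod d)\<^sup>2 \<le> t\<^sup>2"
    proof -
      have "(Re d)\<^sup>2 \<le> t\<^sup>2" "(Im d)\<^sup>2 \<le> t\<^sup>2"
        by (auto simp: t_def abs_le_square_iff[symmetric])
      then have "(cmod d)\<^sup>2 \<le> 2 * t\<^sup>2" by (simp add: cmod_power2)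
      moreover have "(7 / 10 * cmod d)\<^sup>2 = 49 / 100 * (cmod d)\<^sup>2" by (simp add: power2_eq_square)
      ultimately show ?thesis using zero_le_power2[of "cmod d"] by linarith
    qed
    then have t: "7 / 10 * cmod d \<le> t"
      by (rule power2_le_imp_le) (simp add: t_def)
    have "(cmod d)\<^sup>2 - 4 * C * t \<le> cmod d * (cmod d - 14 / 5 * C)"
      using mult_left_mono[OF t, of "4 * C"] C by (simp add: power2_eq_square algebra_simps)
    also have "\<dots> \<le> R * (R - 14 / 5 * C)"
    proof (cases "cmod d \<le> 14 / 5 * C")
      case True
      then have "cmod d * (cmod d - 14 / 5 * C) \<le> 0"
        by (intro mult_nonneg_nonpos) auto
      also have "0 \<le> R * (R - 14 / 5 * C)"
        using C R by (intro mult_nonneg_nonneg) auto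
      finally show ?thesis .
    next
      case False
      then show ?thesis using d C R by (intro mult_mono[of "cmod d" R]) auto
    qed
    finally have "(cmod d)\<^sup>2 - 4 * C * t \<le> R * (R - 14 / 5 * C)" .
    moreover have "R * (R - 14 / 5 * C) + 4 * C\<^sup>2 < (R - C)\<^sup>2"
    proof -
      have "C * (15 / 4 * C) < C * R" using C R by (intro mult_strict_left_mono) auto
      then show ?thesis by (simp add: power2_eq_square algebra_simps)
    qed
    ultimately show ?thesis by linarith
  qed
  ultimately obtain s where "s\<in>{of_real (2 * C), - of_real (2 * C), \<i> * of_real (2 * C), - (\<i> * of_real (2 * C))}"
    "(cmod (d - s))\<^sup>2 < (R - C)\<^sup>2" by metis
  then show ?thesis
    using C R by (intro bexI[of _ s] power2_less_imp_less[of "cmod (d - s)" "R - C"]) auto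
qed

text \<open>If \<open>z\<close> lies in the disc of \<open>l\<close>, one of five kernels centred at
  or near \<open>z\<close> has quotient norm bounded below at \<open>l\<close>. The number of such
  \<open>l\<close> is therefore controlled by five instances of the upper sampling bound.\<close>

lemma sampling_imp_finite_overlap:
  assumes p: "1 \<le> p" and \<alpha>: "0 < \<alpha>" and d: "divisor \<Lambda> m" and s: "sampling p \<alpha> \<Lambda> m"
  shows "finite_overlap \<alpha> \<Lambda> m"
proof -
  have one: "(\<lambda>_. 1) \<in> fock_space p \<alpha>" by (rule one_in_fock_space[OF p \<alpha>])
  obtain C \<eta>1 where C: "0 < C" "0 < \<eta>1" and core: "\<And>z l m. 1 \<le> m \<Longrightarrow> cmod (z - l) < sqrt (real m / \<alpha>) - C \<Longrightarrow>
       \<eta>1 \<le> quotient_norm p \<alpha> l m (fock_kernel \<alpha> z) powr p"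
    using quotient_norm_kernel_core[OF p \<alpha>] by metis
  obtain \<eta>2 where \<eta>2: "0 < \<eta>2" and near: "\<And>z l m. 1 \<le> m \<Longrightarrow> cmod (z - l) \<le> 4 * C \<Longrightarrow>
       \<eta>2 \<le> quotient_norm p \<alpha> l m (fock_kernel \<alpha> z) powr p"
    using quotient_norm_kernel_near[OF p \<alpha>, of "4 * C"] by metis
  obtain c C' where C': "0 < c" "c \<le> C'" and up: "\<And>f. f \<in> fock_space p \<alpha> \<Longrightarrow>
     quotient_sum p \<alpha> \<Lambda> m f \<le> ennreal (C' * fock_norm p \<alpha> f powr p)"
    using s unfolding sampling_def by blast
  define \<eta> where "\<eta> = min \<eta>1 \<eta>2"
  have \<eta>: "0 < \<eta>" using C \<eta>2 by (simp add: \<eta>_def)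
  \<comment> \<open>The shift 0 serves discs of radius at most \<open>4 * C\<close>, the other four
    serve larger discs.\<close>
  define Sh where "Sh = {0, of_real (2 * C), - of_real (2 * C), \<i> * of_real (2 * C), - (\<i> * of_real (2 * C))}"
  define Q where "Q l z = quotient_norm p \<alpha> l (m l) (fock_kernel \<alpha> z) powr p" for l z
  have Q0: "0 \<le> Q l z" for l z by (simp add: Q_def)
  have ex: "\<exists>s\<in>Sh. \<eta> \<le> Q l (z + s)" if l: "l \<in> \<Lambda>" and z: "z \<in> ball l (sqrt (real (m l) / \<alpha>))" for l z
  proof -
    have m1: "1 \<le> m l" using d l by (simp add: divisor_def)
    have zl: "cmod (l - z) < sqrt (real (m l) / \<alpha>)" using z by (simp add: dist_norm)
    show ?thesis
    proof (cases "4 * C < sqrt (real (m l) / \<alpha>)")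
      case True
      then obtain s where s: "s \<in> Sh" "cmod (l - z - s) < sqrt (real (m l) / \<alpha>) - C"
        using shift_towards_center[OF C(1) True zl] unfolding Sh_def by blast
      then have "cmod ((z + s) - l) < sqrt (real (m l) / \<alpha>) - C"
        by (simp add: norm_minus_commute[of "z + s" l] diff_diff_eq)
      from core[OF m1 this] s(1) show ?thesis
        by (intro bexI[of _ s]) (auto simp: Q_def \<eta>_def)
    next
      case False
      then have "cmod (z - l) \<le> 4 * C" using zl by (simp add: norm_minus_commute)
      from near[OF m1 this] show ?thesis
        by (intro bexI[of _ 0]) (auto simp: Q_def \<eta>_def Sh_def)
    qed
  qed
  have upk: "(\<Sum>l\<in>F. ennreal (Q l z)) \<le> ennreal C' * fock_mass p \<alpha> (\<lambda>_. 1) UNIV" if "finite F" "F \<subseteq> \<Lambda>" for F z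
  proof -
    have k: "fock_kernel \<alpha> z \<in> fock_space p \<alpha>" by (rule fock_space_translate[OF one])
    have "(\<Sum>l\<in>F. ennreal (Q l z)) \<le> (\<Sum>\<^sub>\<infinity>l\<in>\<Lambda>. ennreal (Q l z))"
      by (rule sum_le_infsum_ennreal[OF that])
    also have "\<dots> \<le> ennreal (C' * fock_norm p \<alpha> (fock_kernel \<alpha> z) powr p)"
      unfolding Q_def by (rule up[OF k])
    also have "\<dots> = ennreal C' * fock_mass p \<alpha> (\<lambda>_. 1) UNIV"
      using C' p fock_norm_powr[OF k] by (simp add: ennreal_mult fock_mass_kernel_UNIV)
    finally show ?thesis .
  qed
  define T where "T = ennreal (1 / \<eta>) * (5 * (ennreal C' * fock_mass p \<alpha> (\<lambda>_. 1) UNIV))"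
  have "overlap_const \<alpha> \<Lambda> m \<le> T"
    unfolding overlap_const_def
  proof (intro SUP_least infsum_ennreal_leI)
    fix z F assume F: "finite F" "F \<subseteq> \<Lambda>"
    have "(\<Sum>l\<in>F. indicator (ball l (sqrt (real (m l) / \<alpha>))) z) \<le> (\<Sum>l\<in>F. ennreal (1 / \<eta>) * (\<Sum>s\<in>Sh. ennreal (Q l (z + s))))"
    proof (rule sum_mono)
      fix l assume l: "l \<in> F"
      show "indicator (ball l (sqrt (real (m l) / \<alpha>))) z \<le> ennreal (1 / \<eta>) * (\<Sum>s\<in>Sh. ennreal (Q l (z + s)))"
      proof (cases "z \<in> ball l (sqrt (real (m l) / \<alpha>))")
        case True
        then obtain s where s: "s \<in> Sh" "\<eta> \<le> Q l (z + s)" using ex[of l z] l F by blast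
        have "(1::ennreal) = ennreal (1 / \<eta>) * ennreal \<eta>"
          using \<eta> by (simp flip: ennreal_mult)
        also have "\<dots> \<le> ennreal (1 / \<eta>) * ennreal (Q l (z + s))"
          using s by (intro mult_left_mono ennreal_leI) auto
        also have "\<dots> \<le> ennreal (1 / \<eta>) * (\<Sum>s\<in>Sh. ennreal (Q l (z + s)))"
          using s by (intro mult_left_mono member_le_sum) (auto simp: Sh_def)
        finally show ?thesis using True by simp
      qed simp
    qed
    also have "\<dots> = ennreal (1 / \<eta>) * (\<Sum>s\<in>Sh. \<Sum>l\<in>F. ennreal (Q l (z + s)))"
      unfolding sum_distrib_left[symmetric] by (subst sum.swap) (rule refl)
    also have "\<dots> \<le> ennreal (1 / \<eta>) * (\<Sum>s\<in>Sh. ennreal C' * fock_mass p \<alpha> (\<lambda>_. 1) UNIV)"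
      by (intro mult_left_mono sum_mono upk F) auto
    also have "\<dots> \<le> T"
    proof -
      have "card Sh \<le> 5"
        using card_length[of "[0, of_real (2 * C), - of_real (2 * C), \<i> * of_real (2 * C), - (\<i> * of_real (2 * C))]"]
        by (simp add: Sh_def)
      then have "of_nat (card Sh) \<le> (5::ennreal)"
        by (metis of_nat_le_iff of_nat_numeral)
      then show ?thesis
        unfolding T_def sum_constant by (intro mult_left_mono mult_right_mono) auto
    qed
    finally show "(\<Sum>l\<in>F. indicator (ball l (sqrt (real (m l) / \<alpha>))) z) \<le> T" .
  qed
  also have "T < \<infinity>"
    using fock_mass_finite[OF one, of UNIV] by (simp add: T_def ennreal_mult_less_top)
  finally show ?thesis
    by (simp add: finite_overlap_def)
qed

text \<open>If \<open>z\<close> has distance at least \<open>r\<close> from all discs, the quotient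
  sum of the kernel at \<open>z\<close> sees only its mass outside \<open>ball z r\<close>; for
  large \<open>r\<close> this contradicts the lower sampling bound.\<close>

lemma sampling_imp_cover:
  assumes p: "1 \<le> p" and \<alpha>: "0 < \<alpha>" and d: "divisor \<Lambda> m" and s: "sampling p \<alpha> \<Lambda> m"
  shows "\<exists>C>0. (\<Union>l\<in>\<Lambda>. ball l (sqrt (real (m l) / \<alpha>) + C)) = UNIV"
proof -
  have one: "(\<lambda>_. 1) \<in> fock_space p \<alpha>" by (rule one_in_fock_space[OF p \<alpha>])
  have S: "overlap_const \<alpha> \<Lambda> m < \<infinity>"
    using sampling_imp_finite_overlap[OF assms] by (simp add: finite_overlap_def)
  obtain c where c: "0 < c" and lo: "\<And>f. f \<in> fock_space p \<alpha> \<Longrightarrow>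
     ennreal (c * fock_norm p \<alpha> f powr p) \<le> quotient_sum p \<alpha> \<Lambda> m f"
    using s unfolding sampling_def by blast
  obtain A where A: "0 < A" "\<And>f l m. f \<in> fock_space p \<alpha> \<Longrightarrow> 1 \<le> m \<Longrightarrow>
       ennreal (quotient_norm p \<alpha> l m f powr p) \<le> ennreal A * fock_mass p \<alpha> f (ball l (sqrt (real m / \<alpha>)))"
    using quotient_norm_le_local_mass[OF \<alpha> p] by metis
  define I where "I = fock_mass p \<alpha> (\<lambda>_. 1) UNIV"
  have I: "0 < I"
    using fock_mass_one_pos[OF p \<alpha>, of 1] fock_mass_mono[of "ball 0 1" UNIV p \<alpha> "\<lambda>_. 1"] by (simp add: I_def)
  \<comment> \<open>The summand 1 keeps \<open>K\<close> positive, so that division by it is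
    possible even if the overlap is 0.\<close>
  define K where "K = ennreal A * overlap_const \<alpha> \<Lambda> m + 1"
  have K: "0 < K" "K < \<infinity>"
    using S by (auto simp: K_def ennreal_mult_less_top intro!: add_nonneg_pos)
  have "0 < ennreal c * I / K"
    using c I K by (simp add: ennreal_zero_less_divide ennreal_zero_less_mult_iff)
  from fock_mass_tail[OF one this] obtain r where r: "0 < r" "fock_mass p \<alpha> (\<lambda>_. 1) (- ball 0 r) < ennreal c * I / K" .
  have "z \<in> (\<Union>l\<in>\<Lambda>. ball l (sqrt (real (m l) / \<alpha>) + r))" for z
  proof (rule ccontr)
    assume z: "z \<notin> (\<Union>l\<in>\<Lambda>. ball l (sqrt (real (m l) / \<alpha>) + r))"
    have k: "fock_kernel \<alpha> z \<in> fock_space p \<alpha>" by (rule fock_space_translate[OF one])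
    have sub: "ball l (sqrt (real (m l) / \<alpha>)) \<subseteq> - ball z r" if "l \<in> \<Lambda>" for l
    proof
      fix w assume w: "w \<in> ball l (sqrt (real (m l) / \<alpha>))"
      have "sqrt (real (m l) / \<alpha>) + r \<le> dist l z" using z that by auto
      moreover have "dist l z \<le> dist l w + dist z w" by (rule dist_triangle2)
      ultimately show "w \<in> - ball z r" using w by simp
    qed
    have sets: "- ball z r \<in> sets borel" by (intro borel_closed closed_Compl open_ball)
    have "ennreal c * I = ennreal (c * fock_norm p \<alpha> (fock_kernel \<alpha> z) powr p)"
      using c p fock_norm_powr[OF k] by (simp add: ennreal_mult fock_mass_kernel_UNIV I_def)
    also have "\<dots> \<le> (\<Sum>\<^sub>\<infinity>l\<in>\<Lambda>. ennreal (quotient_norm p \<alpha> l (m l) (fock_kernel \<alpha> z) powr p))"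
      by (rule lo[OF k])
    also have "\<dots> \<le> ennreal A * (overlap_const \<alpha> \<Lambda> m * fock_mass p \<alpha> (fock_kernel \<alpha> z) (- ball z r))"
      by (rule infsum_quotient_norm_le[OF k d A(2)[OF k] sub sets])
    also have "\<dots> \<le> K * fock_mass p \<alpha> (fock_kernel \<alpha> z) (- ball z r)"
      unfolding K_def mult.assoc[symmetric] by (intro mult_right_mono) auto
    also have "fock_mass p \<alpha> (fock_kernel \<alpha> z) (- ball z r) = fock_mass p \<alpha> (\<lambda>_. 1) (- ball 0 r)"
    proof -
      have "{u. z + u \<in> - ball z r} = - ball 0 r" by (auto simp: dist_norm)
      then show ?thesis using fock_mass_translate[OF _ sets, of "\<lambda>_. 1"] by simp
    qed
    also have "K * fock_mass p \<alpha> (\<lambda>_. 1) (- ball 0 r) < K * (ennreal c * I / K)"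
      using r(2) K by (intro ennreal_mult_strict_left_mono) auto
    also have "\<dots> = ennreal c * I"
      using K by (simp add: ennreal_times_divide mult.commute[of K] ennreal_mult_divide_eq)
    finally show False by simp
  qed
  then show ?thesis using r(1) by blast
qed

subsection \<open>Uniqueness\<close>

lemma continuous_fock_weighted:
  assumes "f holomorphic_on UNIV"
  shows "continuous_on A (fock_weighted \<alpha> f)"
  unfolding fock_weighted_def[abs_def]
  by (intro continuous_intros continuous_on_subset[OF holomorphic_on_imp_continuous_on[OF assms]]) auto

text \<open>A large value at \<open>z\<close> forces mass on the unit disc around \<open>z\<close>,
  and the mass far out is small.\<close>

lemma fock_weighted_vanishes_at_infinity:
  assumes f: "f \<in> fock_space p \<alpha>" and p: "1 \<le> p" and \<alpha>: "0 < \<alpha>" and e: "0 < e"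
  obtains r where "\<And>z. r \<le> cmod z \<Longrightarrow> fock_weighted \<alpha> f z < e"
proof -
  define I where "I = fock_mass p \<alpha> (\<lambda>_. 1) (ball 0 1)"
  have I: "0 < I"
    using fock_mass_one_pos[OF p \<alpha>, of 1] by (simp add: I_def)
  have "0 < ennreal (e powr p) * I" using I e by (simp add: ennreal_zero_less_mult_iff)
  from fock_mass_tail[OF f this] obtain r where r: "0 < r" "fock_mass p \<alpha> f (- ball 0 r) < ennreal (e powr p) * I" .
  have "fock_weighted \<alpha> f z < e" if z: "r + 1 \<le> cmod z" for z
  proof (rule ccontr)
    assume "\<not> fock_weighted \<alpha> f z < e"
    then have "e powr p \<le> fock_integrand p \<alpha> f z"
      unfolding fock_weighted_powr using e p by (intro powr_mono2) auto
    then have "ennreal (e powr p) * I \<le> ennreal (fock_integrand p \<alpha> f z) * I"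
      by (intro mult_right_mono ennreal_leI) auto
    also have "\<dots> \<le> fock_mass p \<alpha> f (ball z 1)"
      unfolding I_def by (rule fock_integrand_le_local_mass[OF fock_space_holomorphic[OF f] p])
    also have "\<dots> \<le> fock_mass p \<alpha> f (- ball 0 r)"
    proof (rule fock_mass_mono)
      show "ball z 1 \<subseteq> - ball 0 r"
      proof
        fix w assume "w \<in> ball z 1"
        then show "w \<in> - ball 0 r"
          using z norm_triangle_ineq2[of z w] by (simp add: dist_norm)
      qed
    qed
    finally show False using r(2) by simp
  qed
  then show ?thesis using that by blast
qed

text \<open>Since \<open>1 - cos x\<close> is at most \<open>x\<^sup>2 / 2\<close>, Bernoulli's
  inequality shows that the loss of \<open>N\<close> factors with angle proportional to
  \<open>1 / N\<close> is of order \<open>1 / N\<close>. Splitting a fixed exponent \<open>s\<close>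
  into many small ones thus makes the loss as small as desired.\<close>

lemma cos_root_power_gt:
  fixes s q :: real
  assumes s: "0 < s" and q: "q < 1"
  obtains N :: nat where "0 < N" "s / real N < 1" "q < cos (s / real N * pi / 2) ^ N"
proof -
  obtain N :: nat where N: "max s (s\<^sup>2 * pi\<^sup>2 / (8 * (1 - q))) < real N"
    using reals_Archimedean2 by blast
  have N0: "0 < real N" "s < real N" using N s by auto
  define x where "x = s / real N * pi / 2"
  have x: "0 < x" "x < pi / 2" using N0 s by (auto simp: x_def field_simps)
  have "1 - cos x = 2 * (sin (x / 2))\<^sup>2"
    using cos_double_sin[of "x / 2"] by simp
  also have "\<dots> \<le> 2 * (x / 2)\<^sup>2"
    using x sin_x_le_x[of "x / 2"] sin_ge_zero[of "x / 2"] by (intro mult_left_mono power_mono) auto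
  finally have c: "1 - x\<^sup>2 / 2 \<le> cos x" by (simp add: power_divide)
  have "0 < cos x" using x by (intro cos_gt_zero) auto
  have "real N * (x\<^sup>2 / 2) = s\<^sup>2 * pi\<^sup>2 / (8 * real N)"
    using N0 by (simp add: x_def power_divide power_mult_distrib field_simps power2_eq_square)
  also have "\<dots> < 1 - q"
    using N N0 q by (simp add: field_simps)
  finally have "q < 1 + real N * (cos x - 1)"
    using mult_left_mono[OF c, of "real N"] N0 by (simp add: algebra_simps)
  also have "\<dots> \<le> (1 + (cos x - 1)) ^ N"
    using \<open>0 < cos x\<close> by (intro Bernoulli_inequality) auto
  finally show ?thesis
    using that[of N] N0 by (simp add: x_def)
qed

text \<open>Each of these discs counts 1 in the overlap at the origin. They admit no branch of a
  power and have to join the exceptional set.\<close>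

lemma finite_balls_containing_origin:
  assumes "overlap_const \<alpha> \<Lambda> m < \<infinity>"
  shows "finite {l \<in> \<Lambda>. 0 \<in> ball l (sqrt (real (m l) / \<alpha>))}"
proof (rule ccontr)
  define Z where "Z = {l \<in> \<Lambda>. 0 \<in> ball l (sqrt (real (m l) / \<alpha>))}"
  assume "infinite {l \<in> \<Lambda>. 0 \<in> ball l (sqrt (real (m l) / \<alpha>))}"
  then have inf: "infinite Z" by (simp add: Z_def)
  have "(\<Sum>\<^sub>\<infinity>l\<in>Z. indicator (ball l (sqrt (real (m l) / \<alpha>))) 0) = (\<infinity>::ennreal)"
    by (rule infsum_superconst_infinite_ennreal[of _ 1]) (use inf in \<open>auto simp: Z_def\<close>)
  moreover have "(\<Sum>\<^sub>\<infinity>l\<in>Z. indicator (ball l (sqrt (real (m l) / \<alpha>))) 0) \<le> overlap_const \<alpha> \<Lambda> m"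
  proof (rule infsum_ennreal_leI)
    fix F assume "finite F" "F \<subseteq> Z"
    then have "(\<Sum>l\<in>F. indicator (ball l (sqrt (real (m l) / \<alpha>))) 0) \<le> (\<Sum>\<^sub>\<infinity>l\<in>\<Lambda>. indicator (ball l (sqrt (real (m l) / \<alpha>))) 0 :: ennreal)"
      by (intro sum_le_infsum_ennreal) (auto simp: Z_def)
    also have "\<dots> \<le> overlap_const \<alpha> \<Lambda> m"
      unfolding overlap_const_def by (rule SUP_upper) auto
    finally show "(\<Sum>l\<in>F. indicator (ball l (sqrt (real (m l) / \<alpha>))) 0) \<le> overlap_const \<alpha> \<Lambda> m" .
  qed
  ultimately show False using assms by simp
qed

text \<open>Each passage through a covering disc gains the factor \<open>exp (- (\<alpha> * C\<^sup>2 / 4))\<close>, which pays for the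
  loss in replacing a radial weight by a holomorphic multiplier. So the weighted maximum is attained
  near the compact exceptional set for arbitrarily strong polynomial weights.\<close>

lemma vanishing_on_cover_decay:
  assumes f: "f \<in> fock_space p \<alpha>" and p: "1 \<le> p" and \<alpha>: "0 < \<alpha>" and C: "0 < C" and \<rho>: "0 < \<rho>"
    and cover: "\<And>z. \<rho> < cmod z \<Longrightarrow> \<exists>l k. 1 \<le> k \<and> f \<in> vanishing_space p \<alpha> l k \<and> sqrt (real k / \<alpha>) \<le> cmod l \<and>
       C < sqrt (real k / \<alpha>) \<and> cmod (z - l) < sqrt (real k / \<alpha>) - C"
    and M: "\<And>z. fock_weighted \<alpha> f z \<le> M" and s: "0 < s"
  shows "fock_weighted \<alpha> f z * cmod z powr s \<le> M * \<rho> powr s"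
proof -
  note fh = fock_space_holomorphic[OF f]
  have M0: "0 \<le> M" using M[of 0] fock_weighted_nonneg[of \<alpha> f 0] by linarith
  define q where "q = exp (- (\<alpha> * C\<^sup>2 / 4))"
  have q: "0 < q" "q < 1" using \<alpha> C by (auto simp: q_def)
  obtain N :: nat where N: "0 < N" "s / real N < 1" "q < cos (s / real N * pi / 2) ^ N"
    using cos_root_power_gt[OF s q(2)] by blast
  define \<kappa> where "\<kappa> = s / real N"
  have \<kappa>: "0 < \<kappa>" "\<kappa> < 1" using N s by (auto simp: \<kappa>_def)
  define ct where "ct = cos (\<kappa> * pi / 2)"
  have ct: "0 < ct" "q < ct ^ N"
  proof -
    have "0 < \<kappa> * pi / 2" "\<kappa> * pi / 2 < pi / 2" using \<kappa> mult_strict_right_mono[of \<kappa> 1 pi] by auto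
    then show "0 < ct" unfolding ct_def by (rule cos_gt_zero)
    show "q < ct ^ N" unfolding ct_def \<kappa>_def by (rule N(3))
  qed
  have pw: "(x powr \<kappa>) ^ N = x powr s" if "0 \<le> x" for x
    using that N(1) s by (cases "x = 0") (auto simp: powr_realpow[symmetric] powr_powr \<kappa>_def)
  have bound: "fock_weighted \<alpha> f z * radial_weight \<kappa> \<epsilon> z ^ N \<le> M * \<rho> powr s" if \<epsilon>: "0 < \<epsilon>" for \<epsilon> z
  proof (rule ccontr)
    define G where "G z = fock_weighted \<alpha> f z * radial_weight \<kappa> \<epsilon> z ^ N" for z
    assume "\<not> fock_weighted \<alpha> f z * radial_weight \<kappa> \<epsilon> z ^ N \<le> M * \<rho> powr s"
    then have z: "M * \<rho> powr s < G z" by (simp add: G_def)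
    then have Gz: "0 < G z" using M0 by (smt (verit) mult_nonneg_nonneg powr_ge_zero)
    have W0: "0 \<le> radial_weight \<kappa> \<epsilon> w" for w using radial_weight_nonneg \<epsilon> by simp
    have contG: "continuous_on A G" for A
      unfolding G_def using \<kappa> \<epsilon> by (intro continuous_intros continuous_fock_weighted fh continuous_radial_weight) auto
    have "0 < G z * \<epsilon> ^ N" using Gz \<epsilon> by simp
    from fock_weighted_vanishes_at_infinity[OF f p \<alpha> this]
    obtain r where r: "\<And>w. r \<le> cmod w \<Longrightarrow> fock_weighted \<alpha> f w < G z * \<epsilon> ^ N" by blast
    \<comment> \<open>The weight is at most \<open>1 / \<epsilon>\<close> and
      \<open>fock_weighted \<alpha> f\<close> tends to 0, so the maximum of \<open>G\<close> is
      attained; this is the reason for the regularization by \<open>\<epsilon>\<close>.\<close>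
    have far: "G w < G z" if "r \<le> cmod w" for w
    proof -
      have "G w \<le> fock_weighted \<alpha> f w * (1 / \<epsilon>) ^ N"
        unfolding G_def using \<epsilon> W0 radial_weight_le
        by (intro mult_left_mono power_mono fock_weighted_nonneg) auto
      also have "\<dots> < (G z * \<epsilon> ^ N) * (1 / \<epsilon>) ^ N"
        using r[OF that] \<epsilon> by (intro mult_strict_right_mono) auto
      also have "\<dots> = G z" using \<epsilon> by (simp add: power_divide)
      finally show ?thesis .
    qed
    have zr: "z \<in> cball 0 r" using far[of z] by (cases "r \<le> cmod z") auto
    then obtain y where y: "y \<in> cball 0 r" "\<And>w. w \<in> cball 0 r \<Longrightarrow> G w \<le> G y"
      using continuous_attains_sup[OF compact_cball _ contG[of "cball 0 r"]] by blast
    have ymax: "G w \<le> G y" for w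
      using y(2)[of w] y(2)[OF zr] far[of w] by (cases "r \<le> cmod w") auto
    have Gy: "M * \<rho> powr s < G y" "0 < G y" using ymax[of z] z Gz by auto
    \<comment> \<open>Within radius \<open>\<rho>\<close> the function \<open>G\<close> is at most
      \<open>M * \<rho> powr s\<close>, so the maximum point lies in a covering disc.\<close>
    have "\<rho> < cmod y"
    proof (rule ccontr)
      assume "\<not> \<rho> < cmod y"
      then have "radial_weight \<kappa> \<epsilon> y ^ N \<le> (\<rho> powr \<kappa>) ^ N"
        using radial_weight_le_powr[of \<epsilon> \<kappa> y] \<epsilon> W0 \<kappa> powr_mono2[of \<kappa> "cmod y" \<rho>]
        by (intro power_mono) auto
      then have "G y \<le> M * (\<rho> powr \<kappa>) ^ N"
        unfolding G_def using M[of y] W0 M0 by (intro mult_mono) auto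
      then show False using Gy(1) \<rho> by (simp add: pw)
    qed
    from cover[OF this] obtain l k where k: "1 \<le> k" "f \<in> vanishing_space p \<alpha> l k"
      and R: "sqrt (real k / \<alpha>) \<le> cmod l" "C < sqrt (real k / \<alpha>)" "cmod (y - l) < sqrt (real k / \<alpha>) - C"
      by blast
    define R where "R = sqrt (real k / \<alpha>)"
    \<comment> \<open>The closed disc about \<open>l\<close> has radius less than
      \<open>cmod l\<close>, hence lies in the half plane facing \<open>l\<close>.\<close>
    have half: "0 < Re (w * cnj l)" if "w \<in> cball l (R - C / 2)" for w
    proof -
      have "cmod (w - l) < cmod l"
        using that R(1) C by (simp add: dist_norm norm_minus_commute R_def)
      then have "(cmod (w - l))\<^sup>2 < (cmod l)\<^sup>2" by (intro power_strict_mono) auto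
      moreover have "2 * Re (w * cnj l) = (cmod w)\<^sup>2 + ((cmod l)\<^sup>2 - (cmod (w - l))\<^sup>2)"
        unfolding cmod_power2 by (simp add: power2_eq_square algebra_simps)
      ultimately show ?thesis using zero_le_power2[of "cmod w"] by linarith
    qed
    obtain \<psi> where \<psi>: "\<psi> holomorphic_on cball l (R - C / 2)"
      "\<And>w. w \<in> cball l (R - C / 2) \<Longrightarrow> radial_weight \<kappa> \<epsilon> w \<le> cmod (\<psi> w)"
      "\<And>w. w \<in> cball l (R - C / 2) \<Longrightarrow> cmod (\<psi> w) * ct \<le> radial_weight \<kappa> \<epsilon> w"
      using holomorphic_radial_weight[of "cball l (R - C / 2)" l \<kappa> \<epsilon>, OF half \<kappa> \<epsilon>] unfolding ct_def by blast
    have yin: "y \<in> cball l (R - C / 2)" using R(3) C by (simp add: dist_norm norm_minus_commute R_def)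
    have "fock_weighted \<alpha> f y * cmod (\<psi> y ^ N) \<le> exp (- (\<alpha> * C\<^sup>2 / 4)) * (G y / ct ^ N)"
    proof (rule fock_weighted_vanishing_core[OF k(2,1) \<alpha> R_def C])
      show "C < R" "cmod (y - l) \<le> R - C" using R by (auto simp: R_def)
      show "(\<lambda>w. \<psi> w ^ N) holomorphic_on cball l (R - C / 2)" using \<psi>(1) by (rule holomorphic_on_power)
      fix w assume "cmod (w - l) = R - C / 2"
      then have w: "w \<in> cball l (R - C / 2)" by (simp add: dist_norm norm_minus_commute)
      have "cmod (\<psi> w) \<le> radial_weight \<kappa> \<epsilon> w / ct" using \<psi>(3)[OF w] ct by (simp add: le_divide_eq)
      then have "fock_weighted \<alpha> f w * cmod (\<psi> w) ^ N \<le> fock_weighted \<alpha> f w * (radial_weight \<kappa> \<epsilon> w / ct) ^ N"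
        by (intro mult_left_mono power_mono fock_weighted_nonneg) auto
      also have "\<dots> = G w / ct ^ N" by (simp add: G_def power_divide)
      also have "\<dots> \<le> G y / ct ^ N" using ymax[of w] ct by (intro divide_right_mono) auto
      finally show "fock_weighted \<alpha> f w * cmod (\<psi> w ^ N) \<le> G y / ct ^ N" by (simp add: norm_power)
    qed
    moreover have "G y \<le> fock_weighted \<alpha> f y * cmod (\<psi> y ^ N)"
      unfolding G_def norm_power using \<psi>(2)[OF yin] W0 by (intro mult_left_mono power_mono fock_weighted_nonneg) auto
    ultimately have "G y \<le> q * (G y / ct ^ N)" by (simp add: q_def)
    \<comment> \<open>The gain \<open>q\<close> of the maximum principle outweighs the loss
      \<open>1 / ct ^ N\<close> in comparing the radial weight with its holomorphic substitute, by
      the choice of \<open>N\<close>.\<close>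
    also have "\<dots> < G y"
      using ct Gy(2) by (simp add: divide_less_eq mult.commute)
    finally show False by simp
  qed
  \<comment> \<open>The bound is uniform in \<open>\<epsilon>\<close>; as \<open>\<epsilon>\<close>
    tends to 0 the full weight returns, because \<open>\<kappa> * N = s\<close>.\<close>
  define a where "a = cmod z powr \<kappa>"
  have "((\<lambda>\<epsilon>. fock_weighted \<alpha> f z * (a / (1 + \<epsilon> * a)) ^ N) \<longlongrightarrow> fock_weighted \<alpha> f z * (a / (1 + 0 * a)) ^ N) (at_right 0)"
    by (intro tendsto_intros) auto
  moreover have "\<forall>\<^sub>F \<epsilon> in at_right 0. fock_weighted \<alpha> f z * (a / (1 + \<epsilon> * a)) ^ N \<le> M * \<rho> powr s"
    using bound[of _ z] unfolding radial_weight_def a_def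
    by (auto simp: eventually_at_right_field intro!: exI[of _ 1])
  ultimately have "fock_weighted \<alpha> f z * (a / (1 + 0 * a)) ^ N \<le> M * \<rho> powr s"
    by (rule tendsto_upperbound) simp
  then show ?thesis by (simp add: a_def pw)
qed

text \<open>Weights of exponent \<open>n\<close> give the bound
  \<open>M * (\<rho> / cmod z) ^ n\<close> for every positive \<open>n\<close>, so \<open>f\<close>
  is zero outside a disc, and then everywhere by the identity theorem.\<close>

lemma vanishing_on_cover_imp_zero:
  assumes f: "f \<in> fock_space p \<alpha>" and p: "1 \<le> p" and \<alpha>: "0 < \<alpha>" and C: "0 < C"
    and d: "divisor \<Lambda> m" and S: "overlap_const \<alpha> \<Lambda> m < \<infinity>"
    and v: "\<And>l. l \<in> \<Lambda> \<Longrightarrow> f \<in> vanishing_space p \<alpha> l (m l)"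
    and K: "bounded K" and cover: "- K \<subseteq> (\<Union>l\<in>{l\<in>\<Lambda>. C < sqrt (real (m l) / \<alpha>)}. ball l (sqrt (real (m l) / \<alpha>) - C))"
  shows "f z = 0"
proof -
  note fh = fock_space_holomorphic[OF f]
  define Z where "Z = {l \<in> \<Lambda>. 0 \<in> ball l (sqrt (real (m l) / \<alpha>))}"
  have "finite Z" unfolding Z_def by (rule finite_balls_containing_origin[OF S])
  then have "bounded (K \<union> (\<Union>l\<in>Z. ball l (sqrt (real (m l) / \<alpha>))))"
    using K by (auto intro: bounded_UN)
  then obtain \<rho> where \<rho>: "0 < \<rho>" "K \<union> (\<Union>l\<in>Z. ball l (sqrt (real (m l) / \<alpha>))) \<subseteq> ball 0 \<rho>"
    using bounded_subset_ballD by blast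
  have cov: "\<exists>l k. 1 \<le> k \<and> f \<in> vanishing_space p \<alpha> l k \<and> sqrt (real k / \<alpha>) \<le> cmod l \<and>
       C < sqrt (real k / \<alpha>) \<and> cmod (z - l) < sqrt (real k / \<alpha>) - C" if z: "\<rho> < cmod z" for z
  proof -
    have "z \<notin> ball 0 \<rho>" using z by simp
    then have z': "z \<notin> K" "\<And>l. l \<in> Z \<Longrightarrow> z \<notin> ball l (sqrt (real (m l) / \<alpha>))" using \<rho>(2) by blast+
    then obtain l where l: "l \<in> \<Lambda>" "C < sqrt (real (m l) / \<alpha>)" "z \<in> ball l (sqrt (real (m l) / \<alpha>) - C)"
      using cover by blast
    then have "z \<in> ball l (sqrt (real (m l) / \<alpha>))" using C by simp
    then have "l \<notin> Z" using z'(2) by blast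
    then have "sqrt (real (m l) / \<alpha>) \<le> cmod l" using l(1) by (simp add: Z_def)
    moreover have "cmod (z - l) < sqrt (real (m l) / \<alpha>) - C" using l(3) by (simp add: dist_norm norm_minus_commute)
    moreover have "1 \<le> m l" using d l(1) by (simp add: divisor_def)
    ultimately show ?thesis using l(2) v[OF l(1)] by blast
  qed
  obtain M where M: "\<And>z. fock_weighted \<alpha> f z \<le> M"
  proof -
    obtain r where r: "\<And>z. r \<le> cmod z \<Longrightarrow> fock_weighted \<alpha> f z < 1"
      using fock_weighted_vanishes_at_infinity[OF f p \<alpha>, of 1] by auto
    have "compact (fock_weighted \<alpha> f ` cball 0 r)"
      by (intro compact_continuous_image continuous_fock_weighted fh compact_cball)
    then obtain B where B: "\<And>z. z \<in> cball 0 r \<Longrightarrow> fock_weighted \<alpha> f z \<le> B"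
      using compact_imp_bounded[THEN bounded_imp_bdd_above] unfolding bdd_above_def by (metis imageI)
    have "fock_weighted \<alpha> f z \<le> max 1 B" for z
      using r[of z] B[of z] by (cases "r \<le> cmod z") auto
    then show ?thesis using that by blast
  qed
  have zero: "f z = 0" if z: "\<rho> < cmod z" for z
  proof -
    have z0: "0 < cmod z" using z \<rho>(1) by linarith
    have le: "fock_weighted \<alpha> f z \<le> M * (\<rho> / cmod z) ^ n" if n: "0 < n" for n :: nat
    proof -
      have "fock_weighted \<alpha> f z * cmod z powr real n \<le> M * \<rho> powr real n"
        by (rule vanishing_on_cover_decay[OF f p \<alpha> C \<rho>(1) cov M]) (use n in auto)
      then show ?thesis
        using z0 \<rho>(1) by (simp add: powr_realpow power_divide field_simps)
    qed
    have "(\<lambda>n. M * (\<rho> / cmod z) ^ n) \<longlonglongrightarrow> M * 0"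
      using z z0 \<rho>(1) by (intro tendsto_mult_left LIMSEQ_realpow_zero) auto
    moreover have "\<exists>N. \<forall>n\<ge>N. fock_weighted \<alpha> f z \<le> M * (\<rho> / cmod z) ^ n"
      using le by (intro exI[of _ 1]) auto
    ultimately have "fock_weighted \<alpha> f z \<le> M * 0"
      by (rule LIMSEQ_le_const)
    then show ?thesis using fock_weighted_nonneg[of \<alpha> f z] by (simp add: fock_weighted_def mult_le_0_iff)
  qed
  have op: "open {z::complex. \<rho> < cmod z}"
    by (intro open_Collect_less continuous_intros)
  have "complex_of_real (\<rho> + 1) \<in> {z. \<rho> < cmod z}" using \<rho>(1) by (simp add: norm_of_real del: of_real_add)
  then have "complex_of_real (\<rho> + 1) islimpt {z. \<rho> < cmod z}"
    using op by (metis interior_limit_point interior_open)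
  from analytic_continuation[OF fh open_UNIV connected_UNIV subset_UNIV UNIV_I this, of z] zero
  show ?thesis by simp
qed

subsection \<open>Covering divisors are sampling\<close>

text \<open>The local mass inequality on unit discs. The last bound makes the unit ball of the space
  a normal family.\<close>

lemma fock_point_bound:
  assumes p: "1 \<le> p" and \<alpha>: "0 < \<alpha>"
  obtains I where "0 < I"
    "\<And>f M z. f holomorphic_on UNIV \<Longrightarrow> 0 \<le> M \<Longrightarrow> fock_mass p \<alpha> f UNIV \<le> ennreal M \<Longrightarrow>
       fock_integrand p \<alpha> f z \<le> M / I"
    "\<And>f M z. f holomorphic_on UNIV \<Longrightarrow> 0 \<le> M \<Longrightarrow> fock_mass p \<alpha> f UNIV \<le> ennreal M \<Longrightarrow>
       cmod (f z) \<le> (M / I) powr (1 / p) * exp (\<alpha> * (cmod z)\<^sup>2 / 2)"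
proof -
  obtain I where I: "0 < I" "fock_mass p \<alpha> (\<lambda>_. 1) (ball 0 1) = ennreal I"
    using fock_mass_one_ball[OF p \<alpha>] .
  have pt: "fock_integrand p \<alpha> f z \<le> M / I"
    if f: "f holomorphic_on UNIV" and M: "0 \<le> M" "fock_mass p \<alpha> f UNIV \<le> ennreal M" for f M z
  proof -
    have "ennreal (fock_integrand p \<alpha> f z) * ennreal I \<le> fock_mass p \<alpha> f (ball z 1)"
      using fock_integrand_le_local_mass[OF f p, of \<alpha> z 1] by (simp add: I)
    also have "\<dots> \<le> ennreal M"
      using fock_mass_mono[of "ball z 1" UNIV p \<alpha> f] M(2) by simp
    finally have "fock_integrand p \<alpha> f z * I \<le> M"
      using M(1) I(1) by (simp flip: ennreal_mult)
    then show ?thesis using I(1) by (simp add: pos_le_divide_eq)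
  qed
  have "cmod (f z) \<le> (M / I) powr (1 / p) * exp (\<alpha> * (cmod z)\<^sup>2 / 2)"
    if f: "f holomorphic_on UNIV" "0 \<le> M" "fock_mass p \<alpha> f UNIV \<le> ennreal M" for f M z
  proof -
    have "(fock_weighted \<alpha> f z powr p) powr (1 / p) \<le> (M / I) powr (1 / p)"
      using pt[OF f, of z] p by (intro powr_mono2) (auto simp: fock_weighted_powr)
    then have "fock_weighted \<alpha> f z \<le> (M / I) powr (1 / p)"
      using p fock_weighted_nonneg[of \<alpha> f z] by (simp add: powr_powr)
    moreover have "cmod (f z) = fock_weighted \<alpha> f z * exp (\<alpha> * (cmod z)\<^sup>2 / 2)"
      by (simp add: fock_weighted_def mult.assoc flip: exp_add)
    ultimately show ?thesis by (simp add: mult_right_mono)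
  qed
  with I(1) pt show ?thesis using that by blast
qed

section \<open>Ingredients of the compactness argument\<close>

lemma fock_norm_cmult:
  assumes "0 < p"
  shows "fock_norm p \<alpha> (\<lambda>z. c * f z) = cmod c * fock_norm p \<alpha> f"
proof -
  have "(LINT z|lborel. fock_integrand p \<alpha> (\<lambda>z. c * f z) z) = cmod c powr p * (LINT z|lborel. fock_integrand p \<alpha> f z)"
    by (simp add: fock_integrand_def[abs_def] norm_mult powr_mult mult.assoc)
  then show ?thesis
    using assms by (simp add: fock_norm_def powr_mult powr_powr)
qed

lemma quotient_norm_cmult_le:
  assumes p: "0 < p" and c: "c \<noteq> 0"
  shows "quotient_norm p \<alpha> l k (\<lambda>z. c * f z) \<le> cmod c * quotient_norm p \<alpha> l k f"
proof -
  have "quotient_norm p \<alpha> l k (\<lambda>z. c * f z) / cmod c \<le> fock_norm p \<alpha> (\<lambda>z. f z - g z)"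
    if g: "g \<in> vanishing_space p \<alpha> l k" for g
  proof -
    have "(\<lambda>z. c * g z) \<in> vanishing_space p \<alpha> l k"
    proof -
      obtain h where h: "h holomorphic_on UNIV" "\<And>z. g z = (z - l) ^ k * h z"
        using vanishing_space_factor[OF g] by metis
      show ?thesis
      proof (rule vanishing_spaceI)
        show "(\<lambda>z. c * g z) \<in> fock_space p \<alpha>" by (rule fock_space_cmult[OF vanishing_space_subset[OF g]])
        show "(\<lambda>z. c * h z) holomorphic_on UNIV" by (intro holomorphic_intros h)
        show "c * g z = (z - l) ^ k * (c * h z)" for z by (simp add: h(2))
      qed
    qed
    from quotient_norm_le[OF this, of "\<lambda>z. c * f z"]
    have "quotient_norm p \<alpha> l k (\<lambda>z. c * f z) \<le> cmod c * fock_norm p \<alpha> (\<lambda>z. f z - g z)"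
      using fock_norm_cmult[OF p, of \<alpha> c "\<lambda>z. f z - g z"] by (simp add: right_diff_distrib)
    then show ?thesis using c by (simp add: divide_le_eq mult.commute)
  qed
  then have "quotient_norm p \<alpha> l k (\<lambda>z. c * f z) / cmod c \<le> quotient_norm p \<alpha> l k f"
    unfolding quotient_norm_def[of p \<alpha> l k f] using zero_in_vanishing_space[of p \<alpha> l k] by (intro cINF_greatest) auto
  then show ?thesis using c by (simp add: divide_le_eq mult.commute)
qed

text \<open>Subtracting a competitor does not change derivatives of order below \<open>k\<close> at
  \<open>l\<close>, and Cauchy's estimate on a unit circle bounds them by the mass. So quotient
  norms tending to 0 make these derivatives tend to 0.\<close>

lemma higher_deriv_le_quotient_norm:
  assumes p: "1 \<le> p" and \<alpha>: "0 < \<alpha>" and j: "j < k"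
  obtains \<kappa> where "0 < \<kappa>" "\<And>f. f \<in> fock_space p \<alpha> \<Longrightarrow> \<kappa> * cmod ((deriv ^^ j) f l) powr p \<le> quotient_norm p \<alpha> l k f powr p"
proof -
  define E where "E = exp (\<alpha> * (cmod l + 1)\<^sup>2 / 2)"
  obtain I where I0: "0 < I" and pt: "\<And>f M z. f holomorphic_on UNIV \<Longrightarrow> 0 \<le> M \<Longrightarrow> fock_mass p \<alpha> f UNIV \<le> ennreal M \<Longrightarrow>
       cmod (f z) \<le> (M / I) powr (1 / p) * exp (\<alpha> * (cmod z)\<^sup>2 / 2)"
    using fock_point_bound[OF p \<alpha>] by metis
  define \<kappa> where "\<kappa> = I / (fact j * E) powr p"
  have \<kappa>: "0 < \<kappa>" using I0 by (simp add: \<kappa>_def E_def)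
  have main: "ennreal (\<kappa> * cmod ((deriv ^^ j) h l) powr p) \<le> fock_mass p \<alpha> h UNIV" if h: "h \<in> fock_space p \<alpha>" for h
  proof -
    note hh = fock_space_holomorphic[OF h]
    obtain M where M: "fock_mass p \<alpha> h UNIV = ennreal M" "0 \<le> M"
      using fock_mass_finite[OF h, of UNIV] by (metis ennreal_cases infinity_ennreal_def less_irrefl)
    define B where "B = (M / I) powr (1 / p)"
    have "cmod ((deriv ^^ j) h l) \<le> fact j * (B * E) / 1 ^ j"
    proof (rule Cauchy_inequality)
      show "h holomorphic_on ball l 1" "continuous_on (cball l 1) h"
        using hh by (auto intro: holomorphic_on_subset holomorphic_on_imp_continuous_on)
      fix w assume w: "cmod (l - w) = 1"
      have "cmod w \<le> cmod l + 1" using norm_triangle_ineq2[of w l] w by (simp add: norm_minus_commute)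
      then have "(cmod w)\<^sup>2 \<le> (cmod l + 1)\<^sup>2" by (intro power_mono) auto
      then have "exp (\<alpha> * (cmod w)\<^sup>2 / 2) \<le> E" unfolding E_def using \<alpha> by simp
      then have "B * exp (\<alpha> * (cmod w)\<^sup>2 / 2) \<le> B * E" by (intro mult_left_mono) (auto simp: B_def)
      moreover have "cmod (h w) \<le> B * exp (\<alpha> * (cmod w)\<^sup>2 / 2)"
        unfolding B_def by (rule pt[OF hh M(2)]) (simp add: M(1))
      ultimately show "cmod (h w) \<le> B * E" by linarith
    qed simp
    then have "cmod ((deriv ^^ j) h l) powr p \<le> (fact j * E * B) powr p"
      using p by (intro powr_mono2) (auto simp: mult_ac)
    also have "\<dots> = (fact j * E) powr p * (M / I)"
      using p M(2) I0 by (simp add: powr_mult B_def powr_powr E_def)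
    finally have "\<kappa> * cmod ((deriv ^^ j) h l) powr p \<le> \<kappa> * ((fact j * E) powr p * (M / I))"
      using \<kappa> by (intro mult_left_mono) auto
    also have "\<dots> = M"
      using I0 by (simp add: \<kappa>_def E_def)
    finally show ?thesis using M by (simp add: ennreal_leI)
  qed
  have "\<kappa> * cmod ((deriv ^^ j) f l) powr p \<le> quotient_norm p \<alpha> l k f powr p" if f: "f \<in> fock_space p \<alpha>" for f
  proof -
    have "ennreal (\<kappa> * cmod ((deriv ^^ j) f l) powr p) \<le> ennreal (quotient_norm p \<alpha> l k f powr p)"
    proof (rule quotient_norm_powr_ge[OF f])
      fix g assume g: "g \<in> vanishing_space p \<alpha> l k"
      note gf = vanishing_space_subset[OF g]
      have "(deriv ^^ j) g l = 0" using g j by (simp add: vanishing_space_def)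
      then have "(deriv ^^ j) (\<lambda>z. f z - g z) l = (deriv ^^ j) f l"
        using higher_deriv_diff[OF fock_space_holomorphic[OF f] fock_space_holomorphic[OF gf], of l j] by simp
      moreover have "(\<lambda>z. f z - g z) \<in> fock_space p \<alpha>" using f gf p by (intro fock_space_diff) auto
      ultimately show "ennreal (\<kappa> * cmod ((deriv ^^ j) f l) powr p) \<le> fock_mass p \<alpha> (\<lambda>z. f z - g z) UNIV"
        using main by metis
    qed (use p in auto)
    then show ?thesis by (subst (asm) ennreal_le_iff) auto
  qed
  with \<kappa> show ?thesis using that by blast
qed

text \<open>The sum of the core estimates over the divisor. The full discs contribute at most
  \<open>S\<close> times the total mass, and the condition on \<open>C\<close> turns this into half
  of the total mass, ready to be absorbed.\<close>

lemma fock_mass_cover_le: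
  assumes f: "f \<in> fock_space p \<alpha>" and p: "1 \<le> p" and \<alpha>: "0 < \<alpha>" and d: "divisor \<Lambda> m" and C: "0 < C"
    and S: "overlap_const \<alpha> \<Lambda> m = ennreal S" "0 \<le> S" "4 powr p * S * exp (- (p * \<alpha> / 2 * C\<^sup>2)) \<le> 1 / 2"
  shows "fock_mass p \<alpha> f (\<Union>l\<in>{l\<in>\<Lambda>. C < sqrt (real (m l) / \<alpha>)}. ball l (sqrt (real (m l) / \<alpha>) - C))
    \<le> ennreal (2 powr p * (1 + 2 powr p)) * quotient_sum p \<alpha> \<Lambda> m f
       + ennreal (1 / 2) * fock_mass p \<alpha> f UNIV"
proof (rule fock_mass_UN_leI[OF fock_space_holomorphic[OF f]])
  show "countable {l \<in> \<Lambda>. C < sqrt (real (m l) / \<alpha>)}"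
    using d by (auto simp: divisor_def)
  define c where "c = 2 powr p * (1 + 2 powr p)"
  define e where "e = 4 powr p * exp (- (p * \<alpha> * C\<^sup>2 / 2))"
  fix F assume F: "finite F" "F \<subseteq> {l \<in> \<Lambda>. C < sqrt (real (m l) / \<alpha>)}"
  have F': "F \<subseteq> \<Lambda>" using F by auto
  have "(\<Sum>l\<in>F. fock_mass p \<alpha> f (ball l (sqrt (real (m l) / \<alpha>) - C)))
     \<le> (\<Sum>l\<in>F. ennreal c * ennreal (quotient_norm p \<alpha> l (m l) f powr p) + ennreal e * fock_mass p \<alpha> f (ball l (sqrt (real (m l) / \<alpha>))))"
    unfolding c_def e_def using F d p \<alpha> C
    by (intro sum_mono fock_mass_core_le_quotient_norm f) (auto simp: divisor_def)
  also have "\<dots> = ennreal c * (\<Sum>l\<in>F. ennreal (quotient_norm p \<alpha> l (m l) f powr p)) + ennreal e * (\<Sum>l\<in>F. fock_mass p \<alpha> f (ball l (sqrt (real (m l) / \<alpha>))))"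
    by (simp only: sum.distrib sum_distrib_left)
  also have "\<dots> \<le> ennreal c * quotient_sum p \<alpha> \<Lambda> m f + ennreal e * (overlap_const \<alpha> \<Lambda> m * fock_mass p \<alpha> f UNIV)"
    by (intro add_mono mult_left_mono sum_le_infsum_ennreal sum_fock_mass_le_overlap F F' fock_space_holomorphic[OF f]) auto
  also have "ennreal e * (overlap_const \<alpha> \<Lambda> m * fock_mass p \<alpha> f UNIV) = ennreal (e * S) * fock_mass p \<alpha> f UNIV"
    using S by (simp add: ennreal_mult e_def mult.assoc)
  also have "\<dots> \<le> ennreal (1 / 2) * fock_mass p \<alpha> f UNIV"
    using S(3) by (intro mult_right_mono ennreal_leI) (auto simp: e_def mult_ac)
  finally show "(\<Sum>l\<in>F. fock_mass p \<alpha> f (ball l (sqrt (real (m l) / \<alpha>) - C))) \<le> ennreal c * quotient_sum p \<alpha> \<Lambda> m f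
       + ennreal (1 / 2) * fock_mass p \<alpha> f UNIV"
    by (simp add: add_left_mono)
qed simp

text \<open>Compactness: a normalized sequence violating the bound has a nonzero limit vanishing on the divisor.\<close>

lemma cover_imp_lower_sampling_bound:
  assumes p: "1 \<le> p" and \<alpha>: "0 < \<alpha>" and d: "divisor \<Lambda> m" and C: "0 < C"
    and S: "overlap_const \<alpha> \<Lambda> m = ennreal S" "0 \<le> S" "4 powr p * S * exp (- (p * \<alpha> / 2 * C\<^sup>2)) \<le> 1 / 2"
    and K: "compact K" and cover: "- K \<subseteq> (\<Union>l\<in>{l\<in>\<Lambda>. C < sqrt (real (m l) / \<alpha>)}. ball l (sqrt (real (m l) / \<alpha>) - C))"
  shows "\<exists>c>0. \<forall>f\<in>fock_space p \<alpha>. ennreal c * fock_mass p \<alpha> f UNIV \<le> quotient_sum p \<alpha> \<Lambda> m f"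
proof (rule ccontr)
  assume neg: "\<not> ?thesis"
  define \<Sigma> where "\<Sigma> = quotient_sum p \<alpha> \<Lambda> m"
  have p0: "0 < p" using p by simp
  have "\<exists>f. f \<in> fock_space p \<alpha> \<and> fock_mass p \<alpha> f UNIV = 1 \<and> \<Sigma> f \<le> ennreal (1 / real (Suc n))" for n
  proof -
    have "0 < 1 / real (Suc n)" by simp
    with neg obtain f where f: "f \<in> fock_space p \<alpha>" "\<Sigma> f < ennreal (1 / real (Suc n)) * fock_mass p \<alpha> f UNIV"
      unfolding \<Sigma>_def by (meson not_le)
    obtain t where t: "fock_mass p \<alpha> f UNIV = ennreal t" "0 \<le> t"
      using fock_mass_finite[OF f(1), of UNIV] by (metis ennreal_cases infinity_ennreal_def less_irrefl)
    have "t \<noteq> 0" using f(2) t by auto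
    then have t0: "0 < t" using t(2) by simp
    define c where "c = t powr (- (1 / p))"
    have c: "0 < c" using t0 by (simp add: c_def)
    have cp: "c powr p = 1 / t" unfolding c_def powr_powr using t0 p0 by (simp add: powr_minus_divide)
    define g where "g z = of_real c * f z" for z
    have g: "g \<in> fock_space p \<alpha>" unfolding g_def by (rule fock_space_cmult[OF f(1)])
    have "fock_mass p \<alpha> g UNIV = ennreal (c powr p) * ennreal t"
      unfolding g_def t(1)[symmetric] using c
      by (subst fock_mass_cmult) (auto intro: measurable_entire fock_space_holomorphic[OF f(1)])
    then have 1: "fock_mass p \<alpha> g UNIV = 1"
      using cp t0 by (simp flip: ennreal_mult)
    have "\<Sigma> g \<le> ennreal (1 / t) * \<Sigma> f"
      unfolding \<Sigma>_def
    proof (rule infsum_ennreal_leI)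
      fix F assume F: "finite F" "F \<subseteq> \<Lambda>"
      have "(\<Sum>l\<in>F. ennreal (quotient_norm p \<alpha> l (m l) g powr p)) \<le> (\<Sum>l\<in>F. ennreal (1 / t) * ennreal (quotient_norm p \<alpha> l (m l) f powr p))"
      proof (rule sum_mono)
        fix l
        have "quotient_norm p \<alpha> l (m l) g \<le> c * quotient_norm p \<alpha> l (m l) f"
          unfolding g_def using quotient_norm_cmult_le[OF p0, of "of_real c"] c by simp
        then have "quotient_norm p \<alpha> l (m l) g powr p \<le> (c * quotient_norm p \<alpha> l (m l) f) powr p"
          using p0 by (intro powr_mono2 quotient_norm_nonneg) auto
        also have "\<dots> = 1 / t * quotient_norm p \<alpha> l (m l) f powr p"
          by (simp add: powr_mult cp)
        finally show "ennreal (quotient_norm p \<alpha> l (m l) g powr p) \<le> ennreal (1 / t) * ennreal (quotient_norm p \<alpha> l (m l) f powr p)"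
          using t0 by (subst ennreal_mult[symmetric]) (auto intro: ennreal_leI)
      qed
      also have "\<dots> \<le> ennreal (1 / t) * quotient_sum p \<alpha> \<Lambda> m f"
        unfolding sum_distrib_left[symmetric] by (intro mult_left_mono sum_le_infsum_ennreal F) auto
      finally show "(\<Sum>l\<in>F. ennreal (quotient_norm p \<alpha> l (m l) g powr p)) \<le> \<dots>" .
    qed
    also have "\<dots> \<le> ennreal (1 / t) * (ennreal (1 / real (Suc n)) * ennreal t)"
      using f(2) unfolding t(1) by (intro mult_left_mono) auto
    also have "\<dots> = ennreal (1 / real (Suc n))"
      using t0 by (simp flip: ennreal_mult)
    finally show ?thesis using g 1 by blast
  qed
  then obtain f where f: "\<And>n. f n \<in> fock_space p \<alpha>" "\<And>n. fock_mass p \<alpha> (f n) UNIV = 1" "\<And>n. \<Sigma> (f n) \<le> ennreal (1 / real (Suc n))"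
    by metis
  note fh = fock_space_holomorphic[OF f(1)]
  obtain I where I: "0 < I" "\<And>n z. fock_integrand p \<alpha> (f n) z \<le> 1 / I"
      "\<And>n z. cmod (f n z) \<le> (1 / I) powr (1 / p) * exp (\<alpha> * (cmod z)\<^sup>2 / 2)"
    using fock_point_bound[OF p \<alpha>] fh f(2) by (metis ennreal_1 order_refl zero_le_one)
  obtain g r where g: "g holomorphic_on UNIV" "strict_mono r" "\<And>z. (\<lambda>n. f (r n) z) \<longlonglongrightarrow> g z"
    and unif: "\<And>L. compact L \<Longrightarrow> uniform_limit L (f \<circ> r) g sequentially"
  proof (rule Montel[of UNIV "range f" f])
    show "h holomorphic_on UNIV" if "h \<in> range f" for h using that fh by auto
    show "\<exists>B. \<forall>h\<in>range f. \<forall>z\<in>L. cmod (h z) \<le> B" if L: "compact L" for L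
    proof -
      obtain b where b: "\<And>z. z \<in> L \<Longrightarrow> cmod z \<le> b"
        using compact_imp_bounded[OF L] by (auto simp: bounded_iff)
      have "cmod (f n z) \<le> (1 / I) powr (1 / p) * exp (\<alpha> * b\<^sup>2 / 2)" if z: "z \<in> L" for n z
      proof -
        have "(cmod z)\<^sup>2 \<le> b\<^sup>2" using b[OF z] by (intro power_mono) auto
        then have "exp (\<alpha> * (cmod z)\<^sup>2 / 2) \<le> exp (\<alpha> * b\<^sup>2 / 2)" using \<alpha> by simp
        then have "(1 / I) powr (1 / p) * exp (\<alpha> * (cmod z)\<^sup>2 / 2) \<le> (1 / I) powr (1 / p) * exp (\<alpha> * b\<^sup>2 / 2)"
          by (rule mult_left_mono) simp
        with I(3)[of n z] show ?thesis by linarith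
      qed
      then show ?thesis by blast
    qed
  qed auto
  have rn: "\<Sigma> (f (r n)) \<le> ennreal (1 / real (Suc n))" for n
  proof -
    have "1 / real (Suc (r n)) \<le> 1 / real (Suc n)"
      using seq_suble[OF g(2), of n] by (intro divide_left_mono) auto
    then show ?thesis using f(3)[of "r n"] by (meson ennreal_leI order_trans)
  qed
  have lim: "(\<lambda>n. fock_integrand p \<alpha> (f (r n)) z) \<longlonglongrightarrow> fock_integrand p \<alpha> g z" for z
  proof -
    have "(\<lambda>n. cmod (f (r n) z) powr p) \<longlonglongrightarrow> cmod (g z) powr p"
      using p by (intro tendsto_powr' tendsto_norm g(3) tendsto_const) auto
    then show ?thesis unfolding fock_integrand_def by (intro tendsto_mult_right)
  qed
  have [measurable]: "f n \<in> borel_measurable borel" "g \<in> borel_measurable borel" for n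
    using fh g(1) by (auto intro: measurable_entire)
  have [measurable]: "K \<in> sets borel" using K by (intro borel_closed compact_imp_closed)
  \<comment> \<open>By Fatou's lemma, the limit has mass at most 1.\<close>
  have gf: "g \<in> fock_space p \<alpha>"
  proof -
    have "fock_mass p \<alpha> g UNIV = (\<integral>\<^sup>+z. liminf (\<lambda>n. ennreal (fock_integrand p \<alpha> (f (r n)) z)) \<partial>lborel)"
      unfolding fock_mass_def
      by (intro nn_integral_cong) (simp add: lim_imp_Liminf[OF _ tendsto_ennrealI[OF lim]])
    also have "\<dots> \<le> liminf (\<lambda>n. \<integral>\<^sup>+z. ennreal (fock_integrand p \<alpha> (f (r n)) z) \<partial>lborel)"
      by (rule nn_integral_liminf) measurable
    also have "\<dots> = 1"
      using f(2) by (simp add: fock_mass_def Liminf_const)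
    finally show ?thesis
      using g(1) by (auto simp: fock_space_iff intro: le_less_trans)
  qed
  \<comment> \<open>Dominated convergence: the uniform point bound \<open>1 / I\<close> is
    integrable over the compact set.\<close>
  have massK: "(\<lambda>n. fock_mass p \<alpha> (f (r n)) K) \<longlonglongrightarrow> fock_mass p \<alpha> g K"
    unfolding fock_mass_def
  proof (rule nn_integral_dominated_convergence[where w="\<lambda>z. ennreal (1 / I) * indicator K z"])
    show "(\<integral>\<^sup>+z. ennreal (1 / I) * indicator K z \<partial>lborel) < \<infinity>"
      using emeasure_compact_finite[OF K] by (simp add: nn_integral_cmult_indicator ennreal_mult_less_top)
    show "AE z in lborel. (\<lambda>n. ennreal (fock_integrand p \<alpha> (f (r n)) z) * indicator K z) \<longlonglongrightarrow> ennreal (fock_integrand p \<alpha> g z) * indicator K z"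
      using tendsto_ennrealI[OF lim] by (intro AE_I2) (auto split: split_indicator)
    show "AE z in lborel. ennreal (fock_integrand p \<alpha> (f (r n)) z) * indicator K z \<le> ennreal (1 / I) * indicator K z" for n
      using I(2) by (intro AE_I2 mult_right_mono ennreal_leI) auto
  qed measurable
  define c where "c = 2 powr p * (1 + 2 powr p)"
  have c: "0 \<le> c" by (simp add: c_def)
  \<comment> \<open>Outside \<open>K\<close> lies at most half of the mass plus an error tending to
    0, so mass cannot escape to infinity and the limit is nonzero on \<open>K\<close>.\<close>
  have low: "ennreal (1 / 2) \<le> fock_mass p \<alpha> (f (r n)) K + ennreal (c * (1 / real (Suc n)))" for n
  proof -
    have "ennreal (1 / 2) + ennreal (1 / 2) = 1"
      by (subst ennreal_plus[symmetric]) auto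
    also have "\<dots> = fock_mass p \<alpha> (f (r n)) K + fock_mass p \<alpha> (f (r n)) (- K)"
      using fock_mass_union_complement[of "f (r n)" K p \<alpha>] f(2)[of "r n"] by simp
    also have "fock_mass p \<alpha> (f (r n)) (- K) \<le> ennreal c * \<Sigma> (f (r n)) + ennreal (1 / 2) * 1"
      using order_trans[OF fock_mass_mono[OF cover] fock_mass_cover_le[OF f(1) p \<alpha> d C S]]
      unfolding f(2) c_def \<Sigma>_def .
    also have "\<dots> \<le> ennreal c * ennreal (1 / real (Suc n)) + ennreal (1 / 2) * 1"
      by (intro add_right_mono mult_left_mono rn) simp
    also have "\<dots> = ennreal (c * (1 / real (Suc n))) + ennreal (1 / 2)"
      using c by (simp only: ennreal_mult' mult_1_right)
    finally have "ennreal (1 / 2) + ennreal (1 / 2) \<le> ennreal (1 / 2) + (fock_mass p \<alpha> (f (r n)) K + ennreal (c * (1 / real (Suc n))))"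
      by (simp add: add_left_mono add_ac)
    then show ?thesis by (simp add: ennreal_add_left_cancel_le)
  qed
  have "(\<lambda>n. fock_mass p \<alpha> (f (r n)) K + ennreal (c * (1 / real (Suc n)))) \<longlonglongrightarrow> fock_mass p \<alpha> g K + ennreal (c * 0)"
    by (intro tendsto_add massK tendsto_ennrealI tendsto_mult_left LIMSEQ_inverse_real_of_nat[unfolded inverse_eq_divide])
  then have "ennreal (1 / 2) \<le> fock_mass p \<alpha> g K + ennreal (c * 0)"
    by (rule LIMSEQ_le_const) (use low in blast)
  then have half: "ennreal (1 / 2) \<le> fock_mass p \<alpha> g K" by simp
  \<comment> \<open>Each single quotient norm is at most the whole sum, which tends to 0;
    derivatives pass to the locally uniform limit.\<close>
  have van: "g \<in> vanishing_space p \<alpha> l (m l)" if l: "l \<in> \<Lambda>" for l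
  proof -
    have "(deriv ^^ j) g l = 0" if j: "j < m l" for j
    proof -
      obtain \<kappa> where \<kappa>: "0 < \<kappa>" "\<And>f. f \<in> fock_space p \<alpha> \<Longrightarrow> \<kappa> * cmod ((deriv ^^ j) f l) powr p \<le> quotient_norm p \<alpha> l (m l) f powr p"
        using higher_deriv_le_quotient_norm[OF p \<alpha> j] by metis
      have le: "\<kappa> * cmod ((deriv ^^ j) (f (r n)) l) powr p \<le> 1 / real (Suc n)" for n
      proof -
        have "ennreal (\<kappa> * cmod ((deriv ^^ j) (f (r n)) l) powr p) \<le> ennreal (quotient_norm p \<alpha> l (m l) (f (r n)) powr p)"
          by (intro ennreal_leI \<kappa>(2) f(1))
        also have "\<dots> \<le> \<Sigma> (f (r n))"
          unfolding \<Sigma>_def using sum_le_infsum_ennreal[of "{l}" \<Lambda>] l by simp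
        also note rn[of n]
        finally show ?thesis by (subst (asm) ennreal_le_iff) auto
      qed
      have ul: "uniform_limit (ball l 1) (\<lambda>n. f (r n)) g sequentially"
        using uniform_limit_on_subset[OF unif[OF compact_cball[of l 1]] ball_subset_cball] by (simp add: o_def)
      have "(\<lambda>n. (deriv ^^ j) (f (r n)) l) \<longlonglongrightarrow> (deriv ^^ j) g l"
        by (rule higher_deriv_complex_uniform_limit[OF ul])
           (auto intro!: always_eventually holomorphic_on_subset[OF fh])
      then have "(\<lambda>n. \<kappa> * cmod ((deriv ^^ j) (f (r n)) l) powr p) \<longlonglongrightarrow> \<kappa> * cmod ((deriv ^^ j) g l) powr p"
        using p by (intro tendsto_mult_left tendsto_powr' tendsto_norm tendsto_const) auto
      moreover have "(\<lambda>n. 1 / real (Suc n)) \<longlonglongrightarrow> 0"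
        by (rule LIMSEQ_inverse_real_of_nat[unfolded inverse_eq_divide])
      ultimately have "\<kappa> * cmod ((deriv ^^ j) g l) powr p \<le> 0"
        by (rule LIMSEQ_le) (use le in blast)
      then show ?thesis using \<kappa>(1) by (simp add: mult_le_0_iff)
    qed
    then show ?thesis using gf by (simp add: vanishing_space_def)
  qed
  have "overlap_const \<alpha> \<Lambda> m < \<infinity>" using S(1) by simp
  from vanishing_on_cover_imp_zero[OF gf p \<alpha> C d this van compact_imp_bounded[OF K] cover]
  have "fock_mass p \<alpha> g K = 0"
    by (simp add: fock_mass_def fock_integrand_def)
  with half show False by simp
qed

lemma cover_imp_sampling:
  assumes p: "1 \<le> p" and \<alpha>: "0 < \<alpha>" and d: "divisor \<Lambda> m" and C: "0 < C"
    and S: "overlap_const \<alpha> \<Lambda> m = ennreal S" "0 \<le> S" "4 powr p * S * exp (- (p * \<alpha> / 2 * C\<^sup>2)) \<le> 1 / 2"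
    and K: "compact K" and cover: "- K \<subseteq> (\<Union>l\<in>{l\<in>\<Lambda>. C < sqrt (real (m l) / \<alpha>)}. ball l (sqrt (real (m l) / \<alpha>) - C))"
  shows "sampling p \<alpha> \<Lambda> m"
proof -
  obtain c where c: "0 < c" and lower: "\<And>f. f \<in> fock_space p \<alpha> \<Longrightarrow>
      ennreal c * fock_mass p \<alpha> f UNIV \<le> quotient_sum p \<alpha> \<Lambda> m f"
    using cover_imp_lower_sampling_bound[OF assms] by blast
  obtain A where A: "0 < A" "\<And>f l m. f \<in> fock_space p \<alpha> \<Longrightarrow> 1 \<le> m \<Longrightarrow>
       ennreal (quotient_norm p \<alpha> l m f powr p) \<le> ennreal A * fock_mass p \<alpha> f (ball l (sqrt (real m / \<alpha>)))"
    using quotient_norm_le_local_mass[OF \<alpha> p] by metis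
  \<comment> \<open>The maximum secures \<open>c \<le> C'\<close>.\<close>
  define C' where "C' = max c (A * S)"
  have "ennreal (c * fock_norm p \<alpha> f powr p) \<le> quotient_sum p \<alpha> \<Lambda> m f \<and>
     quotient_sum p \<alpha> \<Lambda> m f \<le> ennreal (C' * fock_norm p \<alpha> f powr p)"
    if f: "f \<in> fock_space p \<alpha>" for f
  proof
    have norm: "ennreal (x * fock_norm p \<alpha> f powr p) = ennreal x * fock_mass p \<alpha> f UNIV" if "0 \<le> x" for x
      using that p fock_norm_powr[OF f] by (simp add: ennreal_mult)
    show "ennreal (c * fock_norm p \<alpha> f powr p) \<le> quotient_sum p \<alpha> \<Lambda> m f"
      using lower[OF f] c by (simp add: norm)
    have "quotient_sum p \<alpha> \<Lambda> m f \<le> ennreal A * (overlap_const \<alpha> \<Lambda> m * fock_mass p \<alpha> f UNIV)"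
      by (rule infsum_quotient_norm_le[OF f d A(2)[OF f]]) auto
    also have "\<dots> = ennreal (A * S) * fock_mass p \<alpha> f UNIV"
      using A(1) S(2) by (simp add: S(1) ennreal_mult mult.assoc)
    also have "\<dots> \<le> ennreal C' * fock_mass p \<alpha> f UNIV"
      by (intro mult_right_mono ennreal_leI) (auto simp: C'_def)
    finally show "quotient_sum p \<alpha> \<Lambda> m f \<le> ennreal (C' * fock_norm p \<alpha> f powr p)"
      using c by (simp add: norm C'_def)
  qed
  then show ?thesis
    unfolding sampling_def using c by (intro exI[of _ c] exI[of _ C']) (auto simp: C'_def)
qed

text \<open>In (b) the function \<open>C\<close> is fixed before the divisor is given; this
  expresses that the constant depends on the overlap alone.\<close>

theorem theorem8p1:
  fixes p \<alpha> :: real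
  assumes "2 < p" and "0 < \<alpha>"
  shows "(\<forall>\<Lambda> m. divisor \<Lambda> m \<longrightarrow> sampling p \<alpha> \<Lambda> m \<longrightarrow>
            finite_overlap \<alpha> \<Lambda> m \<and>
            (\<exists>C>0. (\<Union>l\<in>\<Lambda>. ball l (sqrt (real (m l) / \<alpha>) + C)) = UNIV)) \<and>
         (\<exists>C :: ennreal \<Rightarrow> real. (\<forall>S. 0 < C S) \<and>
            (\<forall>\<Lambda> m. divisor \<Lambda> m \<longrightarrow> finite_overlap \<alpha> \<Lambda> m \<longrightarrow>
               (let C\<^sub>X = C (overlap_const \<alpha> \<Lambda> m) in
                 (\<exists>K. compact K \<and>
                    (\<Union>l\<in>{l\<in>\<Lambda>. real (m l) > \<alpha> * C\<^sub>X\<^sup>2}. ball l (sqrt (real (m l) / \<alpha>) - C\<^sub>X)) = UNIV - K)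
                 \<longrightarrow> sampling p \<alpha> \<Lambda> m)))"
proof -
  have p: "1 \<le> p" using assms(1) by simp
  \<comment> \<open>A value is needed for every \<open>S\<close>; \<open>enn2real\<close> has the
    default 0 at infinity and returns the true constant under finite overlap.\<close>
  have "\<exists>C. 0 < C \<and> 4 powr p * enn2real S * exp (- (p * \<alpha> / 2 * C\<^sup>2)) \<le> 1 / 2" for S
    using exp_quadratic_small[of "4 powr p * enn2real S" "p * \<alpha> / 2" "1 / 2"] assms by (auto simp: enn2real_nonneg)
  then obtain C where C: "\<And>S. 0 < C S" "\<And>S. 4 powr p * enn2real S * exp (- (p * \<alpha> / 2 * (C S)\<^sup>2)) \<le> 1 / 2"
    by metis
  have "sampling p \<alpha> \<Lambda> m" if d: "divisor \<Lambda> m" and fin: "finite_overlap \<alpha> \<Lambda> m"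
    and K: "compact K" and cover: "(\<Union>l\<in>{l\<in>\<Lambda>. real (m l) > \<alpha> * (C (overlap_const \<alpha> \<Lambda> m))\<^sup>2}.
        ball l (sqrt (real (m l) / \<alpha>) - C (overlap_const \<alpha> \<Lambda> m))) = UNIV - K" for \<Lambda> m K
  proof (rule cover_imp_sampling[OF p assms(2) d C(1) _ enn2real_nonneg C(2) K])
    show "overlap_const \<alpha> \<Lambda> m = ennreal (enn2real (overlap_const \<alpha> \<Lambda> m))"
      using fin by (simp add: finite_overlap_def)
    have "C (overlap_const \<alpha> \<Lambda> m) < sqrt (real (m l) / \<alpha>)" if "\<alpha> * (C (overlap_const \<alpha> \<Lambda> m))\<^sup>2 < real (m l)" for l
      using that assms(2) C(1)[of "overlap_const \<alpha> \<Lambda> m"] by (intro real_less_rsqrt) (simp add: less_divide_eq mult.commute)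
    then show "- K \<subseteq> (\<Union>l\<in>{l \<in> \<Lambda>. C (overlap_const \<alpha> \<Lambda> m) < sqrt (real (m l) / \<alpha>)}.
        ball l (sqrt (real (m l) / \<alpha>) - C (overlap_const \<alpha> \<Lambda> m)))"
      unfolding Compl_eq_Diff_UNIV cover[symmetric] by (intro UN_mono) auto
  qed
  then have b: "\<exists>C :: ennreal \<Rightarrow> real. (\<forall>S. 0 < C S) \<and>
            (\<forall>\<Lambda> m. divisor \<Lambda> m \<longrightarrow> finite_overlap \<alpha> \<Lambda> m \<longrightarrow>
               (let C\<^sub>X = C (overlap_const \<alpha> \<Lambda> m) in
                 (\<exists>K. compact K \<and>
                    (\<Union>l\<in>{l\<in>\<Lambda>. real (m l) > \<alpha> * C\<^sub>X\<^sup>2}. ball l (sqrt (real (m l) / \<alpha>) - C\<^sub>X)) = UNIV - K)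
                 \<longrightarrow> sampling p \<alpha> \<Lambda> m))"
    unfolding Let_def using C(1) by (intro exI[of _ C] conjI allI impI) blast+
  show ?thesis
    using sampling_imp_finite_overlap[OF p assms(2)] sampling_imp_cover[OF p assms(2)] b by blast
qed

end
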